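(* Let $(\xi_j)_{j\ge0}$ be a homogeneous (not necessarily stationary) Markov chain on a measurable space $\mathcal X$ with Markov operator $Rg(x)=\mathbb E[g(\xi_1)\mid\xi_0=x]$, and let $(B,\|\cdot\|)$ and $f\in B$ (real-valued) satisfy the standing assumptions listed in the context. Let $S_n=\sum_{j=1}^n(f(\xi_j)-\mathbb E[f(\xi_j)])$, $\sigma_n=\|S_n\|_{L^2}$, and assume $\sigma^2:=\lim_{n\to\infty}\frac1n\mathrm{Var}(S_n)>0$, $\sigma>0$. Then: (1) There are functions $\Pi(z),U(z),\delta_n(z)$ ($n\ge1$), analytic on a common complex neighborhood of $0$, and constants $C>0$, $\delta\in(0,1)$, such that $\Pi(0)=0$, $\Pi''(0)>0$, $U(0)=1$, $|\delta_n(z)|\le C\delta^n$, and $\mathbb E[e^{zS_n}]=e^{n\Pi(z)}(U(z)+\delta_n(z))$ for all $n$ and all $z$ in that neighborhood. (2) Consequently, for every bounded real sequence $(A_n)$ and every positive sequence $(B_n)$ with either $B_n=\sigma\sqrt n+O(1)$ or $B_n=\sigma_n+O(1)$, and every integer $m\ge2$, there is a constant $C_m$ such that for all $n$ with $\sigma_n>0$ and all $x\in\mathbb R$, $$\left|\mathbb P\left(\frac{S_n-A_n}{B_n}\le x\right)-\Phi(x)\right|\le C_m\sigma_n^{-1}(1+|x|)^{-m}.$$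
   Context: $\Phi$ is the standard normal distribution function. Standing assumptions: $(B,\|\cdot\|)$ is a complex Banach space of functions on $\mathcal X$ containing the constant functions, with $\|g\|\ge\sup|g|$; $R$ acts continuously on $B$; for every $f\in B$ and $z\in\mathbb C$ one has $e^{zf}\in B$ and $z\mapsto e^{zf}\in B$ is analytic; for the given $f$ the operators $R_z(g)=R(e^{zf}g)$ act boundedly on $B$ and $z\mapsto R_z$ is analytic near $0$. Moreover $R$ is quasi-compact on $B$ and the constant function $\mathbf 1$ is (up to scalars) the unique eigenfunction with eigenvalue of modulus $1$; namely there are a unique stationary probability measure $\mu$ and constants $\delta_0\in(0,1)$, $C_0>0$ such that $\|R^ng-\mu(g)\mathbf 1\|\le C_0\|g\|\delta_0^n$ for all $g\in B$, $n\ge1$. *)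

theory Defs
  imports "HOL-Probability.Probability" "HOL-Complex_Analysis.Complex_Analysis"
begin

section \<open>Markov chains and their operators\<close>

text \<open>
  The chain lives on the probability space \<open>M\<close>, has state space \<open>X\<close> and one-step transition
  kernel \<open>K\<close>; its initial distribution is arbitrary.
\<close>

definition past_algebra :: "'w measure \<Rightarrow> 'a measure \<Rightarrow> (nat \<Rightarrow> 'w \<Rightarrow> 'a) \<Rightarrow> nat \<Rightarrow> 'w measure" where
  "past_algebra M X \<xi> n =
     vimage_algebra (space M) (\<lambda>\<omega>. \<lambda>i\<in>{..n}. \<xi> i \<omega>) (PiM {..n} (\<lambda>_. X))"

locale homogeneous_markov_chain = prob_space M
  for M :: "'w measure" +
  fixes X :: "'a measure" and K :: "'a \<Rightarrow> 'a measure" and \<xi> :: "nat \<Rightarrow> 'w \<Rightarrow> 'a"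
  assumes kernel: "K \<in> X \<rightarrow>\<^sub>M prob_algebra X"
    and random_variable_state: "\<And>j. \<xi> j \<in> M \<rightarrow>\<^sub>M X"
    and markov_property: "\<And>n A. A \<in> sets X \<Longrightarrow>
      AE \<omega> in M. real_cond_exp M (past_algebra M X \<xi> n) (\<lambda>\<omega>. indicator A (\<xi> (Suc n) \<omega>)) \<omega>
                 = measure (K (\<xi> n \<omega>)) A"

definition markov_op :: "('a \<Rightarrow> 'a measure) \<Rightarrow> ('a \<Rightarrow> complex) \<Rightarrow> 'a \<Rightarrow> complex" where
  "markov_op K g x = (LINT y|K x. g y)"

definition twisted_op ::
    "('a \<Rightarrow> 'a measure) \<Rightarrow> ('a \<Rightarrow> real) \<Rightarrow> complex \<Rightarrow> ('a \<Rightarrow> complex) \<Rightarrow> 'a \<Rightarrow> complex" where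
  "twisted_op K f z g = markov_op K (\<lambda>y. exp (z * complex_of_real (f y)) * g y)"

definition stationary_measure :: "'a measure \<Rightarrow> ('a \<Rightarrow> 'a measure) \<Rightarrow> 'a measure \<Rightarrow> bool" where
  "stationary_measure X K \<mu> \<longleftrightarrow> \<mu> \<in> space (prob_algebra X) \<and> \<mu> \<bind> K = \<mu>"


section \<open>Banach spaces of functions\<close>

text \<open>
  A space \<open>B\<close> of complex functions on \<open>space X\<close> is represented by all HOL functions whose
  restriction to \<open>space X\<close> belongs to the space, so values outside \<open>space X\<close> are irrelevant;
  this is assumption \<open>restriction\<close>. The members are identified when they agree on \<open>space X\<close>,
  and with this identification \<open>N\<close> is a norm: definiteness follows from \<open>sup_le_norm\<close>.
\<close>

locale complex_banach_function_space =
  fixes X :: "'a measure" and B :: "('a \<Rightarrow> complex) set" and N :: "('a \<Rightarrow> complex) \<Rightarrow> real"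
  assumes measurable: "\<And>g. g \<in> B \<Longrightarrow> g \<in> borel_measurable X"
    and restriction: "\<And>g h. g \<in> B \<Longrightarrow> (\<And>x. x \<in> space X \<Longrightarrow> h x = g x) \<Longrightarrow> h \<in> B \<and> N h = N g"
    and constants: "\<And>c. (\<lambda>_. c) \<in> B"
    and add_closed: "\<And>g h. g \<in> B \<Longrightarrow> h \<in> B \<Longrightarrow> (\<lambda>x. g x + h x) \<in> B"
    and scale_closed: "\<And>c g. g \<in> B \<Longrightarrow> (\<lambda>x. c * g x) \<in> B"
    and norm_triangle: "\<And>g h. g \<in> B \<Longrightarrow> h \<in> B \<Longrightarrow> N (\<lambda>x. g x + h x) \<le> N g + N h"
    and norm_scale: "\<And>c g. g \<in> B \<Longrightarrow> N (\<lambda>x. c * g x) = cmod c * N g"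
    and sup_le_norm: "\<And>g x. g \<in> B \<Longrightarrow> x \<in> space X \<Longrightarrow> cmod (g x) \<le> N g"
    and complete: "\<And>u. (\<And>n. u n \<in> B) \<Longrightarrow>
      (\<And>e. 0 < e \<Longrightarrow> \<exists>n0. \<forall>m\<ge>n0. \<forall>n\<ge>n0. N (\<lambda>x. u m x - u n x) < e) \<Longrightarrow>
      \<exists>g\<in>B. (\<lambda>n. N (\<lambda>x. u n x - g x)) \<longlonglongrightarrow> 0"

definition fun_analytic_at ::
    "('a \<Rightarrow> complex) set \<Rightarrow> (('a \<Rightarrow> complex) \<Rightarrow> real) \<Rightarrow> (complex \<Rightarrow> 'a \<Rightarrow> complex) \<Rightarrow> complex \<Rightarrow> bool" where
  "fun_analytic_at B N F z0 \<longleftrightarrow>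
     (\<exists>r>0. \<exists>a :: nat \<Rightarrow> 'a \<Rightarrow> complex. (\<forall>k. a k \<in> B) \<and>
        (\<forall>z\<in>ball z0 r. F z \<in> B \<and>
           (\<lambda>n. N (\<lambda>x. F z x - (\<Sum>k<n. (z - z0) ^ k * a k x))) \<longlonglongrightarrow> 0))"


section \<open>Operators on such a space\<close>

definition op_norm_le ::
    "('a \<Rightarrow> complex) set \<Rightarrow> (('a \<Rightarrow> complex) \<Rightarrow> real) \<Rightarrow> (('a \<Rightarrow> complex) \<Rightarrow> 'a \<Rightarrow> complex) \<Rightarrow> real \<Rightarrow> bool" where
  "op_norm_le B N T c \<longleftrightarrow> (\<forall>g\<in>B. T g \<in> B \<and> N (T g) \<le> c * N g)"

definition linear_op ::
    "'a measure \<Rightarrow> ('a \<Rightarrow> complex) set \<Rightarrow> (('a \<Rightarrow> complex) \<Rightarrow> 'a \<Rightarrow> complex) \<Rightarrow> bool" where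
  "linear_op X B T \<longleftrightarrow> (\<forall>g\<in>B. \<forall>h\<in>B. \<forall>a b. \<forall>x\<in>space X.
     T (\<lambda>y. a * g y + b * h y) x = a * T g x + b * T h x)"

definition bounded_op ::
    "'a measure \<Rightarrow> ('a \<Rightarrow> complex) set \<Rightarrow> (('a \<Rightarrow> complex) \<Rightarrow> real) \<Rightarrow>
     (('a \<Rightarrow> complex) \<Rightarrow> 'a \<Rightarrow> complex) \<Rightarrow> bool" where
  "bounded_op X B N T \<longleftrightarrow> linear_op X B T \<and> (\<exists>c. op_norm_le B N T c)"

text \<open>The power series below converges in the operator norm.\<close>

definition op_analytic_at ::
    "'a measure \<Rightarrow> ('a \<Rightarrow> complex) set \<Rightarrow> (('a \<Rightarrow> complex) \<Rightarrow> real) \<Rightarrow>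
     (complex \<Rightarrow> ('a \<Rightarrow> complex) \<Rightarrow> 'a \<Rightarrow> complex) \<Rightarrow> complex \<Rightarrow> bool" where
  "op_analytic_at X B N F z0 \<longleftrightarrow>
     (\<exists>r>0. \<exists>A :: nat \<Rightarrow> ('a \<Rightarrow> complex) \<Rightarrow> 'a \<Rightarrow> complex. (\<forall>k. bounded_op X B N (A k)) \<and>
        (\<forall>z\<in>ball z0 r. \<forall>e>0. \<exists>n0. \<forall>n\<ge>n0.
           op_norm_le B N (\<lambda>g x. F z g x - (\<Sum>k<n. (z - z0) ^ k * A k g x)) e))"

definition compact_op ::
    "'a measure \<Rightarrow> ('a \<Rightarrow> complex) set \<Rightarrow> (('a \<Rightarrow> complex) \<Rightarrow> real) \<Rightarrow>
     (('a \<Rightarrow> complex) \<Rightarrow> 'a \<Rightarrow> complex) \<Rightarrow> bool" where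
  "compact_op X B N Q \<longleftrightarrow> bounded_op X B N Q \<and>
     (\<forall>u. (\<forall>n::nat. u n \<in> B \<and> N (u n) \<le> 1) \<longrightarrow>
        (\<exists>s. strict_mono (s :: nat \<Rightarrow> nat) \<and>
          (\<exists>h\<in>B. (\<lambda>n. N (\<lambda>x. Q (u (s n)) x - h x)) \<longlonglongrightarrow> 0)))"

text \<open>
  Quasi-compactness for an operator of spectral radius 1 (a Markov operator):
  the essential spectral radius is less than 1.
\<close>

definition quasi_compact_op ::
    "'a measure \<Rightarrow> ('a \<Rightarrow> complex) set \<Rightarrow> (('a \<Rightarrow> complex) \<Rightarrow> real) \<Rightarrow>
     (('a \<Rightarrow> complex) \<Rightarrow> 'a \<Rightarrow> complex) \<Rightarrow> bool" where
  "quasi_compact_op X B N T \<longleftrightarrow>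
     (\<exists>n\<ge>1. \<exists>Q. \<exists>c<1. compact_op X B N Q \<and> op_norm_le B N (\<lambda>g x. (T ^^ n) g x - Q g x) c)"

definition only_constant_peripheral_eigenfunctions ::
    "'a measure \<Rightarrow> ('a \<Rightarrow> complex) set \<Rightarrow> (('a \<Rightarrow> complex) \<Rightarrow> 'a \<Rightarrow> complex) \<Rightarrow> bool" where
  "only_constant_peripheral_eigenfunctions X B T \<longleftrightarrow>
     (\<forall>g\<in>B. \<forall>w. cmod w = 1 \<longrightarrow> (\<forall>x\<in>space X. T g x = w * g x) \<longrightarrow>
        (\<exists>c. \<forall>x\<in>space X. g x = c))"

text \<open>
  The quantitative form of the two preceding conditions, which it implies; the uniqueness of the
  stationary measure is among all probability measures on \<open>X\<close>.
\<close>

definition exponential_convergence ::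
    "'a measure \<Rightarrow> ('a \<Rightarrow> 'a measure) \<Rightarrow> ('a \<Rightarrow> complex) set \<Rightarrow> (('a \<Rightarrow> complex) \<Rightarrow> real) \<Rightarrow> bool" where
  "exponential_convergence X K B N \<longleftrightarrow>
     (\<exists>\<mu>. stationary_measure X K \<mu> \<and> (\<forall>\<nu>. stationary_measure X K \<nu> \<longrightarrow> \<nu> = \<mu>) \<and>
       (\<exists>\<delta>0 C0. 0 < \<delta>0 \<and> \<delta>0 < 1 \<and> 0 < C0 \<and>
         (\<forall>g\<in>B. \<forall>n\<ge>1. N (\<lambda>x. (markov_op K ^^ n) g x - (LINT y|\<mu>. g y)) \<le> C0 * N g * \<delta>0 ^ n)))"


section \<open>Partial sums\<close>

definition centered_sum ::
    "'w measure \<Rightarrow> (nat \<Rightarrow> 'w \<Rightarrow> 'a) \<Rightarrow> ('a \<Rightarrow> real) \<Rightarrow> nat \<Rightarrow> 'w \<Rightarrow> real" where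
  "centered_sum M \<xi> f n \<omega> = (\<Sum>j=1..n. (f (\<xi> j \<omega>) - (LINT \<omega>'|M. f (\<xi> j \<omega>'))))"

definition l2_norm :: "'w measure \<Rightarrow> ('w \<Rightarrow> real) \<Rightarrow> real" where
  "l2_norm M Y = sqrt (LINT \<omega>|M. (Y \<omega>)\<^sup>2)"

end

theory Submission
  imports Defs
begin

text \<open>
  Part (1). Let \<open>P g = \<mu>(g) 1\<close> and \<open>T\<^sub>z g = R\<^sub>z (g - P g)\<close>. Since \<open>R\<^sub>z g = T\<^sub>z g + \<mu>(g) R\<^sub>z 1\<close>, the
  numbers \<open>a\<^sub>n = \<mu>(R\<^sub>z\<^sup>n 1)\<close> satisfy the renewal equation \<open>a\<^sub>n\<^sub>+\<^sub>1 = \<Sum>k\<le>n. b\<^sub>k a\<^sub>n\<^sub>-\<^sub>k\<close> with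
  \<open>b\<^sub>k = \<mu>(T\<^sub>z\<^sup>k R\<^sub>z 1)\<close>, and \<open>E R\<^sub>z\<^sup>n 1(\<xi>\<^sub>0)\<close> is expressed through the \<open>a\<^sub>n\<close> in the same way. At \<open>z = 0\<close>
  the operator \<open>T\<^sub>z\<close> has spectral radius less than \<open>1\<close>, so \<open>b\<^sub>k\<close> is small of order \<open>\<delta>\<^sup>k\<close> for \<open>k \<ge> 1\<close> and
  \<open>z\<close> near \<open>0\<close>. The leading eigenvalue is \<open>1 / w\<close> where \<open>\<Sum>k. b\<^sub>k w\<^sup>k\<^sup>+\<^sup>1 = 1\<close>, and the eigenvalue
  expansion of \<open>a\<^sub>n\<close> is the renewal theorem for the weights \<open>b\<^sub>k w\<^sup>k\<^sup>+\<^sup>1\<close>. Thus no spectral calculus is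
  needed, and only scalar functions have to be shown holomorphic.

  Part (2). The tails of the normalised sum \<open>Y\<close> are controlled with the weight \<open>exp \<bar>x\<bar>\<close>, which beats every
  power: the laws of \<open>Y\<close> and of a standard normal variable are tilted by the density \<open>exp y\<close> (by \<open>exp (- y)\<close>
  for the left tail), the tilted characteristic functions are read off from (1) at \<open>(1 + it) / (\<sigma>\<surd>n)\<close>, and
  Esseen's smoothing inequality compares the tilted distribution functions uniformly.
\<close>

section \<open>Complex renewal sequences\<close>

text \<open>Exponential convergence concerns \<open>R 0\<close> alone, so every bound uniform in z
  is obtained by perturbing one power \<open>T 0 ^^ p\<close> of norm at most 1/4. Holomorphy of the
  weights is recovered from the scalar functions \<open>a n\<close> and \<open>\<phi> n\<close>, by
  solving the renewal equations for the weights. The initial law is arbitrary, so the mean of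
  f(xi_j) depends on j. Its deviations from mu(f) decay exponentially: their total c enters U as
  exp(-zc), their tails enter delta_n. Centring forces Pi'(0) = 0, and the second derivatives give
  Var S_n = n Pi''(0) + O(1). This identifies Pi''(0) with sigma^2 and makes the two normalisations
  B_n differ by O(1). In part (2) the characteristic function is known for |t| up to a small
  multiple of sqrt n, a window for which smoothing costs O(1/sqrt n). The inversion formula contains
  1/t, so each error in the tilted characteristic function must carry a factor |t|. Hence remainders
  are estimated in Lipschitz form, between (1+it)/(sigma sqrt n) and 1/(sigma sqrt n).\<close>

lemma holomorphic_on_uniform_sequence:
  assumes "open S" "\<And>n. f n holomorphic_on S" "uniform_limit S f g sequentially"
  shows "g holomorphic_on S"
proof (rule holomorphic_uniform_sequence[OF assms(1,2)])
  fix x assume "x \<in> S"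
  then obtain d where "d > 0" "cball x d \<subseteq> S"
    using assms(1) open_contains_cball by blast
  then show "\<exists>d>0. cball x d \<subseteq> S \<and> uniform_limit (cball x d) f g sequentially"
    using uniform_limit_on_subset[OF assms(3)] by blast
qed

lemma holomorphic_on_suminf:
  fixes f :: "nat \<Rightarrow> complex \<Rightarrow> complex"
  assumes "open S" and hol: "\<And>n. f n holomorphic_on S"
    and bound: "\<And>n z. z \<in> S \<Longrightarrow> cmod (f n z) \<le> m n" and "summable m"
  shows "(\<lambda>z. \<Sum>n. f n z) holomorphic_on S"
proof (rule holomorphic_on_uniform_sequence[OF \<open>open S\<close>])
  show "(\<lambda>z. \<Sum>i<n. f i z) holomorphic_on S" for n
    by (intro holomorphic_intros hol)
  show "uniform_limit S (\<lambda>n z. \<Sum>i<n. f i z) (\<lambda>z. \<Sum>n. f n z) sequentially"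
    by (rule Weierstrass_m_test[OF bound \<open>summable m\<close>])
qed

lemma norm_power_diff_le:
  fixes v w :: complex
  assumes "cmod v \<le> R" "cmod w \<le> R"
  shows "cmod (v ^ Suc k - w ^ Suc k) \<le> real (Suc k) * R ^ k * cmod (v - w)"
proof (induction k)
  case (Suc k)
  have R: "R \<ge> 0" using assms(1) norm_ge_zero order_trans by blast
  have "v ^ Suc (Suc k) - w ^ Suc (Suc k) = v * (v ^ Suc k - w ^ Suc k) + (v - w) * w ^ Suc k"
    by (simp add: algebra_simps)
  also have "cmod \<dots> \<le> R * (real (Suc k) * R ^ k * cmod (v - w)) + cmod (v - w) * R ^ Suc k"
    using assms R Suc
    by (intro order_trans[OF norm_triangle_ineq] add_mono, unfold norm_mult norm_power)
       (intro mult_mono power_mono; simp)+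
  finally show ?case by (simp add: algebra_simps)
qed simp

text \<open>An implicit function theorem by Picard iteration of w -> 1 - g z w, started at 1. The
  first smallness condition keeps the iterates in the disc of radius R, the second makes the map a
  contraction with factor 1/2, because the w-derivative of the series is bounded by the sum of
  \<open>\<epsilon> * (k + 1) * \<kappa> ^ k\<close>. The iterates are holomorphic in z and converge
  uniformly on S, so the solution is holomorphic.\<close>

lemma perturbed_fixed_point:
  fixes c :: "nat \<Rightarrow> complex \<Rightarrow> complex" and \<epsilon> \<delta> R \<kappa> :: real
  defines "\<kappa> \<equiv> \<delta> * R"
  assumes "open S" and hol: "\<And>k. c k holomorphic_on S"
    and bound: "\<And>k z. z \<in> S \<Longrightarrow> cmod (c k z) \<le> \<epsilon> * \<delta> ^ k"
    and "0 < \<delta>" "1 \<le> R" "\<kappa> < 1" "0 \<le> \<epsilon>"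
    and small: "\<epsilon> * R / (1 - \<kappa>) \<le> R - 1" "\<epsilon> / (1 - \<kappa>)\<^sup>2 \<le> 1 / 2"
  obtains w where "w holomorphic_on S" "\<And>z. z \<in> S \<Longrightarrow> cmod (w z - 1) \<le> \<epsilon> * R / (1 - \<kappa>)"
    "\<And>z. z \<in> S \<Longrightarrow> (\<lambda>k. c k z * w z ^ Suc k) sums (1 - w z)"
proof -
  define g where "g z w = (\<Sum>k. c k z * w ^ Suc k)" for z w
  have \<kappa>: "0 < \<kappa>" using assms by simp
  have term_le: "cmod (c k z * w ^ Suc k) \<le> \<epsilon> * R * \<kappa> ^ k" if "z \<in> S" "cmod w \<le> R" for k z w
  proof -
    have "cmod (c k z * w ^ Suc k) \<le> (\<epsilon> * \<delta> ^ k) * R ^ Suc k"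
      unfolding norm_mult norm_power using that bound[OF that(1), of k] assms
      by (intro mult_mono power_mono) auto
    then show ?thesis by (simp add: \<kappa>_def power_mult_distrib mult_ac)
  qed
  have summable_bound: "summable (\<lambda>k. \<epsilon> * R * \<kappa> ^ k)"
    using \<kappa> \<open>\<kappa> < 1\<close> by (intro summable_mult summable_geometric) auto
  have summable_g: "summable (\<lambda>k. c k z * w ^ Suc k)" if "z \<in> S" "cmod w \<le> R" for z w
    by (rule summable_comparison_test'[OF summable_bound]) (rule term_le[OF that])
  have g_le: "cmod (g z w) \<le> \<epsilon> * R / (1 - \<kappa>)" if "z \<in> S" "cmod w \<le> R" for z w
  proof -
    have "cmod (g z w) \<le> (\<Sum>k. \<epsilon> * R * \<kappa> ^ k)"
      unfolding g_def by (rule norm_suminf_le[OF term_le[OF that] summable_bound])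
    also have "\<dots> = \<epsilon> * R / (1 - \<kappa>)"
      using \<kappa> \<open>\<kappa> < 1\<close> by (subst suminf_mult) (auto simp: suminf_geometric summable_geometric)
    finally show ?thesis .
  qed
  have g_lip: "cmod (g z v - g z w) \<le> cmod (v - w) / 2"
    if "z \<in> S" "cmod v \<le> R" "cmod w \<le> R" for z v w
  proof -
    have sums: "(\<lambda>k. \<epsilon> * cmod (v - w) * (of_nat (Suc k) * \<kappa> ^ k)) sums (\<epsilon> * cmod (v - w) * (1 / (1 - \<kappa>)\<^sup>2))"
      using \<kappa> \<open>\<kappa> < 1\<close> by (intro sums_mult geometric_deriv_sums) auto
    have "g z v - g z w = (\<Sum>k. c k z * v ^ Suc k - c k z * w ^ Suc k)"
      unfolding g_def using summable_g that by (intro suminf_diff) auto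
    also have "cmod \<dots> \<le> (\<Sum>k. \<epsilon> * cmod (v - w) * (of_nat (Suc k) * \<kappa> ^ k))"
    proof (rule norm_suminf_le)
      fix k
      have "cmod (c k z * v ^ Suc k - c k z * w ^ Suc k) = cmod (c k z) * cmod (v ^ Suc k - w ^ Suc k)"
        by (simp only: right_diff_distrib[symmetric] norm_mult)
      also have "\<dots> \<le> (\<epsilon> * \<delta> ^ k) * (real (Suc k) * R ^ k * cmod (v - w))"
        using bound[OF that(1), of k] norm_power_diff_le[OF that(2,3), of k] assms
        by (intro mult_mono) auto
      finally show "cmod (c k z * v ^ Suc k - c k z * w ^ Suc k) \<le> \<epsilon> * cmod (v - w) * (of_nat (Suc k) * \<kappa> ^ k)"
        by (simp add: \<kappa>_def power_mult_distrib mult_ac)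
    qed (rule sums_summable[OF sums])
    also have "\<dots> = \<epsilon> / (1 - \<kappa>)\<^sup>2 * cmod (v - w)"
      using sums_unique[OF sums] by simp
    also have "\<dots> \<le> 1 / 2 * cmod (v - w)"
      by (intro mult_right_mono small) auto
    finally show ?thesis by simp
  qed
  define W where "W = rec_nat (\<lambda>_. 1) (\<lambda>_ v z. 1 - g z (v z))"
  have W_0: "W 0 = (\<lambda>_. 1)" and W_Suc: "W (Suc m) = (\<lambda>z. 1 - g z (W m z))" for m
    by (simp_all add: W_def)
  have near_1: "cmod w \<le> R" if "cmod (w - 1) \<le> \<epsilon> * R / (1 - \<kappa>)" for w
    using norm_triangle_ineq[of "w - 1" 1] that small by simp
  have W_near: "cmod (W m z - 1) \<le> \<epsilon> * R / (1 - \<kappa>)" if "z \<in> S" for m z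
  proof (induction m)
    case 0
    then show ?case using assms \<kappa> by (simp add: W_0)
  next
    case (Suc m)
    then show ?case using g_le[OF that near_1[OF Suc]] by (simp add: W_Suc)
  qed
  have W_le: "cmod (W m z) \<le> R" if "z \<in> S" for m z
    using near_1[OF W_near[OF that]] .
  have W_hol: "W m holomorphic_on S" for m
  proof (induction m)
    case (Suc m)
    have "(\<lambda>z. g z (W m z)) holomorphic_on S"
      unfolding g_def using W_le
      by (intro holomorphic_on_suminf[OF \<open>open S\<close> _ term_le summable_bound])
         (auto intro!: holomorphic_intros hol Suc)
    then show ?case unfolding W_Suc by (intro holomorphic_intros)
  qed (simp add: W_0)
  have step: "cmod (W (Suc m) z - W m z) \<le> R * (1 / 2) ^ m" if "z \<in> S" for m z
  proof (induction m)
    case 0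
    have "cmod (g z 1) \<le> R" using g_le[OF that, of 1] small \<open>1 \<le> R\<close> by simp
    then show ?case by (simp add: W_0 W_Suc)
  next
    case (Suc m)
    have "cmod (W (Suc (Suc m)) z - W (Suc m) z) = cmod (g z (W (Suc m) z) - g z (W m z))"
      by (simp add: W_Suc norm_minus_commute)
    also have "\<dots> \<le> cmod (W (Suc m) z - W m z) / 2"
      by (rule g_lip[OF that W_le W_le]) (rule that)+
    finally show ?case using Suc by simp
  qed
  define w where "w z = 1 + (\<Sum>m. W (Suc m) z - W m z)" for z
  have "uniform_limit S (\<lambda>n z. \<Sum>m<n. W (Suc m) z - W m z) (\<lambda>z. \<Sum>m. W (Suc m) z - W m z) sequentially"
    by (rule Weierstrass_m_test[OF step]) (auto intro!: summable_mult summable_geometric)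
  moreover have "(\<lambda>n z. \<Sum>m<n. W (Suc m) z - W m z) = (\<lambda>n z. W n z - 1)"
    by (intro ext) (subst sum_lessThan_telescope, simp add: W_0)
  ultimately have "uniform_limit S (\<lambda>n z. 1 + (W n z - 1)) w sequentially"
    unfolding w_def by (intro uniform_limit_intros) simp
  then have ulim: "uniform_limit S W w sequentially"
    by simp
  have w_lim: "(\<lambda>n. W n z) \<longlonglongrightarrow> w z" if "z \<in> S" for z
    by (rule tendsto_uniform_limitI[OF ulim that])
  have w_near: "cmod (w z - 1) \<le> \<epsilon> * R / (1 - \<kappa>)" if "z \<in> S" for z
    using W_near[OF that]
    by (intro LIMSEQ_le_const2[OF tendsto_norm[OF tendsto_diff[OF w_lim[OF that] tendsto_const]]]) auto
  show ?thesis
  proof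
    show "w holomorphic_on S"
      by (rule holomorphic_on_uniform_sequence[OF \<open>open S\<close> W_hol ulim])
    fix z assume z: "z \<in> S"
    show "cmod (w z - 1) \<le> \<epsilon> * R / (1 - \<kappa>)" by (rule w_near[OF z])
    have w_le: "cmod (w z) \<le> R" by (rule near_1[OF w_near[OF z]])
    have "(\<lambda>m. g z (W m z) - g z (w z)) \<longlonglongrightarrow> 0"
    proof (rule Lim_null_comparison)
      show "\<forall>\<^sub>F m in sequentially. cmod (g z (W m z) - g z (w z)) \<le> cmod (W m z - w z) / 2"
        by (intro always_eventually allI g_lip z W_le w_le)
      show "(\<lambda>m. cmod (W m z - w z) / 2) \<longlonglongrightarrow> 0"
        using w_lim[OF z] by (intro tendsto_eq_intros | simp)+
    qed
    then have "(\<lambda>m. 1 - (g z (W m z) - g z (w z)) - g z (w z)) \<longlonglongrightarrow> 1 - 0 - g z (w z)"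
      by (intro tendsto_intros)
    then have "(\<lambda>m. W (Suc m) z) \<longlonglongrightarrow> 1 - g z (w z)" by (simp add: W_Suc)
    then have "w z = 1 - g z (w z)"
      using LIMSEQ_unique LIMSEQ_Suc[OF w_lim[OF z]] by blast
    then show "(\<lambda>k. c k z * w z ^ Suc k) sums (1 - w z)"
      using summable_sums[OF summable_g[OF z w_le]]
      unfolding g_def[symmetric] by (metis add_diff_cancel_left' diff_add_cancel)
  qed
qed

text \<open>In generating functions: with P(x) the sum of p_k x^(k+1), the sequence
  \<open>\<alpha>\<close> has series 1/(1-P) and the tails have series (1-P)/(1-x). The product is
  1/(1-x), whose coefficients are all 1.\<close>

lemma convolution_tails_eq_1:
  fixes p \<alpha> :: "nat \<Rightarrow> complex"
  assumes "\<alpha> 0 = 1" and rec: "\<And>n. \<alpha> (Suc n) = (\<Sum>k\<le>n. p k * \<alpha> (n - k))"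
  shows "(\<Sum>k\<le>n. (1 - (\<Sum>j<k. p j)) * \<alpha> (n - k)) = 1"
proof (induction n)
  case (Suc n)
  have "(\<Sum>k\<le>Suc n. (1 - (\<Sum>j<k. p j)) * \<alpha> (Suc n - k))
      = \<alpha> (Suc n) + (\<Sum>k\<le>n. (1 - (\<Sum>j<Suc k. p j)) * \<alpha> (n - k))"
    by (subst sum.atMost_Suc_shift) simp
  also have "(\<Sum>k\<le>n. (1 - (\<Sum>j<Suc k. p j)) * \<alpha> (n - k))
      = (\<Sum>k\<le>n. (1 - (\<Sum>j<k. p j)) * \<alpha> (n - k)) - \<alpha> (Suc n)"
    by (simp add: rec sum_subtractf[symmetric] algebra_simps)
  finally show ?case using Suc by simp
qed (simp add: assms)

text \<open>Differencing the identity for the tails q shows that s is the convolution inverse of q.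
  As q starts with 1 and is of order \<open>\<eta> * \<kappa> ^ k\<close> afterwards, s_n is a
  combination of earlier s_j with small coefficients. The induction closes when the geometric sum
  \<open>\<eta> * \<kappa> / (\<theta> - \<kappa>)\<close> is at most 1.\<close>

lemma renewal_increment_bound:
  fixes p \<alpha> s :: "nat \<Rightarrow> complex" and \<eta> \<kappa> \<theta> :: real
  assumes "\<alpha> 0 = 1" and rec: "\<And>n. \<alpha> (Suc n) = (\<Sum>k\<le>n. p k * \<alpha> (n - k))"
    and s: "s 0 = 1" "\<And>n. s (Suc n) = \<alpha> (Suc n) - \<alpha> n"
    and tail: "\<And>k. cmod (1 - (\<Sum>j<Suc k. p j)) \<le> \<eta> * \<kappa> ^ Suc k"
    and "0 < \<kappa>" "\<kappa> < \<theta>" "0 \<le> \<eta>" "\<eta> * \<kappa> / (\<theta> - \<kappa>) \<le> 1"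
  shows "cmod (s n) \<le> \<theta> ^ n"
proof (induction n rule: less_induct)
  case (less n)
  define q where "q k = 1 - (\<Sum>j<k. p j)" for k
  show ?case
  proof (cases n)
    case 0
    then show ?thesis by (simp add: s)
  next
    case (Suc m)
    have Q: "(\<Sum>k\<le>n. q k * \<alpha> (n - k)) = 1" for n
      unfolding q_def by (rule convolution_tails_eq_1[OF assms(1) rec])
    have "0 = (\<Sum>k\<le>Suc m. q k * \<alpha> (Suc m - k)) - (\<Sum>k\<le>m. q k * \<alpha> (m - k))"
      by (simp only: Q diff_self)
    also have "\<dots> = (\<Sum>k\<le>m. q k * (\<alpha> (Suc m - k) - \<alpha> (m - k))) + q (Suc m) * \<alpha> 0"
      by (simp add: sum_subtractf algebra_simps)
    also have "(\<Sum>k\<le>m. q k * (\<alpha> (Suc m - k) - \<alpha> (m - k))) = (\<Sum>k\<le>m. q k * s (Suc m - k))"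
      by (intro sum.cong) (auto simp: Suc_diff_le s)
    also have "\<dots> + q (Suc m) * \<alpha> 0 = (\<Sum>k\<le>Suc m. q k * s (Suc m - k))"
      by (simp add: s assms)
    also have "\<dots> = s (Suc m) + (\<Sum>k\<le>m. q (Suc k) * s (m - k))"
      by (subst sum.atMost_Suc_shift) (simp add: q_def)
    finally have "s n = - (\<Sum>k\<le>m. q (Suc k) * s (m - k))"
      using Suc by (simp add: eq_neg_iff_add_eq_0)
    then have "cmod (s n) \<le> (\<Sum>k\<le>m. cmod (q (Suc k)) * cmod (s (m - k)))"
      by (simp add: norm_sum norm_mult[symmetric])
    also have "\<dots> \<le> (\<Sum>k\<le>m. (\<eta> * \<kappa> ^ Suc k) * \<theta> ^ (m - k))"
      unfolding q_def using Suc assms by (intro sum_mono mult_mono tail less) auto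
    also have "\<dots> = \<eta> * \<kappa> * \<theta> ^ m * (\<Sum>k\<le>m. (\<kappa> / \<theta>) ^ k)"
      unfolding sum_distrib_left using assms
      by (intro sum.cong) (auto simp: power_diff power_divide field_simps)
    also have "\<dots> \<le> \<eta> * \<kappa> * \<theta> ^ m * (1 / (1 - \<kappa> / \<theta>))"
    proof (intro mult_left_mono)
      have "(\<Sum>k\<le>m. (\<kappa> / \<theta>) ^ k) \<le> (\<Sum>k. (\<kappa> / \<theta>) ^ k)"
        using assms by (intro sum_le_suminf) (auto intro!: summable_geometric)
      then show "(\<Sum>k\<le>m. (\<kappa> / \<theta>) ^ k) \<le> 1 / (1 - \<kappa> / \<theta>)"
        using assms by (subst (asm) suminf_geometric) auto
    qed (use assms in auto)
    also have "\<dots> = (\<eta> * \<kappa> / (\<theta> - \<kappa>)) * \<theta> ^ Suc m"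
      using assms by (simp add: field_simps)
    also have "\<dots> \<le> 1 * \<theta> ^ Suc m"
      using assms by (intro mult_right_mono) auto
    finally show ?thesis using Suc by simp
  qed
qed

lemma norm_suminf_geometric_tail:
  fixes x :: "nat \<Rightarrow> complex" and D t :: real
  assumes x: "\<And>k. cmod (x k) \<le> D * t ^ k" and t: "0 < t" "t < 1"
  shows "cmod (\<Sum>j. x (j + n)) \<le> D * t ^ n / (1 - t)"
proof -
  have "cmod (\<Sum>j. x (j + n)) \<le> (\<Sum>j. D * t ^ n * t ^ j)"
  proof (rule norm_suminf_le)
    show "cmod (x (j + n)) \<le> D * t ^ n * t ^ j" for j
      using x[of "j + n"] by (simp add: power_add mult_ac)
  qed (use t in \<open>auto intro!: summable_geometric summable_mult\<close>)
  also have "\<dots> = D * t ^ n / (1 - t)"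
    using t by (subst suminf_mult) (auto simp: suminf_geometric summable_geometric)
  finally show ?thesis .
qed

text \<open>If \<open>p\<close> sums to \<open>1\<close>, the increments of the renewal sequence \<open>\<alpha>\<close> obey the same kind of
  recursion with the tails of \<open>p\<close>, which are exponentially small; hence \<open>\<alpha>\<close> converges.\<close>

lemma renewal_limit:
  fixes p \<alpha> s e \<phi> :: "nat \<Rightarrow> complex" and \<eta> \<kappa> \<theta> E :: real
  assumes "\<alpha> 0 = 1" and rec: "\<And>n. \<alpha> (Suc n) = (\<Sum>k\<le>n. p k * \<alpha> (n - k))"
    and s: "s 0 = 1" "\<And>n. s (Suc n) = \<alpha> (Suc n) - \<alpha> n"
    and tail: "\<And>k. cmod (1 - (\<Sum>j<Suc k. p j)) \<le> \<eta> * \<kappa> ^ Suc k"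
    and \<kappa>: "0 < \<kappa>" "\<kappa> < \<theta>" "\<theta> < 1" "0 \<le> \<eta>" "\<eta> * \<kappa> / (\<theta> - \<kappa>) \<le> 1"
    and \<phi>: "\<And>n. \<phi> (Suc n) = (\<Sum>k\<le>n. e k * \<alpha> (n - k))"
    and e: "\<And>k. cmod (e k) \<le> E * \<kappa> ^ k"
  shows "cmod (\<phi> (Suc n) - suminf e * suminf s) \<le> 2 * E / ((1 - \<theta>) * (\<theta> - \<kappa>)) * \<theta> ^ Suc n"
proof -
  have s_le: "cmod (s n) \<le> \<theta> ^ n" for n
    by (rule renewal_increment_bound[OF assms(1) rec s tail]) (use \<kappa> in auto)
  have sum_\<theta>: "summable (\<lambda>n. \<theta> ^ n)" and sum_\<kappa>: "summable (\<lambda>k. E * \<kappa> ^ k)"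
    using \<kappa> by (auto intro!: summable_geometric summable_mult)
  have E: "0 \<le> E" using order_trans[OF norm_ge_zero e[of 0]] by simp
  have summable_s: "summable s"
    by (rule summable_comparison_test'[OF sum_\<theta> s_le])
  have summable_e: "summable e"
    by (rule summable_comparison_test'[OF sum_\<kappa> e])
  have \<alpha>_sum: "\<alpha> n = (\<Sum>j<Suc n. s j)" for n
    by (induction n) (auto simp: s assms(1))
  have \<alpha>_diff: "cmod (\<alpha> n - suminf s) \<le> \<theta> ^ Suc n / (1 - \<theta>)" for n
  proof -
    have "suminf s = (\<Sum>j. s (j + Suc n)) + \<alpha> n"
      unfolding \<alpha>_sum by (rule suminf_split_initial_segment[OF summable_s])
    then have "cmod (\<alpha> n - suminf s) = cmod (\<Sum>j. s (j + Suc n))"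
      by (simp add: norm_minus_commute)
    also have "\<dots> \<le> 1 * \<theta> ^ Suc n / (1 - \<theta>)"
      by (rule norm_suminf_geometric_tail) (use s_le \<kappa> in auto)
    finally show ?thesis by simp
  qed
  have s_sum_le: "cmod (suminf s) \<le> 1 / (1 - \<theta>)"
    using norm_suminf_geometric_tail[of s 1 \<theta> 0] s_le \<kappa> by simp
  \<comment> \<open>There are two sources of error: \<open>\<alpha>\<close> has not reached its
    limit \<open>suminf s\<close>, and the tail of e is missing. Each is brought to the same bound
    with the help of \<open>\<theta> < 1\<close>, whence the factor 2 in the claim.\<close>
  have "\<phi> (Suc n) - suminf e * suminf s
      = (\<Sum>k\<le>n. e k * (\<alpha> (n - k) - suminf s)) - (\<Sum>j. e (j + Suc n)) * suminf s"
  proof -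
    have "suminf e = (\<Sum>j. e (j + Suc n)) + (\<Sum>k\<le>n. e k)"
      using suminf_split_initial_segment[OF summable_e, of "Suc n"] by (simp add: lessThan_Suc_atMost)
    then show ?thesis
      by (simp add: \<phi> sum_subtractf right_diff_distrib distrib_right sum_distrib_right)
  qed
  also have "cmod \<dots> \<le> E * \<theta> ^ Suc n / ((1 - \<theta>) * (\<theta> - \<kappa>)) + E * \<theta> ^ Suc n / ((1 - \<theta>) * (\<theta> - \<kappa>))"
  proof (intro order_trans[OF norm_triangle_ineq4] add_mono)
    have "cmod (\<Sum>k\<le>n. e k * (\<alpha> (n - k) - suminf s))
        \<le> (\<Sum>k\<le>n. (E * \<kappa> ^ k) * (\<theta> ^ Suc (n - k) / (1 - \<theta>)))"
      by (intro order_trans[OF norm_sum] sum_mono, unfold norm_mult)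
         (intro mult_mono e \<alpha>_diff; use E \<kappa> in simp)
    also have "\<dots> = E * \<theta> ^ Suc n / (1 - \<theta>) * (\<Sum>k\<le>n. (\<kappa> / \<theta>) ^ k)"
      unfolding sum_distrib_left using \<kappa>
      by (intro sum.cong) (auto simp: power_diff power_divide field_simps)
    also have "\<dots> \<le> E * \<theta> ^ Suc n / (1 - \<theta>) * (1 / (\<theta> - \<kappa>))"
    proof (intro mult_left_mono)
      have "(\<Sum>k\<le>n. (\<kappa> / \<theta>) ^ k) \<le> (\<Sum>k. (\<kappa> / \<theta>) ^ k)"
        using \<kappa> by (intro sum_le_suminf) (auto intro!: summable_geometric)
      also have "\<dots> = \<theta> / (\<theta> - \<kappa>)"
        using \<kappa> by (subst suminf_geometric) (auto simp: field_simps)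
      also have "\<dots> \<le> 1 / (\<theta> - \<kappa>)"
        using \<kappa> by (intro divide_right_mono) auto
      finally show "(\<Sum>k\<le>n. (\<kappa> / \<theta>) ^ k) \<le> 1 / (\<theta> - \<kappa>)" .
    qed (use \<kappa> E in auto)
    finally show "cmod (\<Sum>k\<le>n. e k * (\<alpha> (n - k) - suminf s)) \<le> E * \<theta> ^ Suc n / ((1 - \<theta>) * (\<theta> - \<kappa>))"
      by simp
    have "cmod ((\<Sum>j. e (j + Suc n)) * suminf s) \<le> (E * \<kappa> ^ Suc n / (1 - \<kappa>)) * (1 / (1 - \<theta>))"
      unfolding norm_mult using \<kappa> E by (intro mult_mono norm_suminf_geometric_tail e s_sum_le) auto
    also have "\<dots> \<le> (E * \<theta> ^ Suc n / (\<theta> - \<kappa>)) * (1 / (1 - \<theta>))"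
      using \<kappa> E by (intro mult_right_mono frac_le mult_left_mono power_mono) auto
    finally show "cmod ((\<Sum>j. e (j + Suc n)) * suminf s) \<le> E * \<theta> ^ Suc n / ((1 - \<theta>) * (\<theta> - \<kappa>))"
      by (simp add: mult_ac)
  qed
  finally show ?thesis by simp
qed

text \<open>Because \<open>a 0\<close> is 1, the recursion can be solved for its newest coefficient.
  The weights are integrals of powers of the operator \<open>T z\<close>; this way their holomorphy
  follows from that of the scalar functions \<open>a\<close> and \<open>\<phi>\<close>.\<close>

lemma holomorphic_renewal_coefficients:
  fixes a e \<phi> :: "nat \<Rightarrow> complex \<Rightarrow> complex"
  assumes hol: "\<And>n. a n holomorphic_on S" "\<And>n. \<phi> n holomorphic_on S"
    and a_0: "\<And>z. z \<in> S \<Longrightarrow> a 0 z = 1"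
    and rec: "\<And>n z. z \<in> S \<Longrightarrow> \<phi> (Suc n) z = (\<Sum>k\<le>n. e k z * a (n - k) z)"
  shows "e n holomorphic_on S"
proof (induction n rule: less_induct)
  case (less n)
  have "(\<lambda>z. \<phi> (Suc n) z - (\<Sum>k<n. e k z * a (n - k) z)) holomorphic_on S"
    by (intro holomorphic_intros hol less) auto
  moreover have "\<phi> (Suc n) z - (\<Sum>k<n. e k z * a (n - k) z) = e n z" if "z \<in> S" for z
    using rec[OF that, of n] a_0[OF that] by (simp add: lessThan_Suc_atMost[symmetric])
  ultimately show ?case by (rule holomorphic_transform)
qed

text \<open>Turns the vanishing of each coefficient at 0 into smallness linear in |z|, with a bound
  that keeps its geometric decay in k.\<close>

lemma Schwarz_ball:
  fixes f :: "complex \<Rightarrow> complex"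
  assumes hol: "f holomorphic_on ball 0 r" and "f 0 = 0" "0 < D"
    and le: "\<And>z. z \<in> ball 0 r \<Longrightarrow> cmod (f z) < D" and z: "z \<in> ball 0 r"
  shows "cmod (f z) \<le> D * cmod z / r"
proof -
  have r: "r > 0" using z norm_ge_zero[of z] by (auto simp del: norm_ge_zero)
  define h where "h u = f (of_real r * u) / of_real D" for u
  have in_ball: "of_real r * u \<in> ball 0 r" if "cmod u < 1" for u :: complex
    using that r by (simp add: norm_mult)
  have "cmod (h (z / of_real r)) \<le> cmod (z / of_real r)"
  proof (rule Schwarz_Lemma)
    show "h holomorphic_on ball 0 1"
      unfolding h_def using \<open>0 < D\<close> in_ball
      by (intro holomorphic_intros holomorphic_on_compose_gen[of _ _ f, unfolded comp_def, OF _ hol])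
         (auto intro!: holomorphic_intros)
    show "cmod (h u) < 1" if "cmod u < 1" for u
      using le[OF in_ball[OF that]] \<open>0 < D\<close> by (simp add: h_def norm_divide)
  qed (use z r assms in \<open>auto simp: h_def norm_divide\<close>)
  then show ?thesis
    using r \<open>0 < D\<close> by (simp add: h_def norm_divide field_simps)
qed

text \<open>At z = 0 all \<open>a n\<close> are 1, which forces b = (1, 0, 0, ...). Hence c, the
  difference of b from this sequence, vanishes at 0 and is small nearby.
  \<open>perturbed_fixed_point\<close> then yields w with total weight 1 for b_k w^(k+1), and
  multiplication by w^n turns \<open>a\<close> and \<open>\<phi>\<close> into sequences to which
  \<open>renewal_limit\<close> applies. Here l is 1/w, and U is the resulting limit.\<close>

lemma renewal_asymptotics:
  fixes a b e \<phi> :: "nat \<Rightarrow> complex \<Rightarrow> complex" and r0 C \<delta> :: real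
  assumes "0 < r0" and hol_a: "\<And>n. a n holomorphic_on ball 0 r0"
    and hol_\<phi>: "\<And>n. \<phi> n holomorphic_on ball 0 r0"
    and a_0: "\<And>z. z \<in> ball 0 r0 \<Longrightarrow> a 0 z = 1"
    and rec_a: "\<And>n z. z \<in> ball 0 r0 \<Longrightarrow> a (Suc n) z = (\<Sum>k\<le>n. b k z * a (n - k) z)"
    and rec_\<phi>: "\<And>n z. z \<in> ball 0 r0 \<Longrightarrow> \<phi> (Suc n) z = (\<Sum>k\<le>n. e k z * a (n - k) z)"
    and b_le: "\<And>k z. z \<in> ball 0 r0 \<Longrightarrow> cmod (b k z) \<le> C * \<delta> ^ k"
    and e_le: "\<And>k z. z \<in> ball 0 r0 \<Longrightarrow> cmod (e k z) \<le> C * \<delta> ^ k"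
    and \<delta>: "0 < \<delta>" "\<delta> < 1"
    and at_0: "\<And>n. a n 0 = 1" "\<And>n. \<phi> n 0 = 1"
  obtains r l U \<theta> D where "0 < r" "r \<le> r0" "0 < \<theta>" "\<theta> < 1"
    "l holomorphic_on ball 0 r" "U holomorphic_on ball 0 r" "l 0 = 1" "U 0 = 1"
    "\<And>z. z \<in> ball 0 r \<Longrightarrow> Re (l z) > 0"
    "\<And>n z. z \<in> ball 0 r \<Longrightarrow>
      cmod (\<phi> (Suc n) z - l z ^ Suc n * U z) \<le> D * \<theta> ^ Suc n * cmod (l z) ^ Suc n"
proof -
  have hol_b: "b k holomorphic_on ball 0 r0" for k
    by (rule holomorphic_renewal_coefficients[OF hol_a hol_a a_0 rec_a])
  have hol_e: "e k holomorphic_on ball 0 r0" for k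
    by (rule holomorphic_renewal_coefficients[OF hol_a hol_\<phi> a_0 rec_\<phi>])
  have C: "0 \<le> C" using order_trans[OF norm_ge_zero b_le[of 0 0]] \<open>0 < r0\<close> by simp
  define c where "c k z = b k z - (if k = 0 then 1 else 0)" for k z
  have "(\<Sum>k\<le>n. b k 0) = 1" for n
    using rec_a[of 0 n] at_0 \<open>0 < r0\<close> by simp
  from this[of 0] this this have b_at_0: "b k 0 = (if k = 0 then 1 else 0)" for k
    by (cases k) (auto, metis add_cancel_right_right sum.atMost_Suc)
  \<comment> \<open>The summand \<open>2 * \<delta> ^ k\<close> exceeds the correction at k = 0 and
    is positive for all k, which gives the strict inequality demanded by the Schwarz lemma.\<close>
  have c_lt: "cmod (c k z) < (C + 2) * \<delta> ^ k" if "z \<in> ball 0 r0" for k z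
  proof -
    have "cmod (c k z) \<le> cmod (b k z) + (if k = 0 then 1 else 0)"
      unfolding c_def by (rule order_trans[OF norm_triangle_ineq4]) simp
    also have "\<dots> < C * \<delta> ^ k + 2 * \<delta> ^ k"
      using b_le[OF that, of k] \<delta> by (intro add_le_less_mono) auto
    finally show ?thesis by (simp add: algebra_simps)
  qed
  have c_le: "cmod (c k z) \<le> (C + 2) * \<delta> ^ k * cmod z / r0" if "z \<in> ball 0 r0" for k z
    by (rule Schwarz_ball[OF _ _ _ c_lt that])
       (use C \<delta> in \<open>auto simp: c_def b_at_0 intro!: holomorphic_intros hol_b\<close>)

  \<comment> \<open>\<open>\<kappa>\<close> and \<open>\<theta>\<close> are successive midpoints on
    the way from \<open>\<delta>\<close> to 1. The choice of R gives
    \<open>\<delta> * R = \<kappa>\<close>, so that terms of order \<open>\<delta> ^ k\<close>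
    multiplied by w^k with |w| at most R decay like \<open>\<kappa> ^ k\<close>.\<close>
  define \<kappa> where "\<kappa> = (1 + \<delta>) / 2"
  define \<theta> where "\<theta> = (1 + \<kappa>) / 2"
  define R where "R = \<kappa> / \<delta>"
  have \<kappa>: "0 < \<kappa>" "\<kappa> < 1" "\<delta> < \<kappa>"
    using \<delta> by (auto simp: \<kappa>_def)
  then have \<theta>: "\<kappa> < \<theta>" "\<theta> < 1" "0 < \<theta>"
    by (auto simp: \<theta>_def)
  have R: "1 < R" "\<delta> * R = \<kappa>" using \<kappa> \<delta> by (auto simp: R_def)
  \<comment> \<open>In this order the four entries ensure that the iteration stays in the disc of
    radius R, that |w - 1| is at most 1/2 and so Re w is positive, that the iteration contracts, and
    that \<open>renewal_increment_bound\<close> applies with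
    \<open>\<eta> = \<epsilon> * R / (1 - \<kappa>)\<close>.\<close>
  define \<epsilon> where "\<epsilon> = Min {(R - 1) * (1 - \<kappa>) / R, (1 - \<kappa>) / (2 * R), (1 - \<kappa>)\<^sup>2 / 2, (1 - \<kappa>) * (\<theta> - \<kappa>) / (R * \<kappa>)}"
  have "\<epsilon> > 0"
    unfolding \<epsilon>_def using \<kappa> \<theta> R by (subst Min_gr_iff) auto
  have "\<epsilon> \<le> (R - 1) * (1 - \<kappa>) / R" "\<epsilon> \<le> (1 - \<kappa>) / (2 * R)" "\<epsilon> \<le> (1 - \<kappa>)\<^sup>2 / 2"
    "\<epsilon> \<le> (1 - \<kappa>) * (\<theta> - \<kappa>) / (R * \<kappa>)"
    unfolding \<epsilon>_def by (intro Min_le; simp)+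
  then have \<epsilon>: "\<epsilon> * R / (1 - \<kappa>) \<le> R - 1" "\<epsilon> * R / (1 - \<kappa>) \<le> 1 / 2" "\<epsilon> / (1 - \<kappa>)\<^sup>2 \<le> 1 / 2"
    and "\<epsilon> * (R * \<kappa>) \<le> (1 - \<kappa>) * (\<theta> - \<kappa>)"
    using \<kappa> \<theta> R by (simp_all add: field_simps)
  then have "\<epsilon> * (R * \<kappa>) / ((1 - \<kappa>) * (\<theta> - \<kappa>)) \<le> 1"
    using \<kappa> \<theta> by (subst divide_le_eq_1_pos) auto
  then have \<epsilon>4: "\<epsilon> * R / (1 - \<kappa>) * \<kappa> / (\<theta> - \<kappa>) \<le> 1"
    by (simp add: mult_ac)
  \<comment> \<open>On this ball the linear bound \<open>c_le\<close> falls below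
    \<open>\<epsilon> * \<delta> ^ k\<close>.\<close>
  define r where "r = r0 * min 1 (\<epsilon> / (C + 2))"
  have r: "0 < r" "r \<le> r0" "r \<le> r0 * (\<epsilon> / (C + 2))"
    unfolding r_def using \<open>0 < r0\<close> \<open>\<epsilon> > 0\<close> C mult_left_mono[OF min.cobounded1[of 1 "\<epsilon> / (C + 2)"], of r0]
      mult_left_mono[OF min.cobounded2[of 1 "\<epsilon> / (C + 2)"], of r0]
    by (simp_all add: less_imp_le)
  have sub: "ball 0 r \<subseteq> ball 0 r0" using r by auto
  have c_small: "cmod (c k z) \<le> \<epsilon> * \<delta> ^ k" if "z \<in> ball 0 r" for k z
  proof -
    have "cmod z \<le> r0 * (\<epsilon> / (C + 2))" using that r by simp
    then have "(C + 2) * \<delta> ^ k * cmod z / r0 \<le> (C + 2) * \<delta> ^ k * (r0 * (\<epsilon> / (C + 2))) / r0"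
      using C \<delta> \<open>0 < r0\<close> by (intro divide_right_mono mult_left_mono) auto
    also have "\<dots> = \<epsilon> * \<delta> ^ k" using C \<open>0 < r0\<close> by simp
    finally show ?thesis using c_le[of z k] that sub by (meson order_trans subsetD)
  qed
  obtain w where w_hol: "w holomorphic_on ball 0 r"
    and w_near: "\<And>z. z \<in> ball 0 r \<Longrightarrow> cmod (w z - 1) \<le> \<epsilon> * R / (1 - \<delta> * R)"
    and w_sums: "\<And>z. z \<in> ball 0 r \<Longrightarrow> (\<lambda>k. c k z * w z ^ Suc k) sums (1 - w z)"
  proof (rule perturbed_fixed_point[where S = "ball 0 r" and c = c and \<epsilon> = \<epsilon> and \<delta> = \<delta> and R = R])
    show "c k holomorphic_on ball 0 r" for k
      unfolding c_def by (intro holomorphic_intros holomorphic_on_subset[OF hol_b sub])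
  qed (use c_small R \<delta> \<epsilon> \<kappa> \<open>\<epsilon> > 0\<close> in auto)
  have w_le: "cmod (w z) \<le> R" and w_Re: "Re (w z) > 0" and w_nz: "w z \<noteq> 0" if "z \<in> ball 0 r" for z
  proof -
    show "cmod (w z) \<le> R"
      using norm_triangle_ineq[of "w z - 1" 1] w_near[OF that] \<epsilon> R by simp
    have "\<bar>Re (w z - 1)\<bar> \<le> 1 / 2"
      using \<epsilon>(2) unfolding R(2)[symmetric]
      by (intro order_trans[OF abs_Re_le_cmod order_trans[OF w_near[OF that]]])
    then have "\<bar>Re (w z) - 1\<bar> \<le> 1 / 2" by simp
    then show "Re (w z) > 0" by arith
    then show "w z \<noteq> 0" by auto
  qed
  have w_at_0: "w 0 = 1"
    using w_sums[of 0] r sums_unique2[of "\<lambda>_. 0" 0 "1 - w 0"] by (simp add: c_def b_at_0 if_distrib cong: if_cong)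

  define p where "p z k = b k z * w z ^ Suc k" for z k
  define \<alpha> where "\<alpha> z n = a n z * w z ^ n" for z n
  define f where "f z k = e k z * w z ^ Suc k" for z k
  define s where "s z n = (case n of 0 \<Rightarrow> 1 | Suc m \<Rightarrow> \<alpha> z (Suc m) - \<alpha> z m)" for z n
  have s: "s z 0 = 1" "s z (Suc n) = \<alpha> z (Suc n) - \<alpha> z n" for z n
    by (simp_all add: s_def)
  have \<alpha>_0: "\<alpha> z 0 = 1" if "z \<in> ball 0 r" for z
    by (simp add: \<alpha>_def a_0[OF subsetD[OF sub that]])
  have \<alpha>_rec: "\<alpha> z (Suc n) = (\<Sum>k\<le>n. p z k * \<alpha> z (n - k))" if "z \<in> ball 0 r" for z n
  proof -
    have "\<alpha> z (Suc n) = (\<Sum>k\<le>n. b k z * a (n - k) z * w z ^ Suc n)"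
      using rec_a[OF subsetD[OF sub that], of n] by (simp add: \<alpha>_def sum_distrib_right del: power_Suc)
    also have "\<dots> = (\<Sum>k\<le>n. p z k * \<alpha> z (n - k))"
      by (intro sum.cong) (auto simp: p_def \<alpha>_def power_add[symmetric] mult_ac)
    finally show ?thesis .
  qed
  have \<phi>_rec: "\<phi> (Suc n) z * w z ^ Suc n = (\<Sum>k\<le>n. f z k * \<alpha> z (n - k))" if "z \<in> ball 0 r" for z n
  proof -
    have "\<phi> (Suc n) z * w z ^ Suc n = (\<Sum>k\<le>n. e k z * a (n - k) z * w z ^ Suc n)"
      using rec_\<phi>[OF subsetD[OF sub that], of n] by (simp add: sum_distrib_right del: power_Suc)
    also have "\<dots> = (\<Sum>k\<le>n. f z k * \<alpha> z (n - k))"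
      by (intro sum.cong) (auto simp: f_def \<alpha>_def power_add[symmetric] mult_ac)
    finally show ?thesis .
  qed
  have term_le: "cmod (x * w z ^ Suc k) \<le> (D * R) * \<kappa> ^ k"
    if "z \<in> ball 0 r" "cmod x \<le> D * \<delta> ^ k" for x z D k
  proof -
    have "cmod (x * w z ^ Suc k) \<le> (D * \<delta> ^ k) * R ^ Suc k"
      unfolding norm_mult norm_power using that w_le[OF that(1)] order_trans[OF norm_ge_zero that(2)]
      by (intro mult_mono power_mono) auto
    also have "\<dots> = D * R * (\<delta> * R) ^ k" by (simp add: power_mult_distrib mult_ac)
    finally show ?thesis unfolding R(2) .
  qed
  have f_le: "cmod (f z k) \<le> (C * R) * \<kappa> ^ k" if "z \<in> ball 0 r" for z k
    unfolding f_def by (rule term_le[OF that e_le[OF subsetD[OF sub that]]])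
  \<comment> \<open>Since p sums to 1, the difference is a tail of p. That tail begins at index 1 or
    later, where b and c agree, so it inherits the factor \<open>\<epsilon>\<close> of c.\<close>
  have tail: "cmod (1 - (\<Sum>j<Suc k. p z j)) \<le> (\<epsilon> * R / (1 - \<kappa>)) * \<kappa> ^ Suc k"
    if z: "z \<in> ball 0 r" for z k
  proof -
    have "(\<lambda>j. c j z * w z ^ Suc j + (if j = 0 then w z else 0)) sums (1 - w z + w z)"
      by (intro sums_add w_sums z) (rule sums_single[of 0 "\<lambda>_. w z"])
    moreover have "(\<lambda>j. c j z * w z ^ Suc j + (if j = 0 then w z else 0)) = p z"
      by (auto simp: p_def c_def fun_eq_iff algebra_simps)
    ultimately have p: "p z sums 1" by simp
    have "1 - (\<Sum>j<Suc k. p z j) = (\<Sum>j. p z (j + Suc k))"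
      using suminf_split_initial_segment[OF sums_summable[OF p], of "Suc k"] sums_unique[OF p]
      by (metis add_diff_cancel_right')
    also have "\<dots> = (\<Sum>j. c (j + Suc k) z * w z ^ Suc (j + Suc k))"
      by (simp add: p_def c_def)
    also have "cmod \<dots> \<le> (\<epsilon> * R) * \<kappa> ^ Suc k / (1 - \<kappa>)"
      by (rule norm_suminf_geometric_tail[OF term_le[OF z c_small[OF z]]]) (use \<kappa> in auto)
    finally show ?thesis by simp
  qed
  have \<eta>: "0 \<le> \<epsilon> * R / (1 - \<kappa>)" using \<open>\<epsilon> > 0\<close> R \<kappa> by simp
  have s_le: "cmod (s z n) \<le> \<theta> ^ n" if z: "z \<in> ball 0 r" for z n
    by (rule renewal_increment_bound[OF \<alpha>_0[OF z] \<alpha>_rec[OF z] s tail[OF z]])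
       (use \<kappa> \<theta> \<eta> \<epsilon>4 in auto)
  define D where "D = 2 * (C * R) / ((1 - \<theta>) * (\<theta> - \<kappa>))"
  define U where "U z = suminf (f z) * suminf (s z)" for z
  have limit: "cmod (\<phi> (Suc n) z * w z ^ Suc n - U z) \<le> D * \<theta> ^ Suc n" if z: "z \<in> ball 0 r" for z n
    unfolding U_def D_def
    by (rule renewal_limit[where \<phi> = "\<lambda>n. \<phi> n z * w z ^ n",
          OF \<alpha>_0[OF z] \<alpha>_rec[OF z] s tail[OF z] \<kappa>(1) \<theta>(1,2) \<eta> \<epsilon>4 \<phi>_rec[OF z] f_le[OF z]])
  have \<alpha>_hol: "(\<lambda>z. \<alpha> z n) holomorphic_on ball 0 r" for n
    unfolding \<alpha>_def by (intro holomorphic_intros w_hol holomorphic_on_subset[OF hol_a sub])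
  show thesis
  proof (rule that[of r \<theta> "\<lambda>z. 1 / w z" U D])
    show "(\<lambda>z. 1 / w z) holomorphic_on ball 0 r"
      by (intro holomorphic_intros w_hol w_nz)
    have "(\<lambda>z. suminf (f z)) holomorphic_on ball 0 r"
    proof (rule holomorphic_on_suminf[OF open_ball _ f_le])
      show "(\<lambda>z. f z k) holomorphic_on ball 0 r" for k
        unfolding f_def by (intro holomorphic_intros w_hol holomorphic_on_subset[OF hol_e sub])
    qed (use \<kappa> in \<open>auto intro!: summable_mult summable_geometric\<close>)
    moreover have "(\<lambda>z. suminf (s z)) holomorphic_on ball 0 r"
    proof (rule holomorphic_on_suminf[OF open_ball _ s_le])
      show "(\<lambda>z. s z k) holomorphic_on ball 0 r" for k
        by (cases k) (auto simp: s intro!: holomorphic_intros \<alpha>_hol)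
    qed (use \<theta> in \<open>auto intro!: summable_geometric\<close>)
    ultimately show "U holomorphic_on ball 0 r"
      unfolding U_def by (intro holomorphic_intros)
    \<comment> \<open>U is given by an infinite product formula in neither factor explicit; its
      value at 0 comes from letting n tend to infinity in \<open>limit\<close>, where
      \<open>\<phi> n 0\<close> and \<open>w 0\<close> are 1.\<close>
    have "(\<lambda>n. D * \<theta> ^ Suc n) \<longlonglongrightarrow> D * 0"
      using \<theta> by (intro tendsto_intros LIMSEQ_Suc LIMSEQ_realpow_zero) auto
    then have "cmod (1 - U 0) \<le> 0"
      using limit[of 0] r by (intro LIMSEQ_le_const) (auto simp: w_at_0 at_0)
    then show "U 0 = 1" by simp
    show "Re (1 / w z) > 0" if "z \<in> ball 0 r" for z
      using w_Re[OF that] by (simp add: Re_divide w_nz[OF that] complex_neq_0[symmetric])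
    show "cmod (\<phi> (Suc n) z - (1 / w z) ^ Suc n * U z) \<le> D * \<theta> ^ Suc n * cmod (1 / w z) ^ Suc n"
      if z: "z \<in> ball 0 r" for n z
    proof -
      have "\<phi> (Suc n) z - (1 / w z) ^ Suc n * U z
          = (\<phi> (Suc n) z * w z ^ Suc n - U z) * (1 / w z) ^ Suc n"
        using w_nz[OF z] by (simp add: field_simps del: power_Suc)
      then show ?thesis
        using limit[OF z, of n] by (simp add: norm_mult norm_power mult_right_mono del: power_Suc)
    qed
  qed (use r \<theta> w_at_0 in auto)
qed

section \<open>Esseen smoothing inequality\<close>

lemma integrable_inverse_one_plus_square: "integrable lborel (\<lambda>x::real. inverse (1 + x\<^sup>2))"
  using integrable_inverse_1_plus_square by (simp add: set_integrable_def)

lemma one_minus_cos_le: "1 - cos x \<le> x\<^sup>2 / 2" for x :: real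
proof -
  have "1 - cos x = 2 * (sin (x / 2))\<^sup>2"
    using cos_double_sin[of "x / 2"] by simp
  also have "\<dots> \<le> 2 * (x / 2)\<^sup>2"
    using abs_sin_x_le_abs_x[of "x / 2"] by (intro mult_left_mono) (auto simp: abs_le_square_iff[symmetric])
  finally show ?thesis by (simp add: power2_eq_square)
qed

text \<open>The Fejer kernel without normalisation, with a scale a because products with cosines
  lead to other scales. Division by zero makes the value at x = 0 equal to 0 instead of the limit
  a^2/2; this affects a null set only.\<close>

definition fejer :: "real \<Rightarrow> real \<Rightarrow> real" where
  "fejer a x = (1 - cos (a * x)) / x\<^sup>2"

lemma fejer_nonneg: "0 \<le> fejer a x"
  by (simp add: fejer_def)

lemma fejer_measurable [measurable]: "fejer a \<in> borel_measurable borel"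
  unfolding fejer_def by measurable

lemma integrable_fejer_1: "integrable lborel (fejer 1)"
proof (rule Bochner_Integration.integrable_bound)
  show "integrable lborel (\<lambda>x::real. 4 * inverse (1 + x\<^sup>2))"
    by (intro integrable_mult_right integrable_inverse_one_plus_square)
  show "AE x in lborel. norm (fejer 1 x) \<le> norm (4 * inverse (1 + x\<^sup>2))"
  proof (intro AE_I2)
    fix x :: real
    have pos: "0 < 1 + x\<^sup>2" by (simp add: add_pos_nonneg)
    have "fejer 1 x \<le> 4 * inverse (1 + x\<^sup>2)"
    proof (cases "\<bar>x\<bar> \<le> 1")
      case True
      then have x2: "x\<^sup>2 \<le> 1" by (simp add: abs_square_le_1)
      have "fejer 1 x \<le> 1 / 2"
        using one_minus_cos_le[of x] by (cases "x = 0") (auto simp: fejer_def field_simps)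
      also have "\<dots> \<le> 4 * inverse (1 + x\<^sup>2)"
        using x2 pos by (simp add: field_simps)
      finally show ?thesis .
    next
      case False
      then have x2: "1 < x\<^sup>2" by (metis abs_square_le_1 not_le)
      then have "fejer 1 x \<le> 2 / x\<^sup>2"
        unfolding fejer_def using cos_ge_minus_one[of x] by (intro divide_right_mono) auto
      also have "\<dots> = 4 / (2 * x\<^sup>2)" by simp
      also have "\<dots> \<le> 4 / (1 + x\<^sup>2)"
        using order.strict_trans[OF zero_less_one x2] x2 pos
        by (intro divide_left_mono mult_pos_pos) linarith+
      also have "\<dots> = 4 * inverse (1 + x\<^sup>2)" by (rule divide_inverse)
      finally show ?thesis .
    qed
    then show "norm (fejer 1 x) \<le> norm (4 * inverse (1 + x\<^sup>2))"
      using fejer_nonneg[of 1 x] pos by simp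
  qed
qed simp

lemma fejer_scaling:
  shows integrable_fejer: "integrable lborel (fejer a)"
    and integral_fejer: "integral\<^sup>L lborel (fejer a) = \<bar>a\<bar> * integral\<^sup>L lborel (fejer 1)"
proof -
  have "integrable lborel (fejer a) \<and> integral\<^sup>L lborel (fejer a) = \<bar>a\<bar> * integral\<^sup>L lborel (fejer 1)"
  proof (cases "a = 0")
    case True
    then have "fejer a = (\<lambda>_. 0)" by (auto simp: fejer_def)
    then show ?thesis using True by simp
  next
    case False
    have eq: "fejer a x = a\<^sup>2 * fejer 1 (0 + a * x)" for x
      using False by (simp add: fejer_def power_mult_distrib)
    have "integrable lborel (\<lambda>x. fejer 1 (0 + a * x))"
      by (rule lborel_integrable_real_affine[OF integrable_fejer_1 False])
    then have "integrable lborel (fejer a)"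
      unfolding eq[abs_def] by (rule integrable_mult_right)
    moreover have "integral\<^sup>L lborel (fejer a) = a\<^sup>2 * (LBINT x. fejer 1 (0 + a * x))"
      unfolding eq[abs_def] by simp
    moreover have "integral\<^sup>L lborel (fejer 1) = \<bar>a\<bar> * (LBINT x. fejer 1 (0 + a * x))"
      using lborel_integral_real_affine[OF False, of "fejer 1" 0] by simp
    ultimately show ?thesis
      by (simp add: power2_eq_square abs_mult_self_eq[symmetric, of a] del: abs_mult_self_eq)
  qed
  then show "integrable lborel (fejer a)" "integral\<^sup>L lborel (fejer a) = \<bar>a\<bar> * integral\<^sup>L lborel (fejer 1)"
    by auto
qed

text \<open>The kernel is strictly positive on [pi/2, pi], an interval of positive length.
  Positivity of the integral makes the normalised kernel a probability density.\<close>

lemma integral_fejer_pos: "0 < integral\<^sup>L lborel (fejer 1)"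
proof -
  have "0 \<le> integral\<^sup>L lborel (fejer 1)"
    by (intro integral_nonneg_AE) (simp add: fejer_nonneg)
  moreover have "integral\<^sup>L lborel (fejer 1) \<noteq> 0"
  proof
    assume "integral\<^sup>L lborel (fejer 1) = 0"
    then have "AE x in lborel. fejer 1 x = 0"
      using integral_nonneg_eq_0_iff_AE[OF integrable_fejer_1] by (simp add: fejer_nonneg)
    then have "AE x in lborel. x \<notin> {pi/2..pi}"
    proof (rule AE_mp, intro AE_I2 impI)
      fix x :: real assume "fejer 1 x = 0"
      then show "x \<notin> {pi/2..pi}"
        using cos_monotone_0_pi_le[of "pi / 2" x] by (auto simp: fejer_def)
    qed
    then have "emeasure lborel {pi/2..pi} = 0"
      by (subst (asm) AE_iff_measurable[of "{pi/2..pi}"]) auto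
    then show False by simp
  qed
  ultimately show ?thesis by simp
qed

lemma density_lborel_no_atoms:
  fixes f :: "real \<Rightarrow> ennreal"
  assumes [measurable]: "f \<in> borel_measurable borel"
  shows "measure (density lborel f) {x} = 0"
proof -
  have "emeasure (density lborel f) {x} = 0"
    by (subst emeasure_density) (auto intro!: nn_integral_0_iff_AE[THEN iffD2] AE_I[of _ _ "{x}"])
  then show ?thesis by (simp add: measure_def)
qed

text \<open>With \<open>integral_fejer\<close>, this product formula evaluates the Fourier transform
  of the kernel as (|1+t| + |1-t|)/2 - |t|, up to the factor
  \<open>integral\<^sup>L lborel (fejer 1)\<close>. That expression vanishes for |t| at least
  1.\<close>

lemma cos_times_fejer: "cos (t * x) * fejer 1 x = (fejer (1 + t) x + fejer (1 - t) x) / 2 - fejer t x"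
proof -
  have sum: "cos ((1 + t) * x) = 2 * (cos x * cos (t * x)) - cos ((1 - t) * x)"
    by (simp add: cos_add cos_diff algebra_simps)
  have *: "cos (t * x) * (1 - cos x) = ((1 - cos ((1 + t) * x)) + (1 - cos ((1 - t) * x))) / 2 - (1 - cos (t * x))"
    unfolding sum by (simp add: field_simps)
  have fejer: "fejer a x = (1 - cos (a * x)) * inverse (x\<^sup>2)" for a
    by (simp add: fejer_def divide_inverse)
  have "cos (t * x) * fejer 1 x = (cos (t * x) * (1 - cos x)) * inverse (x\<^sup>2)"
    by (simp add: fejer)
  also have "\<dots> = (((1 - cos ((1 + t) * x)) + (1 - cos ((1 - t) * x))) / 2 - (1 - cos (t * x))) * inverse (x\<^sup>2)"
    by (simp only: *)
  also have "\<dots> = (fejer (1 + t) x + fejer (1 - t) x) / 2 - fejer t x"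
    unfolding fejer by (simp only: left_diff_distrib add_divide_distrib distrib_right times_divide_eq_left)
  finally show ?thesis .
qed

text \<open>The normalised Fejer kernel, with characteristic function \<open>max 0 (1 - \<bar>t\<bar>)\<close>.\<close>

lemma exists_band_limited_distribution:
  obtains V where "real_distribution V" "\<And>x. measure V {x} = 0"
    "\<And>t. 1 \<le> \<bar>t\<bar> \<Longrightarrow> char V t = 0"
proof -
  define J where "J = integral\<^sup>L lborel (fejer 1)"
  have J: "0 < J" unfolding J_def by (rule integral_fejer_pos)
  define V where "V = density lborel (\<lambda>x. ennreal (fejer 1 x / J))"
  have int: "integrable lborel (\<lambda>x. fejer 1 x / J)"
    by (intro integrable_divide integrable_fejer)
  have "emeasure V UNIV = (\<integral>\<^sup>+x. ennreal (fejer 1 x / J) \<partial>lborel)"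
    unfolding V_def by (subst emeasure_density) auto
  also have "\<dots> = ennreal (LBINT x. fejer 1 x / J)"
    using J by (intro nn_integral_eq_integral int) (simp add: fejer_nonneg)
  also have "\<dots> = 1" using J by (simp add: J_def)
  finally have "real_distribution V"
    by (intro real_distribution.intro prob_spaceI real_distribution_axioms.intro) (simp_all add: V_def)
  moreover have "measure V {x} = 0" for x
    unfolding V_def by (rule density_lborel_no_atoms) measurable
  moreover have "char V t = 0" if t: "1 \<le> \<bar>t\<bar>" for t
  proof -
    have "char V t = (CLBINT x. complex_of_real (fejer 1 x / J) * iexp (t * x))"
      unfolding char_def V_def using J
      by (subst integral_density) (auto simp: fejer_nonneg scaleR_conv_of_real)
    also have "\<dots> = 0"
    proof (rule complex_eqI)
      have int': "complex_integrable lborel (\<lambda>x. complex_of_real (fejer 1 x / J) * iexp (t * x))"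
        using int by (rule Bochner_Integration.integrable_bound) (auto simp: norm_mult norm_divide of_real_mult[symmetric] simp del: of_real_mult)
      have "Re (CLBINT x. complex_of_real (fejer 1 x / J) * iexp (t * x)) = (LBINT x. cos (t * x) * fejer 1 x / J)"
        by (subst integral_Re[OF int', symmetric]) (simp add: Re_exp mult_ac)
      also have "\<dots> = (LBINT x. (fejer (1 + t) x + fejer (1 - t) x) / 2 - fejer t x) / J"
        by (simp add: cos_times_fejer)
      also have "(LBINT x. (fejer (1 + t) x + fejer (1 - t) x) / 2 - fejer t x)
          = (\<bar>1 + t\<bar> * J + \<bar>1 - t\<bar> * J) / 2 - \<bar>t\<bar> * J"
        by (subst Bochner_Integration.integral_diff)
           (auto intro!: integrable_fejer integrable_divide Bochner_Integration.integrable_add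
                 simp: Bochner_Integration.integral_add integrable_fejer integral_fejer[of t] integral_fejer[of "1 + t"]
                   integral_fejer[of "1 - t"] J_def)
      also have "\<dots> = 0"
      proof -
        have "1 \<le> t \<or> t \<le> - 1" using t by linarith
        then show ?thesis
          by (elim disjE) (simp_all add: abs_of_nonneg abs_of_nonpos algebra_simps)
      qed
      finally show "Re (CLBINT x. complex_of_real (fejer 1 x / J) * iexp (t * x)) = Re 0" by simp
      define I where "I = (LBINT x. sin (t * x) * fejer 1 x / J)"
      have "Im (CLBINT x. complex_of_real (fejer 1 x / J) * iexp (t * x)) = I"
        unfolding I_def by (subst integral_Im[OF int', symmetric]) (simp add: Im_exp mult_ac)
      \<comment> \<open>The integrand is odd; the substitution is x -> -x.\<close>
      moreover have "I = - I"
        using lborel_integral_real_affine[of "-1" "\<lambda>x. sin (t * x) * fejer 1 x / J" 0]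
        unfolding I_def by (simp add: fejer_def)
      ultimately show "Im (CLBINT x. complex_of_real (fejer 1 x / J) * iexp (t * x)) = Im 0"
        by (simp only: zero_complex.sel)
    qed
    finally show ?thesis .
  qed
  ultimately show ?thesis by (rule that)
qed

section \<open>Convolution with a smoothing kernel\<close>

lemma real_distribution_convolution:
  assumes "real_distribution K" "real_distribution F"
  shows "real_distribution (K \<star> F)"
proof -
  interpret K: real_distribution K by fact
  interpret F: real_distribution F by fact
  interpret P: pair_prob_space K F ..
  have "(\<lambda>(x, y). x + y) \<in> borel_measurable (K \<Otimes>\<^sub>M F)" by measurable
  then show ?thesis unfolding convolution_def by (rule P.real_distribution_distr)
qed

lemma char_convolution:
  assumes "real_distribution K" "real_distribution F"
  shows "char (K \<star> F) t = char K t * char F t"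
proof -
  interpret K: real_distribution K by fact
  interpret F: real_distribution F by fact
  interpret P: pair_prob_space K F ..
  have "char (K \<star> F) t = (CLINT z|K \<Otimes>\<^sub>M F. iexp (t * (case z of (x, y) \<Rightarrow> x + y)))"
    unfolding char_def convolution_def by (subst integral_distr) auto
  also have "\<dots> = (CLINT z|K \<Otimes>\<^sub>M F. (case z of (x, y) \<Rightarrow> iexp (t * x) * iexp (t * y)))"
    by (intro Bochner_Integration.integral_cong) (auto simp: exp_add[symmetric] algebra_simps split: prod.splits)
  also have "\<dots> = (CLINT x|K. CLINT y|F. iexp (t * x) * iexp (t * y))"
  proof (rule P.integral_fst[symmetric])
    show "integrable (K \<Otimes>\<^sub>M F) (\<lambda>(x, y). iexp (t * x) * iexp (t * y))"
      by (rule P.integrable_const_bound[where B = 1])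
         (auto simp: norm_mult of_real_mult[symmetric] simp del: of_real_mult)
  qed
  also have "\<dots> = char K t * char F t"
    by (simp add: char_def)
  finally show ?thesis .
qed

lemma cdf_convolution:
  assumes "real_distribution K" "real_distribution F"
  shows "cdf (K \<star> F) y = (LINT v|K. cdf F (y - v))"
    and "integrable K (\<lambda>v. cdf F (y - v))"
proof -
  interpret K: real_distribution K by fact
  interpret F: real_distribution F by fact
  interpret KF: real_distribution "K \<star> F" by (rule real_distribution_convolution[OF assms])
  have "mono (cdf F)" by (auto simp: mono_def F.cdf_nondecreasing)
  then have [measurable]: "cdf F \<in> borel_measurable borel" by (rule borel_measurable_mono)
  show int: "integrable K (\<lambda>v. cdf F (y - v))"
    by (rule K.integrable_const_bound[where B = 1]) (auto simp: F.cdf_bounded_prob F.cdf_nonneg)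
  have "emeasure (K \<star> F) {..y} = (\<integral>\<^sup>+v. emeasure F {a. a + v \<in> {..y}} \<partial>K)"
    by (intro convolution_emeasure) (auto intro: K.finite_measure_axioms F.finite_measure_axioms)
  also have "\<dots> = (\<integral>\<^sup>+v. ennreal (cdf F (y - v)) \<partial>K)"
  proof (intro nn_integral_cong)
    fix v
    have "{a. a + v \<in> {..y}} = {..y - v}" by auto
    then show "emeasure F {a. a + v \<in> {..y}} = ennreal (cdf F (y - v))"
      by (simp add: cdf_def F.emeasure_eq_measure)
  qed
  also have "\<dots> = ennreal (LINT v|K. cdf F (y - v))"
    by (intro nn_integral_eq_integral int) (simp add: F.cdf_nonneg)
  finally show "cdf (K \<star> F) y = (LINT v|K. cdf F (y - v))"
    by (simp add: cdf_def KF.emeasure_eq_measure integral_nonneg_AE F.cdf_nonneg)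
qed

text \<open>An atomless kernel smooths an arbitrary law F, so Levy inversion for the convolution is
  available at every pair of end points.\<close>

lemma convolution_no_atoms:
  assumes "real_distribution K" "real_distribution F" "\<And>x. measure K {x} = 0"
  shows "measure (K \<star> F) {x} = 0"
proof -
  interpret K: real_distribution K by fact
  interpret F: real_distribution F by fact
  have "emeasure (K \<star> F) {x} = emeasure (F \<star> K) {x}"
    by (subst convolution_commutative) (auto intro: K.finite_measure_axioms F.finite_measure_axioms)
  also have "\<dots> = (\<integral>\<^sup>+v. emeasure K {a. a + v \<in> {x}} \<partial>F)"
    by (intro convolution_emeasure) (auto intro: K.finite_measure_axioms F.finite_measure_axioms)
  also have "\<dots> = 0"
  proof -
    have "{a. a + v \<in> {x}} = {x - v}" for v by auto
    then show ?thesis using assms(3) by (simp add: K.emeasure_eq_measure)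
  qed
  finally show ?thesis by (simp add: measure_def)
qed

section \<open>Levy inversion and the smoothing inequality\<close>

lemma levy_integrand_integrable:
  assumes "real_distribution M" "a \<le> b"
  shows "set_integrable lborel {-T<..<T::real}
    (\<lambda>t. (iexp (- (t * a)) - iexp (- (t * b))) / (\<i> * complex_of_real t) * char M t)"
proof -
  interpret real_distribution M by fact
  have [measurable]: "char M \<in> borel_measurable borel" by (rule char_measurable)
  show ?thesis
    unfolding set_integrable_def
  proof (rule integrableI_bounded_set_indicator[where B = "b - a"])
    have "cmod ((iexp (- (t * a)) - iexp (- (t * b))) / (\<i> * complex_of_real t) * char M t) \<le> b - a" for t
    proof -
      have "cmod ((iexp (- (t * a)) - iexp (- (t * b))) / (\<i> * complex_of_real t)) \<le> b - a"
        using Levy_Inversion_aux2[of "-b" "-a" t] assms(2) by (cases "t = 0") auto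
      then show ?thesis
        unfolding norm_mult using mult_mono[OF _ cmod_char_le_1] assms(2) by fastforce
    qed
    then show "AE t in lborel. t \<in> {-T<..<T} \<longrightarrow>
        cmod ((iexp (- (t * a)) - iexp (- (t * b))) / (\<i> * complex_of_real t) * char M t) \<le> b - a"
      by simp
    show "emeasure lborel {- T<..<T} < \<infinity>" by (cases "- T \<le> T") auto
  qed auto
qed

text \<open>The inversion kernel k satisfies |k t| |t| \<le> 2, so the factor |t| in the hypothesis
  cancels its singularity at 0. With the prefactor 1/(2 pi) this leaves a constant 1/pi \<le> 1. The
  bound is free of a, which permits a -> -infinity in \<open>band_limited_cdf_diff\<close>.\<close>

lemma band_limited_Ioc_diff:
  fixes g :: "real \<Rightarrow> real"
  assumes F: "real_distribution F" and G: "real_distribution G"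
    and atoms: "\<And>x. measure F {x} = 0" "\<And>x. measure G {x} = 0"
    and g: "integrable lborel g" "\<And>t. 0 \<le> g t"
    and diff: "\<And>t. cmod (char F t - char G t) \<le> \<bar>t\<bar> * g t"
    and "a \<le> b"
  shows "\<bar>measure F {a<..b} - measure G {a<..b}\<bar> \<le> (LBINT t. g t)"
proof -
  interpret F: real_distribution F by fact
  interpret G: real_distribution G by fact
  define k where "k t = (iexp (- (t * a)) - iexp (- (t * b))) / (\<i> * complex_of_real t)" for t
  let ?I = "\<lambda>M (n::nat). complex_of_real (1 / (2 * pi)) * (CLBINT t=ereal (real_of_int (- int n))..ereal (real n). k t * char M t)"
  have set: "(CLBINT t=ereal (real_of_int (- int n))..ereal (real n). k t * char M t)
      = (CLINT t:{- real n<..<real n}|lborel. k t * char M t)" for M n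
    by (simp add: interval_lebesgue_integral_def)
  have k_le: "cmod (k t) * \<bar>t\<bar> \<le> 2" for t
  proof -
    have "cmod (k t) * \<bar>t\<bar> \<le> cmod (iexp (- (t * a)) - iexp (- (t * b)))"
      by (cases "t = 0") (auto simp: k_def norm_divide norm_mult)
    also have "\<dots> \<le> cmod (iexp (- (t * a))) + cmod (iexp (- (t * b)))"
      by (rule norm_triangle_ineq4)
    finally show ?thesis by simp
  qed
  have bound: "cmod (?I F n - ?I G n) \<le> (LBINT t. g t)" for n
  proof -
    let ?S = "{- real n<..<real n}"
    have "?I F n - ?I G n = complex_of_real (1 / (2 * pi)) *
        ((CLINT t:?S|lborel. k t * char F t) - (CLINT t:?S|lborel. k t * char G t))"
      unfolding set by (simp add: algebra_simps)
    also have "(CLINT t:?S|lborel. k t * char F t) - (CLINT t:?S|lborel. k t * char G t)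
        = (CLINT t:?S|lborel. k t * char F t - k t * char G t)"
      unfolding k_def
      by (rule set_integral_diff(2)[symmetric]) (rule levy_integrand_integrable assms)+
    finally have eq: "cmod (?I F n - ?I G n)
        = 1 / (2 * pi) * cmod (CLINT t:?S|lborel. k t * char F t - k t * char G t)"
      by (simp add: norm_mult norm_divide)
    have le: "cmod (CLINT t:?S|lborel. k t * char F t - k t * char G t) \<le> (LBINT t. 2 * g t)"
      unfolding set_lebesgue_integral_def
    proof (rule order_trans[OF integral_norm_bound Bochner_Integration.integral_mono])
      show "integrable lborel (\<lambda>t. cmod (indicat_real ?S t *\<^sub>R (k t * char F t - k t * char G t)))"
        unfolding k_def
        by (intro integrable_norm, unfold set_integrable_def[symmetric])
           (intro set_integral_diff levy_integrand_integrable assms)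
      show "cmod (indicat_real ?S t *\<^sub>R (k t * char F t - k t * char G t)) \<le> 2 * g t" for t
      proof -
        have "cmod (indicat_real ?S t *\<^sub>R (k t * char F t - k t * char G t)) \<le> cmod (k t) * cmod (char F t - char G t)"
          by (auto simp: right_diff_distrib[symmetric] norm_mult indicator_def)
        also have "\<dots> \<le> cmod (k t) * (\<bar>t\<bar> * g t)"
          by (intro mult_left_mono diff) simp
        also have "\<dots> = (cmod (k t) * \<bar>t\<bar>) * g t"
          by simp
        also have "\<dots> \<le> 2 * g t"
          by (intro mult_right_mono k_le g)
        finally show ?thesis .
      qed
    qed (use g in simp)
    have "cmod (?I F n - ?I G n) \<le> 1 / (2 * pi) * (LBINT t. 2 * g t)"
      unfolding eq by (intro mult_left_mono le) simp
    also have "1 / (2 * pi) * (LBINT t. 2 * g t) = (LBINT t. g t) / pi"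
      by simp
    also have "\<dots> \<le> (LBINT t. g t)"
    proof -
      have "0 \<le> (LBINT t. g t)" using g(2) by (intro integral_nonneg_AE) simp
      then show ?thesis using pi_gt3 by (simp add: divide_le_eq mult_le_cancel_left1)
    qed
    finally show ?thesis .
  qed
  have "(\<lambda>n. ?I F n - ?I G n) \<longlonglongrightarrow> complex_of_real (measure F {a<..b}) - complex_of_real (measure G {a<..b})"
    unfolding k_def using atoms \<open>a \<le> b\<close>
    by (intro tendsto_diff F.Levy_Inversion G.Levy_Inversion) auto
  then have "(\<lambda>n. cmod (?I F n - ?I G n)) \<longlonglongrightarrow> cmod (complex_of_real (measure F {a<..b}) - complex_of_real (measure G {a<..b}))"
    by (rule tendsto_norm)
  then have "cmod (complex_of_real (measure F {a<..b}) - complex_of_real (measure G {a<..b})) \<le> (LBINT t. g t)"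
    by (rule LIMSEQ_le_const2) (use bound in blast)
  then show ?thesis
    by (simp only: of_real_diff[symmetric] norm_of_real)
qed

lemma band_limited_cdf_diff:
  fixes g :: "real \<Rightarrow> real"
  assumes F: "real_distribution F" and G: "real_distribution G"
    and atoms: "\<And>x. measure F {x} = 0" "\<And>x. measure G {x} = 0"
    and g: "integrable lborel g" "\<And>t. 0 \<le> g t"
    and diff: "\<And>t. cmod (char F t - char G t) \<le> \<bar>t\<bar> * g t"
  shows "\<bar>cdf F b - cdf G b\<bar> \<le> (LBINT t. g t)"
proof -
  interpret F: real_distribution F by fact
  interpret G: real_distribution G by fact
  have "((\<lambda>a. \<bar>(cdf F b - cdf F a) - (cdf G b - cdf G a)\<bar>) \<longlongrightarrow> \<bar>(cdf F b - 0) - (cdf G b - 0)\<bar>) at_bot"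
    by (intro tendsto_intros F.cdf_lim_at_bot G.cdf_lim_at_bot)
  moreover have "\<forall>\<^sub>F a in at_bot. \<bar>(cdf F b - cdf F a) - (cdf G b - cdf G a)\<bar> \<le> (LBINT t. g t)"
    by (rule eventually_mono[OF eventually_gt_at_bot[of b]])
       (use band_limited_Ioc_diff[OF assms, of _ b] in \<open>auto simp: F.cdf_diff_eq G.cdf_diff_eq\<close>)
  ultimately show ?thesis
    using tendsto_upperbound[of _ _ at_bot] by fastforce
qed

text \<open>If \<open>F - G\<close> is large at one point, then it stays large on an
  interval on one side of that point, since \<open>F\<close> is monotone and \<open>G\<close> is Lipschitz. The convolution
  with a band-limited kernel concentrated on such an interval cannot be small.\<close>

lemma esseen_smoothing:
  obtains A :: real where "A > 0"
    "\<And>F G L T x (g :: real \<Rightarrow> real). \<lbrakk>real_distribution F; real_distribution G; T > 0; L \<ge> 0;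
       \<And>u v. u \<le> v \<Longrightarrow> cdf G v - cdf G u \<le> L * (v - u);
       integrable lborel g; \<And>t. 0 \<le> g t;
       \<And>t. \<bar>t\<bar> \<le> T \<Longrightarrow> cmod (char F t - char G t) \<le> \<bar>t\<bar> * g t\<rbrakk>
     \<Longrightarrow> \<bar>cdf F x - cdf G x\<bar> \<le> A * ((LBINT t. g t) + L / T)"
proof -
  obtain V where V: "real_distribution V" "\<And>x. measure V {x} = 0" "\<And>t. 1 \<le> \<bar>t\<bar> \<Longrightarrow> char V t = 0"
    using exists_band_limited_distribution by blast
  interpret V: real_distribution V by fact
  have "(\<lambda>n::nat. cdf V (real n) - cdf V (- real n)) \<longlonglongrightarrow> 1 - 0"
    by (intro tendsto_diff V.cdf_lim_infty_prob V.cdf_lim_neg_infty)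
  then have "\<forall>\<^sub>F n in sequentially. 3 / 4 < cdf V (real n) - cdf V (- real n)"
    by (rule order_tendstoD) simp
  then obtain n where n: "3 / 4 < cdf V (real n) - cdf V (- real n)"
    by (auto simp: eventually_sequentially)
  define a where "a = real n"
  have "a > 0" using n by (cases "n = 0") (auto simp: a_def)
  \<comment> \<open>What matters is a mass above 1/2: outside the window the difference of the
    distribution functions is bounded only by its supremum \<open>\<eta>\<close>, and the
    \<open>\<eta>\<close> lost there has to be absorbed by the \<open>\<eta>\<close> gained
    inside.\<close>
  then have Va: "3 / 4 \<le> measure V {-a..a}"
    using n V.cdf_diff_eq[of "-a" a] V.finite_measure_mono[of "{-a<..a}" "{-a..a}"] by (force simp: a_def)
  show ?thesis
  proof (rule that[of "3 * a + 2"])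
    fix F G :: "real measure" and L T x :: real and g :: "real \<Rightarrow> real"
    assume F: "real_distribution F" and G: "real_distribution G" and "T > 0" "L \<ge> 0"
      and lip: "\<And>u v. u \<le> v \<Longrightarrow> cdf G v - cdf G u \<le> L * (v - u)"
      and g: "integrable lborel g" "\<And>t. 0 \<le> g t"
      and diff: "\<And>t. \<bar>t\<bar> \<le> T \<Longrightarrow> cmod (char F t - char G t) \<le> \<bar>t\<bar> * g t"
    interpret F: real_distribution F by fact
    interpret G: real_distribution G by fact
    \<comment> \<open>Rescaling by 1/T stretches the characteristic function, so that it vanishes
      for |t| \<ge> T, where nothing is assumed about F - G. The window of V becomes
      [-h, h].\<close>
    define K where "K = distr V borel (\<lambda>v. v / T)"
    have K: "real_distribution K" unfolding K_def by (intro V.real_distribution_distr) simp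
    interpret K: real_distribution K by fact
    define h where "h = a / T"
    have "h > 0" using \<open>a > 0\<close> \<open>T > 0\<close> by (simp add: h_def)
    have K_meas: "measure K A = measure V ((\<lambda>v. v / T) -` A)" if "A \<in> sets borel" for A
      unfolding K_def using that by (subst measure_distr) auto
    have Kh: "3 / 4 \<le> measure K {-h..h}"
    proof -
      have "(\<lambda>v. v / T) -` {-h..h} = {-a..a}"
        using \<open>T > 0\<close> by (auto simp: h_def field_simps)
      then show ?thesis using Va by (simp add: K_meas)
    qed
    have K_atoms: "measure K {x} = 0" for x
    proof -
      have "(\<lambda>v. v / T) -` {x} = {x * T}" using \<open>T > 0\<close> by (auto simp: field_simps)
      then show ?thesis by (simp add: K_meas V)
    qed
    have K_char: "char K t = char V (t / T)" for t
      unfolding K_def char_def by (subst integral_distr) auto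
    define I where "I = (LBINT t. g t)"
    have smoothed: "\<bar>cdf (K \<star> F) y - cdf (K \<star> G) y\<bar> \<le> I" for y
      unfolding I_def
    proof (rule band_limited_cdf_diff[OF _ _ _ _ g])
      fix t
      have "cmod (char K t) * cmod (char F t - char G t) \<le> \<bar>t\<bar> * g t"
      proof (cases "\<bar>t\<bar> \<le> T")
        case True
        then show ?thesis
          using mult_mono[OF K.cmod_char_le_1[of t] diff[OF True]] by simp
      next
        case False
        then have "char K t = 0"
          using \<open>T > 0\<close> by (simp add: K_char V)
        then show ?thesis using g by simp
      qed
      then show "cmod (char (K \<star> F) t - char (K \<star> G) t) \<le> \<bar>t\<bar> * g t"
        by (simp add: char_convolution[OF K F] char_convolution[OF K G] right_diff_distrib[symmetric] norm_mult)
    qed (use K F G K_atoms in \<open>auto intro: real_distribution_convolution convolution_no_atoms\<close>)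
    define D where "D y = cdf F y - cdf G y" for y
    have D_int: "integrable K (\<lambda>v. D (y - v))" and D_conv: "(LINT v|K. D (y - v)) = cdf (K \<star> F) y - cdf (K \<star> G) y" for y
      unfolding D_def by (simp_all add: cdf_convolution[OF K F] cdf_convolution[OF K G])
    have D_le1: "\<bar>D y\<bar> \<le> 1" for y
      using F.cdf_bounded_prob[of y] F.cdf_nonneg[of y] G.cdf_bounded_prob[of y] G.cdf_nonneg[of y]
      by (auto simp: D_def)
    define \<eta> where "\<eta> = (SUP y. \<bar>D y\<bar>)"
    have bdd: "bdd_above (range (\<lambda>y. \<bar>D y\<bar>))" using D_le1 by (auto intro!: bdd_aboveI)
    have D_le: "\<bar>D y\<bar> \<le> \<eta>" for y
      unfolding \<eta>_def by (rule cSUP_upper[OF _ bdd]) simp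
    have "\<eta> \<ge> 0" using order_trans[OF abs_ge_zero D_le] .
    have "I \<ge> 0" unfolding I_def using g by (intro integral_nonneg_AE) simp
    \<comment> \<open>The sign s treats both directions of deviation at once. On the window the
      integrand is at least d - 2Lh, elsewhere at least \<open>- \<eta>\<close>. The lower bound 3/4
      for the mass can be multiplied in only when d - 2Lh + \<open>\<eta>\<close> is nonnegative;
      otherwise d is so small that the claim is immediate.\<close>
    have pos_part: "3 / 4 * d \<le> I + \<eta> / 4 + 3 / 2 * L * h"
      if s: "\<bar>s\<bar> = 1" and window: "\<And>v. \<bar>v\<bar> \<le> h \<Longrightarrow> d - 2 * L * h \<le> s * D (y - v)" for d s y
    proof (cases "0 \<le> d - 2 * L * h + \<eta>")
      case True
      define P where "P = measure K {-h..h}"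
      have "(d - 2 * L * h + \<eta>) * (3 / 4) - \<eta> \<le> (d - 2 * L * h + \<eta>) * P - \<eta>"
        using mult_left_mono[OF Kh True] by (simp add: P_def)
      also have "\<dots> = (LINT v|K. (d - 2 * L * h + \<eta>) * indicat_real {-h..h} v - \<eta>)"
        by (subst Bochner_Integration.integral_diff)
           (auto simp: P_def K.prob_space[simplified] intro!: K.integrable_const_bound[where B = 1])
      also have "\<dots> \<le> (LINT v|K. s * D (y - v))"
      proof (rule integral_mono)
        show "integrable K (\<lambda>v. (d - 2 * L * h + \<eta>) * indicat_real {-h..h} v - \<eta>)"
          by (intro Bochner_Integration.integrable_diff integrable_mult_right K.integrable_const
              K.integrable_const_bound[where B = 1]) auto
        show "integrable K (\<lambda>v. s * D (y - v))"
          by (intro integrable_mult_right D_int)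
        fix v
        have "- \<eta> \<le> s * D (y - v)"
          using D_le[of "y - v"] s by (auto simp: abs_if split: if_splits)
        then show "(d - 2 * L * h + \<eta>) * indicat_real {-h..h} v - \<eta> \<le> s * D (y - v)"
          using window[of v] by (auto simp: indicator_def abs_le_iff)
      qed
      also have "\<dots> = s * (cdf (K \<star> F) y - cdf (K \<star> G) y)"
        by (simp add: D_conv)
      also have "\<dots> \<le> I"
        using smoothed[of y] s by (auto simp: abs_if split: if_splits)
      finally show ?thesis by (simp add: algebra_simps)
    next
      case False
      have "0 \<le> L * h" using \<open>L \<ge> 0\<close> \<open>h > 0\<close> by simp
      then show ?thesis using False \<open>I \<ge> 0\<close> \<open>\<eta> \<ge> 0\<close> by (simp add: algebra_simps)
    qed
    \<comment> \<open>The centre is moved to y + h or y - h according to the sign of D y, so that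
      the whole window lies on the side where monotonicity of F preserves the deviation. Over its
      length 2h, G moves by at most 2Lh.\<close>
    have D_bound: "3 / 4 * \<bar>D y\<bar> \<le> I + \<eta> / 4 + 3 / 2 * L * h" for y
    proof (cases "D y \<ge> 0")
      case True
      have "D y - 2 * L * h \<le> 1 * D (y + h - v)" if "\<bar>v\<bar> \<le> h" for v
      proof -
        have "L * (h - v) \<le> L * (2 * h)" using that \<open>L \<ge> 0\<close> by (intro mult_left_mono) auto
        then show ?thesis
          using F.cdf_nondecreasing[of y "y + h - v"] lip[of y "y + h - v"] abs_le_D1[OF that] by (simp add: D_def algebra_simps)
      qed
      from pos_part[OF _ this] True show ?thesis by simp
    next
      case False
      have "- D y - 2 * L * h \<le> (-1) * D (y - h - v)" if "\<bar>v\<bar> \<le> h" for v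
      proof -
        have "L * (h + v) \<le> L * (2 * h)" using that \<open>L \<ge> 0\<close> by (intro mult_left_mono) auto
        then show ?thesis
          using F.cdf_nondecreasing[of "y - h - v" y] lip[of "y - h - v" y] abs_le_D2[OF that] by (simp add: D_def algebra_simps)
      qed
      from pos_part[OF _ this] False show ?thesis by simp
    qed
    have "\<bar>D y\<bar> \<le> 4 / 3 * (I + \<eta> / 4 + 3 / 2 * L * h)" for y
      using D_bound[of y] by (simp add: field_simps)
    then have "\<eta> \<le> 4 / 3 * (I + \<eta> / 4 + 3 / 2 * L * h)"
      unfolding \<eta>_def by (intro cSUP_least) auto
    then have "\<eta> \<le> 2 * I + 3 * L * h" by (simp add: field_simps)
    also have "\<dots> = 2 * I + 3 * a * (L / T)" by (simp add: h_def)
    also have "\<dots> \<le> (3 * a + 2) * (I + L / T)"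
      using \<open>a > 0\<close> \<open>I \<ge> 0\<close> \<open>L \<ge> 0\<close> \<open>T > 0\<close> by (simp add: algebra_simps)
    finally show "\<bar>cdf F x - cdf G x\<bar> \<le> (3 * a + 2) * ((LBINT t. g t) + L / T)"
      using D_le[of x] by (simp add: D_def I_def)
  qed (use \<open>a > 0\<close> in simp)
qed

section \<open>Exponential tilting and weighted Berry-Esseen bounds\<close>

text \<open>The Esscher transform of F with parameter 1.\<close>

definition exp_tilt :: "real measure \<Rightarrow> real measure" where
  "exp_tilt F = density F (\<lambda>y. ennreal (exp y / (LINT y|F. exp y)))"

lemma nn_integral_exp_tail: "(\<integral>\<^sup>+u. ennreal (exp (- u)) * indicator {y..} u \<partial>lborel) = ennreal (exp (- y))"
proof -
  have "(\<integral>\<^sup>+u. ennreal (exp (- u)) * indicator {y..} u \<partial>lborel) = ennreal (0 - (- exp (- y)))"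
  proof (rule nn_integral_FTC_atLeast)
    show "((\<lambda>u. - exp (- u)) has_real_derivative exp (- u)) (at u)" for u :: real
      by (auto intro!: derivative_eq_intros)
    show "((\<lambda>u. - exp (- u)) \<longlongrightarrow> (0::real)) at_top"
      using tendsto_minus[OF filterlim_compose[OF exp_at_bot filterlim_uminus_at_bot_at_top]] by simp
  qed auto
  then show ?thesis by simp
qed

lemma integrable_exp_tail: "integrable lborel (\<lambda>u::real. indicat_real {x<..} u * exp (- u))"
  and integral_exp_tail_le: "(LBINT u. indicat_real {x<..} u * exp (- u)) \<le> exp (- x)"
proof -
  have "(\<integral>\<^sup>+u. ennreal (indicat_real {x<..} u * exp (- u)) \<partial>lborel)
      \<le> (\<integral>\<^sup>+u. ennreal (exp (- u)) * indicator {x..} u \<partial>lborel)"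
    by (intro nn_integral_mono) (auto simp: indicator_def)
  then have le: "(\<integral>\<^sup>+u. ennreal (indicat_real {x<..} u * exp (- u)) \<partial>lborel) \<le> ennreal (exp (- x))"
    by (simp add: nn_integral_exp_tail)
  then show int: "integrable lborel (\<lambda>u::real. indicat_real {x<..} u * exp (- u))"
    by (intro integrableI_nonneg) (auto intro: le_less_trans)
  have "ennreal (LBINT u. indicat_real {x<..} u * exp (- u)) \<le> ennreal (exp (- x))"
    using le by (subst nn_integral_eq_integral[OF int, symmetric]) auto
  then show "(LBINT u. indicat_real {x<..} u * exp (- u)) \<le> exp (- x)"
    by (simp add: ennreal_le_iff)
qed

text \<open>Integration by parts through Fubini, writing exp(-y) as the integral of exp(-u) over u
  \<ge> y. An integral against H becomes a Lebesgue integral of its distribution function, so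
  uniform closeness of distribution functions can be inserted.\<close>

lemma exp_weighted_tail:
  assumes "real_distribution H"
  shows "(LINT y|H. indicat_real {x<..} y * exp (- y))
      = (LBINT u. indicat_real {x<..} u * exp (- u) * (cdf H u - cdf H x))"
    and "integrable lborel (\<lambda>u. indicat_real {x<..} u * exp (- u) * (cdf H u - cdf H x))"
    and "0 \<le> (LINT y|H. indicat_real {x<..} y * exp (- y))"
    and "(LINT y|H. indicat_real {x<..} y * exp (- y)) \<le> exp (- x)"
proof -
  interpret real_distribution H by fact
  interpret P: pair_sigma_finite H lborel ..
  have "mono (cdf H)" by (auto simp: mono_def cdf_nondecreasing)
  then have [measurable]: "cdf H \<in> borel_measurable borel" by (rule borel_measurable_mono)
  let ?f = "\<lambda>u. indicat_real {x<..} u * exp (- u) * (cdf H u - cdf H x)"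
  let ?k = "\<lambda>y. indicat_real {x<..} y * exp (- y)"
  have k_le: "?k y \<le> exp (- x)" for y by (auto simp: indicator_def)
  have k_int: "integrable H ?k"
    using k_le by (intro integrable_const_bound[where B = "exp (- x)"]) auto
  show "0 \<le> integral\<^sup>L H ?k"
    by (intro integral_nonneg_AE) simp
  show "integral\<^sup>L H ?k \<le> exp (- x)"
    using integral_mono[OF k_int integrable_const[of "exp (- x)"] k_le] prob_space by simp
  have f_nonneg: "0 \<le> ?f u" for u
    using cdf_nondecreasing[of x u] by (auto simp: indicator_def)
  show f_int: "integrable lborel ?f"
  proof (rule Bochner_Integration.integrable_bound[OF integrable_exp_tail[of x]])
    show "AE u in lborel. norm (?f u) \<le> norm (indicat_real {x<..} u * exp (- u))"
    proof (intro AE_I2)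
      fix u
      show "norm (?f u) \<le> norm (indicat_real {x<..} u * exp (- u))"
        using cdf_nondecreasing[of x u] cdf_bounded_prob[of u] cdf_nonneg[of x]
        by (auto simp: indicator_def mult_le_cancel_left1)
    qed
  qed measurable
  have "ennreal (integral\<^sup>L H ?k) = (\<integral>\<^sup>+y. ennreal (?k y) \<partial>H)"
    by (intro nn_integral_eq_integral[symmetric] k_int) simp
  also have "\<dots> = (\<integral>\<^sup>+y. \<integral>\<^sup>+u. indicator {x<..} y * (ennreal (exp (- u)) * indicator {y..} u) \<partial>lborel \<partial>H)"
  proof (intro nn_integral_cong)
    fix y
    show "ennreal (?k y) = (\<integral>\<^sup>+u. indicator {x<..} y * (ennreal (exp (- u)) * indicator {y..} u) \<partial>lborel)"
      by (subst nn_integral_cmult) (cases "x < y"; simp add: nn_integral_exp_tail)+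
  qed
  also have "\<dots> = (\<integral>\<^sup>+y. \<integral>\<^sup>+u. ennreal (exp (- u)) * indicator {z. x < fst z \<and> fst z \<le> snd z} (y, u) \<partial>lborel \<partial>H)"
    by (intro nn_integral_cong) (auto simp: indicator_def)
  also have "\<dots> = (\<integral>\<^sup>+u. \<integral>\<^sup>+y. ennreal (exp (- u)) * indicator {z. x < fst z \<and> fst z \<le> snd z} (y, u) \<partial>H \<partial>lborel)"
  proof (rule P.Fubini'[symmetric])
    have "{z. x < fst z \<and> fst z \<le> snd z} = {z \<in> space (H \<Otimes>\<^sub>M lborel). x < fst z \<and> fst z \<le> snd z}"
      by (simp add: space_pair_measure)
    also have "\<dots> \<in> sets (H \<Otimes>\<^sub>M lborel)" by measurable
    finally have [measurable]: "{z. x < fst z \<and> fst z \<le> snd z} \<in> sets (H \<Otimes>\<^sub>M lborel)" .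
    show "(\<lambda>(y, u). ennreal (exp (- u)) * indicator {z. x < fst z \<and> fst z \<le> snd z} (y, u))
        \<in> borel_measurable (H \<Otimes>\<^sub>M lborel)"
      by measurable
  qed
  also have "\<dots> = (\<integral>\<^sup>+u. ennreal (?f u) \<partial>lborel)"
  proof (intro nn_integral_cong)
    fix u :: real
    have "(\<integral>\<^sup>+y. ennreal (exp (- u)) * indicator {z. x < fst z \<and> fst z \<le> snd z} (y, u) \<partial>H)
        = (\<integral>\<^sup>+y. ennreal (exp (- u)) * indicator {x<..u} y \<partial>H)"
      by (intro nn_integral_cong) (auto simp: indicator_def)
    also have "\<dots> = ennreal (exp (- u)) * emeasure H {x<..u}"
      by (subst nn_integral_cmult_indicator) auto
    also have "\<dots> = ennreal (?f u)"
      by (cases "x < u") (auto simp: emeasure_Ioc ennreal_mult' indicator_def)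
    finally show "(\<integral>\<^sup>+y. ennreal (exp (- u)) * indicator {z. x < fst z \<and> fst z \<le> snd z} (y, u) \<partial>H) = ennreal (?f u)" .
  qed
  also have "\<dots> = ennreal (integral\<^sup>L lborel ?f)"
    by (intro nn_integral_eq_integral f_int) (simp only: f_nonneg AE_I2)
  finally show "integral\<^sup>L H ?k = integral\<^sup>L lborel ?f"
    by (subst (asm) ennreal_inj) (auto intro!: integral_nonneg_AE f_nonneg)
qed

locale exp_integrable_distribution = real_distribution F for F +
  assumes exp_integrable: "integrable F exp"
begin

lemma exp_moment_pos: "0 < (LINT y|F. exp y)"
proof -
  have "(LINT y|F. exp y) \<noteq> 0"
  proof
    assume "(LINT y|F. exp y) = 0"
    then have "AE y in F. exp y = 0"
      using integral_nonneg_eq_0_iff_AE[OF exp_integrable] by simp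
    then show False by simp
  qed
  moreover have "0 \<le> (LINT y|F. exp y)" by (intro integral_nonneg_AE) simp
  ultimately show ?thesis by linarith
qed

lemma real_distribution_exp_tilt: "real_distribution (exp_tilt F)"
proof -
  have "emeasure (exp_tilt F) UNIV = (\<integral>\<^sup>+y. ennreal (exp y / (LINT y|F. exp y)) \<partial>F)"
    unfolding exp_tilt_def by (subst emeasure_density) auto
  also have "\<dots> = ennreal (LINT y|F. exp y / (LINT y|F. exp y))"
    using exp_moment_pos by (intro nn_integral_eq_integral integrable_divide exp_integrable) simp
  also have "\<dots> = 1" using exp_moment_pos by simp
  finally show ?thesis
    by (intro real_distribution.intro prob_spaceI real_distribution_axioms.intro) (simp_all add: exp_tilt_def)
qed

lemma tail_via_exp_tilt:
  "1 - cdf F x = (LINT y|F. exp y) * (LINT y|exp_tilt F. indicat_real {x<..} y * exp (- y))"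
proof -
  define m where "m = (LINT y|F. exp y)"
  have m: "0 < m" using exp_moment_pos by (simp add: m_def)
  have "(LINT y|exp_tilt F. indicat_real {x<..} y * exp (- y))
      = (LINT y|F. (exp y / m) *\<^sub>R (indicat_real {x<..} y * exp (- y)))"
    unfolding exp_tilt_def m_def[symmetric] using m by (intro integral_density) auto
  also have "\<dots> = (LINT y|F. indicat_real {x<..} y / m)"
    by (intro Bochner_Integration.integral_cong) (auto simp: exp_minus field_simps)
  also have "\<dots> = measure F {x<..} / m" by simp
  also have "measure F {x<..} = 1 - cdf F x"
  proof -
    have "{x<..} = space F - {..x}" by auto
    then show ?thesis using prob_compl[of "{..x}"] by (simp add: cdf_def)
  qed
  finally show ?thesis using m by (simp add: m_def)
qed

lemma char_exp_tilt: "char (exp_tilt F) t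
    = (CLINT y|F. exp ((1 + \<i> * t) * complex_of_real y)) / (LINT y|F. exp y)"
proof -
  define m where "m = (LINT y|F. exp y)"
  have m: "0 < m" using exp_moment_pos by (simp add: m_def)
  have "char (exp_tilt F) t = (CLINT y|F. (exp y / m) *\<^sub>R iexp (t * y))"
    unfolding exp_tilt_def m_def[symmetric] char_def using m by (intro integral_density) auto
  also have "\<dots> = (CLINT y|F. exp ((1 + \<i> * t) * complex_of_real y) / m)"
    by (intro Bochner_Integration.integral_cong)
       (auto simp: scaleR_conv_of_real exp_of_real[symmetric] exp_add[symmetric] algebra_simps)
  finally show ?thesis by (simp add: m_def)
qed

end

text \<open>Undoing the tilt: each right tail is the exponential moment times a tail integral of
  exp(-y) against the tilted law. The difference splits into a difference of moments, multiplied by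
  an integral of size at most exp(-x), and a difference of tail integrals. The latter involves cdf
  increments from x to u, hence the factor 2.\<close>

lemma cdf_diff_via_exp_tilt:
  assumes "exp_integrable_distribution F" "exp_integrable_distribution G"
    and close: "\<And>u. \<bar>cdf (exp_tilt F) u - cdf (exp_tilt G) u\<bar> \<le> \<eta>"
  shows "\<bar>cdf F x - cdf G x\<bar>
    \<le> (\<bar>(LINT y|F. exp y) - (LINT y|G. exp y)\<bar> + 2 * (LINT y|G. exp y) * \<eta>) * exp (- x)"
proof -
  interpret F: exp_integrable_distribution F by fact
  interpret G: exp_integrable_distribution G by fact
  define m m' where "m = (LINT y|F. exp y)" and "m' = (LINT y|G. exp y)"
  define I where "I H = (LINT y|H. indicat_real {x<..} y * exp (- y))" for H :: "real measure"
  note tilt = F.real_distribution_exp_tilt G.real_distribution_exp_tilt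
  define f where "f H u = indicat_real {x<..} u * exp (- u) * (cdf H u - cdf H x)" for H :: "real measure" and u
  have f: "integrable lborel (f (exp_tilt F))" "integrable lborel (f (exp_tilt G))"
    and I_eq: "I (exp_tilt F) = integral\<^sup>L lborel (f (exp_tilt F))" "I (exp_tilt G) = integral\<^sup>L lborel (f (exp_tilt G))"
    using exp_weighted_tail(1,2)[OF tilt(1)] exp_weighted_tail(1,2)[OF tilt(2)]
    by (simp_all add: I_def f_def[abs_def])
  have "\<eta> \<ge> 0" using order_trans[OF abs_ge_zero close] .
  have I_diff: "\<bar>I (exp_tilt F) - I (exp_tilt G)\<bar> \<le> 2 * \<eta> * exp (- x)"
  proof -
    have "I (exp_tilt F) - I (exp_tilt G) = (LBINT u. f (exp_tilt F) u - f (exp_tilt G) u)"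
      unfolding I_eq by (rule Bochner_Integration.integral_diff[OF f, symmetric])
    also have "\<bar>\<dots>\<bar> \<le> (LBINT u. 2 * \<eta> * (indicat_real {x<..} u * exp (- u)))"
    proof (rule order_trans[OF integral_abs_bound Bochner_Integration.integral_mono])
      show "integrable lborel (\<lambda>u. \<bar>f (exp_tilt F) u - f (exp_tilt G) u\<bar>)"
        by (intro integrable_abs Bochner_Integration.integrable_diff f)
      show "integrable lborel (\<lambda>u. 2 * \<eta> * (indicat_real {x<..} u * exp (- u)))"
        by (intro integrable_mult_right integrable_exp_tail)
      fix u
      have "\<bar>f (exp_tilt F) u - f (exp_tilt G) u\<bar> = (indicat_real {x<..} u * exp (- u)) *
          \<bar>(cdf (exp_tilt F) u - cdf (exp_tilt G) u) - (cdf (exp_tilt F) x - cdf (exp_tilt G) x)\<bar>"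
      proof -
        have "f (exp_tilt F) u - f (exp_tilt G) u = (indicat_real {x<..} u * exp (- u)) *
            ((cdf (exp_tilt F) u - cdf (exp_tilt G) u) - (cdf (exp_tilt F) x - cdf (exp_tilt G) x))"
          by (simp add: f_def algebra_simps)
        then show ?thesis by (simp add: abs_mult)
      qed
      also have "\<dots> \<le> (indicat_real {x<..} u * exp (- u)) * (2 * \<eta>)"
        using close[of u] close[of x] by (intro mult_left_mono) auto
      finally show "\<bar>f (exp_tilt F) u - f (exp_tilt G) u\<bar> \<le> 2 * \<eta> * (indicat_real {x<..} u * exp (- u))"
        by (simp add: mult_ac)
    qed
    also have "\<dots> = 2 * \<eta> * (LBINT u. indicat_real {x<..} u * exp (- u))"
      by simp
    also have "\<dots> \<le> 2 * \<eta> * exp (- x)"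
      using \<open>\<eta> \<ge> 0\<close> by (intro mult_left_mono integral_exp_tail_le) auto
    finally show ?thesis .
  qed
  have I_F: "0 \<le> I (exp_tilt F)" "I (exp_tilt F) \<le> exp (- x)"
    unfolding I_def by (rule exp_weighted_tail[OF tilt(1)])+
  have m': "0 < m'" using G.exp_moment_pos by (simp add: m'_def)
  have "cdf F x - cdf G x = m' * I (exp_tilt G) - m * I (exp_tilt F)"
    using F.tail_via_exp_tilt[of x] G.tail_via_exp_tilt[of x] by (simp add: m_def m'_def I_def)
  also have "\<dots> = - ((m - m') * I (exp_tilt F) + m' * (I (exp_tilt F) - I (exp_tilt G)))"
    by (simp add: algebra_simps)
  also have "\<bar>\<dots>\<bar> \<le> \<bar>m - m'\<bar> * I (exp_tilt F) + m' * \<bar>I (exp_tilt F) - I (exp_tilt G)\<bar>"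
    unfolding abs_minus_cancel using m' I_F
    by (intro order_trans[OF abs_triangle_ineq]) (simp add: abs_mult)
  also have "\<dots> \<le> \<bar>m - m'\<bar> * exp (- x) + m' * (2 * \<eta> * exp (- x))"
    using m' by (intro add_mono mult_left_mono I_F I_diff) auto
  finally show ?thesis by (simp add: m_def m'_def algebra_simps)
qed

text \<open>All three follow from completing the square: exp(y) times the standard normal density is
  exp(1/2) times the density with mean 1.\<close>

lemma exp_integrable_std_normal: "exp_integrable_distribution std_normal_distribution"
  and exp_moment_std_normal: "(LINT y|std_normal_distribution. exp y) = exp (1 / 2)"
  and exp_tilt_std_normal: "exp_tilt std_normal_distribution = density lborel (normal_density 1 1)"
proof -
  interpret real_distribution std_normal_distribution by (rule real_dist_normal_dist)
  have eq: "std_normal_density y * exp y = exp (1 / 2) * normal_density 1 1 y" for y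
    by (simp add: normal_density_def exp_add[symmetric] power2_eq_square field_simps)
  have int: "integrable lborel (\<lambda>y. exp (1 / 2) * normal_density 1 1 y)"
    by (intro integrable_mult_right integrable_normal_density) simp
  have "integrable std_normal_distribution exp"
    using int by (subst integrable_density) (auto simp: eq)
  then show "exp_integrable_distribution std_normal_distribution"
    by unfold_locales
  have "(LINT y|std_normal_distribution. exp y) = (LBINT y. exp (1 / 2) * normal_density 1 1 y)"
    by (subst integral_density) (auto simp: eq)
  then show m: "(LINT y|std_normal_distribution. exp y) = exp (1 / 2)"
    by simp
  show "exp_tilt std_normal_distribution = density lborel (normal_density 1 1)"
    unfolding exp_tilt_def m
  proof (subst density_density_eq)
    show "density lborel (\<lambda>x. ennreal (std_normal_density x) * ennreal (exp x / exp (1 / 2)))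
        = density lborel (\<lambda>x. ennreal (normal_density 1 1 x))"
      by (intro density_cong) (auto simp: ennreal_mult'[symmetric] eq)
  qed auto
qed

lemma char_normal_1_1:
  "char (density lborel (normal_density 1 1)) t = exp (\<i> * t - (complex_of_real t)\<^sup>2 / 2)"
proof -
  interpret std: real_distribution std_normal_distribution by (rule real_dist_normal_dist)
  have "distributed std_normal_distribution lborel (\<lambda>x. x) std_normal_density"
    by (auto simp: distributed_def distr_id2)
  then have "distributed std_normal_distribution lborel (\<lambda>x. 1 + 1 * x) (normal_density (1 + 1 * 0) (\<bar>1\<bar> * 1))"
    by (intro std.normal_density_affine) auto
  then have *: "density lborel (normal_density 1 1) = distr std_normal_distribution lborel (\<lambda>x. 1 + x)"
    by (simp add: distributed_def)
  have "char (density lborel (normal_density 1 1)) t = (CLINT x|std_normal_distribution. iexp (t * (1 + x)))"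
    unfolding * char_def by (subst integral_distr) auto
  also have "\<dots> = iexp t * char std_normal_distribution t"
    unfolding char_def by (simp add: distrib_left exp_add)
  also have "\<dots> = iexp t * exp (- (complex_of_real t)\<^sup>2 / 2)"
    by (simp add: char_std_normal_distribution exp_of_real[symmetric])
  finally show ?thesis by (simp add: exp_add[symmetric])
qed

section \<open>Lipschitz bounds for distribution functions and holomorphic functions\<close>

lemma normal_density_le_1: "normal_density \<mu> 1 x \<le> 1"
proof -
  have "1 \<le> sqrt (2 * pi)" using pi_ge_two by (simp add: real_le_rsqrt)
  then have "1 / sqrt (2 * pi) * exp (- ((x - \<mu>)\<^sup>2 / 2)) \<le> 1 * 1"
    by (intro mult_mono) auto
  then show ?thesis by (simp add: normal_density_def)
qed

lemma cdf_density_lipschitz: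
  fixes f :: "real \<Rightarrow> real"
  assumes "real_distribution (density lborel f)" and [measurable]: "f \<in> borel_measurable borel"
    and "u \<le> v" "0 \<le> D" and le: "\<And>x. u \<le> x \<Longrightarrow> x \<le> v \<Longrightarrow> f x \<le> D"
  shows "cdf (density lborel f) v - cdf (density lborel f) u \<le> D * (v - u)"
proof -
  interpret real_distribution "density lborel f" by fact
  have "emeasure (density lborel f) {u<..v} = (\<integral>\<^sup>+x. ennreal (f x) * indicator {u<..v} x \<partial>lborel)"
    by (rule emeasure_density) auto
  also have "\<dots> \<le> (\<integral>\<^sup>+x. ennreal D * indicator {u<..v} x \<partial>lborel)"
    by (intro nn_integral_mono) (auto simp: indicator_def intro!: ennreal_leI le)
  also have "\<dots> = ennreal (D * (v - u))"
    using assms by (subst nn_integral_cmult_indicator) (auto simp: ennreal_mult)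
  finally show ?thesis
    using assms by (simp add: emeasure_Ioc ennreal_le_iff)
qed

text \<open>The constant is Cauchy's estimate for the derivative on circles of radius r/4, which
  stay inside \<open>ball 0 r\<close> around every point of the half ball.\<close>

lemma holomorphic_bounded_lipschitz:
  fixes f :: "complex \<Rightarrow> complex" and r D :: real
  assumes hol: "f holomorphic_on ball 0 r" and le: "\<And>z. z \<in> ball 0 r \<Longrightarrow> cmod (f z) \<le> D"
    and z: "z \<in> ball 0 (r / 2)" and w: "w \<in> ball 0 (r / 2)"
  shows "cmod (f z - f w) \<le> 4 * D / r * cmod (z - w)"
proof (rule field_differentiable_bound[OF convex_ball _ _ z w])
  have r: "r > 0" using z norm_ge_zero[of z] by (auto simp del: norm_ge_zero)
  fix u :: complex assume u: "u \<in> ball 0 (r / 2)"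
  have sub: "cball u (r / 4) \<subseteq> ball 0 r"
  proof
    fix v assume "v \<in> cball u (r / 4)"
    then have "cmod (u - v) \<le> r / 4" by (simp add: dist_norm)
    then show "v \<in> ball 0 r"
      using norm_triangle_ineq2[of v u] u r by (simp add: norm_minus_commute)
  qed
  have "u \<in> ball 0 r" using u r by simp
  then show "(f has_field_derivative deriv f u) (at u within ball 0 (r / 2))"
    using holomorphic_derivI[OF hol open_ball] has_field_derivative_at_within by blast
  have "cmod ((deriv ^^ 1) f u) \<le> fact 1 * D / (r / 4) ^ 1"
  proof (rule Cauchy_inequality)
    show "f holomorphic_on ball u (r / 4)" "continuous_on (cball u (r / 4)) f"
      using sub ball_subset_cball hol by (meson holomorphic_on_subset order_trans holomorphic_on_imp_continuous_on)+
    show "cmod (f x) \<le> D" if "cmod (u - x) = r / 4" for x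
      using that sub by (intro le) (auto simp: dist_norm)
  qed (use r in simp)
  then show "cmod (deriv f u) \<le> 4 * D / r" by (simp add: mult.commute)
qed

lemma cmod_exp_minus_1_le: "cmod (exp z - 1) \<le> cmod z * exp (cmod z)"
proof -
  have "cmod (exp z - exp 0) \<le> exp (cmod z) * cmod (z - 0)"
  proof (rule field_differentiable_bound[of "cball 0 (cmod z)"])
    show "(exp has_field_derivative exp u) (at u within cball 0 (cmod z))" for u :: complex
      by (rule has_field_derivative_at_within[OF DERIV_exp])
    show "cmod (exp u) \<le> exp (cmod z)" if "u \<in> cball 0 (cmod z)" for u
      using that norm_exp[of u] order_trans by fastforce
  qed auto
  then show ?thesis by (simp add: mult.commute)
qed

lemma deriv_bound_lipschitz:
  assumes hol: "f holomorphic_on ball 0 r" and "R < r"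
    and le: "\<And>u. u \<in> cball 0 R \<Longrightarrow> cmod (deriv f u) \<le> D" and "cmod z \<le> R" "cmod w \<le> R"
  shows "cmod (f z - f w) \<le> D * cmod (z - w)"
proof (rule field_differentiable_bound[of "cball 0 R"])
  show "(f has_field_derivative deriv f u) (at u within cball 0 R)" if "u \<in> cball 0 R" for u
  proof -
    have "u \<in> ball 0 r" using that \<open>R < r\<close> by simp
    then show ?thesis
      using holomorphic_derivI[OF hol open_ball] has_field_derivative_at_within by blast
  qed
qed (use assms in auto)

text \<open>The remainder vanishes at 0 together with its first two derivatives, and its third
  derivative is bounded by D on the half ball; three successive integrations give the claim. A bound
  O(|z|^3) would not do here: the remainders at two points are subtracted, and the result has to
  contain their distance.\<close>

lemma cubic_remainder_lipschitz:
  fixes \<Lambda> :: "complex \<Rightarrow> complex"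
  assumes hol: "\<Lambda> holomorphic_on ball 0 r" and "r > 0"
    and "\<Lambda> 0 = 0" "deriv \<Lambda> 0 = 0" "deriv (deriv \<Lambda>) 0 = c"
  obtains D where "D > 0"
    "\<And>z w R. \<lbrakk>cmod z \<le> R; cmod w \<le> R; R \<le> r / 2\<rbrakk> \<Longrightarrow>
      cmod ((\<Lambda> z - c * z\<^sup>2 / 2) - (\<Lambda> w - c * w\<^sup>2 / 2)) \<le> D * R\<^sup>2 * cmod (z - w)"
proof -
  define f where "f z = \<Lambda> z - c * z\<^sup>2 / 2" for z
  have holf: "f holomorphic_on ball 0 r"
    unfolding f_def by (intro holomorphic_intros hol) auto
  have hol1: "deriv f holomorphic_on ball 0 r" and hol2: "deriv (deriv f) holomorphic_on ball 0 r"
    and hol3: "deriv (deriv (deriv f)) holomorphic_on ball 0 r"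
    by (auto intro!: holomorphic_deriv holf)
  have d1: "deriv f z = deriv \<Lambda> z - c * z" if "z \<in> ball 0 r" for z
  proof (rule DERIV_imp_deriv)
    show "(f has_field_derivative deriv \<Lambda> z - c * z) (at z)"
      unfolding f_def
      by (rule derivative_eq_intros holomorphic_derivI[OF hol open_ball that] refl | simp)+
  qed
  have d2: "deriv (deriv f) 0 = deriv (deriv \<Lambda>) 0 - c"
  proof -
    have "deriv (deriv f) 0 = deriv (\<lambda>z. deriv \<Lambda> z - c * z) 0"
      using d1 \<open>r > 0\<close> by (intro deriv_cong_ev eventually_nhds_in_open[THEN eventually_mono, of "ball 0 r"]) auto
    also have "\<dots> = deriv (deriv \<Lambda>) 0 - c"
    proof (rule DERIV_imp_deriv)
      show "((\<lambda>z. deriv \<Lambda> z - c * z) has_field_derivative deriv (deriv \<Lambda>) 0 - c) (at 0)"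
        by (rule derivative_eq_intros holomorphic_derivI[OF holomorphic_deriv[OF hol open_ball] open_ball] refl
            | use \<open>r > 0\<close> in simp)+
    qed
    finally show ?thesis .
  qed
  obtain D0 where D0: "\<And>u. u \<in> cball 0 (r / 2) \<Longrightarrow> cmod (deriv (deriv (deriv f)) u) \<le> D0"
  proof -
    have "cball (0::complex) (r / 2) \<subseteq> ball 0 r" using \<open>r > 0\<close> by auto
    then have "compact (deriv (deriv (deriv f)) ` cball 0 (r / 2))"
      using hol3 by (intro compact_continuous_image)
        (auto intro: holomorphic_on_imp_continuous_on holomorphic_on_subset)
    then have "bounded (deriv (deriv (deriv f)) ` cball 0 (r / 2))"
      by (rule compact_imp_bounded)
    then obtain D0 where "\<forall>x\<in>deriv (deriv (deriv f)) ` cball 0 (r / 2). cmod x \<le> D0"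
      unfolding bounded_iff by (elim exE)
    then show ?thesis by (intro that[of D0]) (erule bspec, rule imageI)
  qed
  define D where "D = max D0 1"
  have "D > 0" by (simp add: D_def)
  have b3: "cmod (deriv (deriv (deriv f)) u) \<le> D" if "u \<in> cball 0 (r / 2)" for u
    using D0[OF that] by (simp add: D_def)
  have b2: "cmod (deriv (deriv f) u) \<le> D * cmod u" if "cmod u \<le> r / 2" for u
    using deriv_bound_lipschitz[OF hol2, of "cmod u" D u 0] that b3 \<open>r > 0\<close> assms d2 by simp
  have b1: "cmod (deriv f u) \<le> D * (cmod u)\<^sup>2" if "cmod u \<le> r / 2" for u
  proof -
    have le: "cmod (deriv (deriv f) v) \<le> D * cmod u" if "v \<in> cball 0 (cmod u)" for v
      using that \<open>cmod u \<le> r / 2\<close> \<open>D > 0\<close> by (intro order_trans[OF b2] mult_left_mono) auto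
    have "cmod (deriv f u - deriv f 0) \<le> (D * cmod u) * cmod (u - 0)"
      by (rule deriv_bound_lipschitz[OF hol1 _ le]) (use that \<open>r > 0\<close> in auto)
    then show ?thesis
      using \<open>r > 0\<close> assms d1[of 0] by (simp add: power2_eq_square mult.assoc)
  qed
  show thesis
  proof (rule that[OF \<open>D > 0\<close>])
    fix z w R assume *: "cmod z \<le> R" "cmod w \<le> R" "R \<le> r / 2"
    have le: "cmod (deriv f v) \<le> D * R\<^sup>2" if "v \<in> cball 0 R" for v
      using that * \<open>D > 0\<close> by (intro order_trans[OF b1] mult_left_mono power_mono) auto
    have "cmod (f z - f w) \<le> D * R\<^sup>2 * cmod (z - w)"
      by (rule deriv_bound_lipschitz[OF holf _ le *(1,2)]) (use * \<open>r > 0\<close> in auto)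
    then show "cmod ((\<Lambda> z - c * z\<^sup>2 / 2) - (\<Lambda> w - c * w\<^sup>2 / 2)) \<le> D * R\<^sup>2 * cmod (z - w)"
      by (simp add: f_def)
  qed
qed

text \<open>Supplies an integrable majorant. With u = t^2/4 the factor 32 matches the quadratic term
  of (1 + 4u)^2 with that of the Taylor bound for exp u.\<close>

lemma gaussian_le_cauchy: "(1 + t\<^sup>2) * exp (- t\<^sup>2 / 4) \<le> 32 * inverse (1 + t\<^sup>2)" for t :: real
proof -
  define u where "u = t\<^sup>2 / 4"
  have u: "u \<ge> 0" by (simp add: u_def)
  have "(1 + 4 * u)\<^sup>2 \<le> 32 * (1 + u + u\<^sup>2 / 2)"
    using u by (simp add: power2_eq_square algebra_simps)
  also have "\<dots> \<le> 32 * exp u"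
    using exp_lower_Taylor_quadratic[OF u] by simp
  finally have "(1 + 4 * u)\<^sup>2 \<le> 32 * exp u" .
  then show ?thesis
    using u by (simp add: u_def[symmetric] exp_minus field_simps power2_eq_square add_pos_nonneg)
      (simp add: u_def field_simps power2_eq_square)
qed

text \<open>Put z = (1+it)/s and w = 1/s. Because n sigma^2 = s^2, the quadratic parts of n
  Lambda(z) - n Lambda(w) combine to exactly it - t^2/2, the exponent of the normal law with mean 1.
  What remains is the factor exp E from the cubic remainders and the quotient q = W z / W w. Both
  differ from 1 by a multiple of |z - w| = |t|/s, with growth in t that the Gaussian absorbs. The
  second claim repeats the comparison with w and 0 for the normalising moment.\<close>

lemma tilted_char_estimate:
  fixes \<Lambda> W :: "complex \<Rightarrow> complex" and \<sigma> s C D K r t :: real and n :: nat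
  assumes "\<sigma> > 0" "s > 0" "D > 0" "K > 0" "C > 0" and s: "real n * \<sigma>\<^sup>2 = s\<^sup>2"
    and \<Lambda>: "\<And>z w R. \<lbrakk>cmod z \<le> R; cmod w \<le> R; R \<le> r\<rbrakk> \<Longrightarrow>
      cmod ((\<Lambda> z - (complex_of_real \<sigma>)\<^sup>2 * z\<^sup>2 / 2) - (\<Lambda> w - (complex_of_real \<sigma>)\<^sup>2 * w\<^sup>2 / 2)) \<le> D * R\<^sup>2 * cmod (z - w)"
    and W_lip: "\<And>z w. \<lbrakk>cmod z \<le> r; cmod w \<le> r\<rbrakk> \<Longrightarrow> cmod (W z - W w) \<le> K * cmod (z - w)"
    and W_le: "\<And>z. cmod z \<le> r \<Longrightarrow> cmod (W z) \<le> C" and "W 0 = 1" "\<Lambda> 0 = 0"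
    and \<kappa>: "2 * \<kappa> \<le> r" "\<kappa> * (8 * D) \<le> \<sigma>\<^sup>2" "1 \<le> \<kappa> * s" "2 * K \<le> s"
    and t: "\<bar>t\<bar> \<le> \<kappa> * s"
  shows "cmod (exp (of_nat n * \<Lambda> ((1 + \<i> * t) / s)) * W ((1 + \<i> * t) / s) / (exp (of_nat n * \<Lambda> (1 / s)) * W (1 / s))
        - exp (\<i> * t - (complex_of_real t)\<^sup>2 / 2))
      \<le> \<bar>t\<bar> * (32 * (4 * C * D / \<sigma>\<^sup>2 * exp (1 / 4) + 2 * K) / s * inverse (1 + t\<^sup>2))"
    and "cmod (exp (of_nat n * \<Lambda> (1 / s)) * W (1 / s) - exp (1 / 2)) \<le> exp 1 * (C * D / \<sigma>\<^sup>2 + K) / s"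
proof -
  define z w where "z = (1 + \<i> * complex_of_real t) / complex_of_real s" and "w = 1 / complex_of_real s"
  define \<rho> where "\<rho> z = \<Lambda> z - (complex_of_real \<sigma>)\<^sup>2 * z\<^sup>2 / 2" for z
  define q where "q = W z / W w"
  have n_eq: "real n = s\<^sup>2 / \<sigma>\<^sup>2" using s \<open>\<sigma> > 0\<close> by (simp add: field_simps)
  have n_c: "of_nat n * (complex_of_real \<sigma>)\<^sup>2 = (complex_of_real s)\<^sup>2"
    using arg_cong[OF s, of complex_of_real] by simp
  have inv_s: "1 / s \<le> \<kappa>" using \<kappa> \<open>s > 0\<close> by (simp add: field_simps)
  have "\<kappa> > 0" using inv_s \<open>s > 0\<close> order.strict_trans2[of 0 "1 / s" \<kappa>] by simp
  have w_norm: "cmod w = 1 / s" using \<open>s > 0\<close> by (simp add: w_def norm_divide)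
  have z_norm: "cmod z \<le> (1 + \<bar>t\<bar>) / s"
    using norm_triangle_ineq[of 1 "\<i> * complex_of_real t"] \<open>s > 0\<close>
    by (simp add: z_def norm_divide norm_mult divide_right_mono)
  have R_le: "(1 + \<bar>t\<bar>) / s \<le> r"
  proof -
    have "(1 + \<bar>t\<bar>) / s \<le> (\<kappa> * s + \<kappa> * s) / s" using t \<kappa> \<open>s > 0\<close> by (intro divide_right_mono) auto
    then show ?thesis using \<kappa> \<open>s > 0\<close> by simp
  qed
  have w_le: "cmod w \<le> (1 + \<bar>t\<bar>) / s" using w_norm \<open>s > 0\<close> by (simp add: divide_right_mono)
  have zr: "cmod z \<le> r" and wr: "cmod w \<le> r" and r0: "0 \<le> r"
    using z_norm w_le R_le order_trans[OF norm_ge_zero] by (fastforce intro: order_trans)+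
  have zw: "cmod (z - w) = \<bar>t\<bar> / s"
    using \<open>s > 0\<close> by (simp add: z_def w_def diff_divide_distrib[symmetric] norm_divide norm_mult)

  define E where "E = of_nat n * (\<rho> z - \<rho> w)"
  have E_le: "cmod E \<le> D / \<sigma>\<^sup>2 * (1 + \<bar>t\<bar>)\<^sup>2 * (\<bar>t\<bar> / s)"
  proof -
    have "cmod E \<le> real n * (D * ((1 + \<bar>t\<bar>) / s)\<^sup>2 * cmod (z - w))"
      unfolding E_def norm_mult norm_of_nat \<rho>_def
      by (intro mult_left_mono \<Lambda> z_norm w_le R_le) simp
    also have "\<dots> = D / \<sigma>\<^sup>2 * (1 + \<bar>t\<bar>)\<^sup>2 * (\<bar>t\<bar> / s)"
      using \<open>s > 0\<close> by (simp add: n_eq zw power_divide)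
    finally show ?thesis .
  qed
  have sq: "(1 + \<bar>t\<bar>)\<^sup>2 \<le> 2 * (1 + t\<^sup>2)"
    using zero_le_power2[of "1 - \<bar>t\<bar>"] by (simp add: power2_eq_square algebra_simps)
  \<comment> \<open>The window |t|/s \<le> \<open>\<kappa>\<close> and the condition
    \<open>\<kappa> * (8 * D) \<le> \<sigma>\<^sup>2\<close> are used here. The coefficient 1/4 of
    t^2 is half of the Gaussian exponent, so decay exp(-t^2/4) survives.\<close>
  have E_le': "cmod E \<le> 1 / 4 + t\<^sup>2 / 4"
  proof -
    have "cmod E \<le> D / \<sigma>\<^sup>2 * (2 * (1 + t\<^sup>2)) * \<kappa>"
      using \<open>D > 0\<close> \<open>\<kappa> > 0\<close> \<open>s > 0\<close> t sq
      by (intro order_trans[OF E_le] mult_mono) (auto simp: divide_le_eq)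
    also have "\<dots> = (\<kappa> * (8 * D) / \<sigma>\<^sup>2) * ((1 + t\<^sup>2) / 4)" by simp
    also have "\<dots> \<le> 1 * ((1 + t\<^sup>2) / 4)"
      using \<kappa> \<open>\<sigma> > 0\<close> by (intro mult_right_mono) (auto simp: divide_le_eq)
    finally show ?thesis by (simp add: add_divide_distrib)
  qed
  have exponent: "of_nat n * \<Lambda> z - of_nat n * \<Lambda> w = \<i> * t - (complex_of_real t)\<^sup>2 / 2 + E"
  proof -
    have "of_nat n * \<Lambda> z - of_nat n * \<Lambda> w = of_nat n * (complex_of_real \<sigma>)\<^sup>2 * (z\<^sup>2 - w\<^sup>2) / 2 + E"
      by (simp add: E_def \<rho>_def field_simps)
    also have "of_nat n * (complex_of_real \<sigma>)\<^sup>2 * (z\<^sup>2 - w\<^sup>2) = (1 + \<i> * complex_of_real t)\<^sup>2 - 1"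
      unfolding n_c using \<open>s > 0\<close> by (simp add: z_def w_def power_divide diff_divide_distrib[symmetric])
    also have "\<dots> = 2 * (\<i> * t - (complex_of_real t)\<^sup>2 / 2)"
      by (simp add: power2_eq_square algebra_simps)
    finally show ?thesis by simp
  qed
  have W_w1: "cmod (W w - 1) \<le> K / s"
    using W_lip[OF wr, of 0] r0 \<open>W 0 = 1\<close> w_norm by simp
  \<comment> \<open>The condition \<open>2 * K \<le> s\<close> keeps W w away from 0, so that
    dividing by it costs at most a factor 2.\<close>
  have W_w: "1 / 2 \<le> cmod (W w)"
  proof -
    have "K / s \<le> 1 / 2" using \<kappa> \<open>s > 0\<close> by (simp add: field_simps)
    moreover have "1 - cmod (W w) \<le> cmod (W w - 1)"
      using norm_triangle_ineq2[of 1 "W w"] by (simp add: norm_minus_commute)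
    ultimately show ?thesis using W_w1 by linarith
  qed
  then have "W w \<noteq> 0" by auto
  have q_le: "cmod q \<le> 2 * C"
  proof -
    have "cmod (W z) \<le> C" by (rule W_le[OF zr])
    also have "\<dots> \<le> 2 * C * cmod (W w)"
      using mult_left_mono[OF W_w, of "2 * C"] \<open>C > 0\<close> by simp
    finally show ?thesis
      using \<open>W w \<noteq> 0\<close> by (simp add: q_def norm_divide divide_le_eq)
  qed
  have q_1: "cmod (q - 1) \<le> 2 * K * (\<bar>t\<bar> / s)"
  proof -
    have "cmod (W z - W w) \<le> K * (\<bar>t\<bar> / s)" using W_lip[OF zr wr] zw by simp
    also have "\<dots> \<le> 2 * K * (\<bar>t\<bar> / s) * cmod (W w)"
      using mult_left_mono[OF W_w, of "2 * K * (\<bar>t\<bar> / s)"] \<open>K > 0\<close> \<open>s > 0\<close> by simp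
    finally have "cmod (W z - W w) / cmod (W w) \<le> 2 * K * (\<bar>t\<bar> / s)"
      using \<open>W w \<noteq> 0\<close> by (simp add: divide_le_eq)
    moreover have "q - 1 = (W z - W w) / W w" using \<open>W w \<noteq> 0\<close> by (simp add: q_def field_simps)
    ultimately show ?thesis by (simp add: norm_divide)
  qed
  have ratio: "exp (of_nat n * \<Lambda> z) * W z / (exp (of_nat n * \<Lambda> w) * W w)
      = exp (\<i> * t - (complex_of_real t)\<^sup>2 / 2) * (exp E * q)"
  proof -
    have "exp (of_nat n * \<Lambda> z) * W z / (exp (of_nat n * \<Lambda> w) * W w) = exp (of_nat n * \<Lambda> z - of_nat n * \<Lambda> w) * q"
      by (simp add: exp_diff q_def)
    then show ?thesis by (simp add: exponent exp_add)
  qed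
  have gauss: "cmod (exp (\<i> * t - (complex_of_real t)\<^sup>2 / 2)) = exp (- t\<^sup>2 / 2)"
    by (simp add: norm_exp_eq_Re power2_eq_square)
  have step: "cmod (exp E * q - 1) \<le> (\<bar>t\<bar> / s) * ((4 * C * D / \<sigma>\<^sup>2 * exp (1 / 4) + 2 * K) * ((1 + t\<^sup>2) * exp (t\<^sup>2 / 4)))"
  proof -
    have "exp E * q - 1 = (exp E - 1) * q + (q - 1)" by (simp add: algebra_simps)
    then have "cmod (exp E * q - 1) \<le> cmod (exp E - 1) * cmod q + cmod (q - 1)"
      using norm_triangle_ineq norm_mult by metis
    also have "\<dots> \<le> (D / \<sigma>\<^sup>2 * (2 * (1 + t\<^sup>2)) * (\<bar>t\<bar> / s) * exp (1 / 4 + t\<^sup>2 / 4)) * (2 * C) + 2 * K * (\<bar>t\<bar> / s) * 1"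
    proof (intro add_mono mult_mono q_le)
      have "cmod (exp E - 1) \<le> cmod E * exp (cmod E)" by (rule cmod_exp_minus_1_le)
      also have "\<dots> \<le> (D / \<sigma>\<^sup>2 * (1 + \<bar>t\<bar>)\<^sup>2 * (\<bar>t\<bar> / s)) * exp (1 / 4 + t\<^sup>2 / 4)"
        using E_le E_le' \<open>D > 0\<close> \<open>s > 0\<close> by (intro mult_mono) auto
      also have "\<dots> \<le> (D / \<sigma>\<^sup>2 * (2 * (1 + t\<^sup>2)) * (\<bar>t\<bar> / s)) * exp (1 / 4 + t\<^sup>2 / 4)"
        using sq \<open>D > 0\<close> \<open>s > 0\<close> by (intro mult_right_mono mult_left_mono) auto
      finally show "cmod (exp E - 1) \<le> (D / \<sigma>\<^sup>2 * (2 * (1 + t\<^sup>2)) * (\<bar>t\<bar> / s)) * exp (1 / 4 + t\<^sup>2 / 4)" .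
      show "cmod (q - 1) \<le> 2 * K * (\<bar>t\<bar> / s) * 1" using q_1 by simp
      have "0 \<le> D / \<sigma>\<^sup>2 * (2 * (1 + t\<^sup>2)) * (\<bar>t\<bar> / s)"
        using \<open>D > 0\<close> \<open>s > 0\<close> by (intro mult_nonneg_nonneg) auto
      then show "0 \<le> D / \<sigma>\<^sup>2 * (2 * (1 + t\<^sup>2)) * (\<bar>t\<bar> / s) * exp (1 / 4 + t\<^sup>2 / 4)"
        by (rule mult_nonneg_nonneg) simp
    qed simp
    \<comment> \<open>The second summand is enlarged so that both share the growth factor
      \<open>(1 + t\<^sup>2) * exp (t\<^sup>2 / 4)\<close>.\<close>
    also have "\<dots> \<le> (D / \<sigma>\<^sup>2 * (2 * (1 + t\<^sup>2)) * (\<bar>t\<bar> / s) * exp (1 / 4 + t\<^sup>2 / 4)) * (2 * C)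
        + 2 * K * (\<bar>t\<bar> / s) * ((1 + t\<^sup>2) * exp (t\<^sup>2 / 4))"
    proof -
      have "1 * 1 \<le> (1 + t\<^sup>2) * exp (t\<^sup>2 / 4)" by (intro mult_mono) auto
      then have "1 \<le> (1 + t\<^sup>2) * exp (t\<^sup>2 / 4)" by simp
      moreover have "0 \<le> 2 * K * (\<bar>t\<bar> / s)" using \<open>K > 0\<close> \<open>s > 0\<close> by simp
      ultimately show ?thesis by (intro add_left_mono mult_left_mono)
    qed
    also have "\<dots> = (\<bar>t\<bar> / s) * ((4 * C * D / \<sigma>\<^sup>2 * exp (1 / 4) + 2 * K) * ((1 + t\<^sup>2) * exp (t\<^sup>2 / 4)))"
      unfolding exp_add by (simp add: algebra_simps)
    finally show ?thesis .
  qed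
  define K' where "K' = 4 * C * D / \<sigma>\<^sup>2 * exp (1 / 4) + 2 * K"
  have "K' \<ge> 0" using assms by (simp add: K'_def)
  have "cmod (exp (of_nat n * \<Lambda> z) * W z / (exp (of_nat n * \<Lambda> w) * W w) - exp (\<i> * t - (complex_of_real t)\<^sup>2 / 2))
      = exp (- t\<^sup>2 / 2) * cmod (exp E * q - 1)"
    unfolding ratio gauss[symmetric] norm_mult[symmetric] by (simp add: algebra_simps)
  also have "\<dots> \<le> exp (- t\<^sup>2 / 2) * ((\<bar>t\<bar> / s) * (K' * ((1 + t\<^sup>2) * exp (t\<^sup>2 / 4))))"
    using step unfolding K'_def by (intro mult_left_mono) auto
  also have "\<dots> = (\<bar>t\<bar> / s) * K' * ((1 + t\<^sup>2) * (exp (- t\<^sup>2 / 2) * exp (t\<^sup>2 / 4)))"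
    by simp
  also have "exp (- t\<^sup>2 / 2) * exp (t\<^sup>2 / 4) = exp (- t\<^sup>2 / 4)"
    by (simp add: exp_add[symmetric])
  also have "(\<bar>t\<bar> / s) * K' * ((1 + t\<^sup>2) * exp (- t\<^sup>2 / 4)) \<le> (\<bar>t\<bar> / s) * K' * (32 * inverse (1 + t\<^sup>2))"
    using \<open>s > 0\<close> \<open>K' \<ge> 0\<close> by (intro mult_left_mono gaussian_le_cauchy) auto
  also have "\<dots> = \<bar>t\<bar> * (32 * K' / s * inverse (1 + t\<^sup>2))" by simp
  finally show "cmod (exp (of_nat n * \<Lambda> ((1 + \<i> * t) / s)) * W ((1 + \<i> * t) / s) / (exp (of_nat n * \<Lambda> (1 / s)) * W (1 / s))
        - exp (\<i> * t - (complex_of_real t)\<^sup>2 / 2))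
      \<le> \<bar>t\<bar> * (32 * (4 * C * D / \<sigma>\<^sup>2 * exp (1 / 4) + 2 * K) / s * inverse (1 + t\<^sup>2))"
    unfolding z_def w_def K'_def by simp

  define E' where "E' = of_nat n * (\<rho> w - \<rho> 0)"
  have E'_le: "cmod E' \<le> D / \<sigma>\<^sup>2 / s"
  proof -
    have "cmod E' \<le> real n * (D * (1 / s)\<^sup>2 * cmod (w - 0))"
      unfolding E'_def norm_mult norm_of_nat \<rho>_def
      using w_norm wr \<open>s > 0\<close> by (intro mult_left_mono \<Lambda>) auto
    also have "\<dots> = D / \<sigma>\<^sup>2 / s"
      using \<open>s > 0\<close> by (simp add: n_eq w_norm power_divide)
    finally show ?thesis .
  qed
  have E'_le': "cmod E' \<le> 1 / 2"
  proof -
    have "D / \<sigma>\<^sup>2 / s \<le> D / \<sigma>\<^sup>2 * \<kappa>"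
      using inv_s \<open>D > 0\<close> mult_left_mono[of "1 / s" \<kappa> "D / \<sigma>\<^sup>2"] by simp
    also have "\<dots> \<le> 1 / 8" using \<kappa> \<open>\<sigma> > 0\<close> by (simp add: field_simps)
    finally have "D / \<sigma>\<^sup>2 / s \<le> 1 / 8" .
    then show ?thesis using E'_le by linarith
  qed
  have exponent': "of_nat n * \<Lambda> w = 1 / 2 + E'"
  proof -
    have "of_nat n * \<Lambda> w = of_nat n * (complex_of_real \<sigma>)\<^sup>2 * w\<^sup>2 / 2 + E'"
      using \<open>\<Lambda> 0 = 0\<close> by (simp add: E'_def \<rho>_def field_simps)
    also have "of_nat n * (complex_of_real \<sigma>)\<^sup>2 * w\<^sup>2 = 1"
      unfolding n_c using \<open>s > 0\<close> by (simp add: w_def power_divide)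
    finally show ?thesis .
  qed
  show "cmod (exp (of_nat n * \<Lambda> (1 / s)) * W (1 / s) - exp (1 / 2)) \<le> exp 1 * (C * D / \<sigma>\<^sup>2 + K) / s"
  proof -
    have "exp (of_nat n * \<Lambda> w) * W w - exp (1 / 2) = exp (1 / 2) * ((exp E' - 1) * W w + (W w - 1))"
      unfolding exponent' exp_add by (simp add: algebra_simps)
    also have "cmod \<dots> = exp (1 / 2) * cmod ((exp E' - 1) * W w + (W w - 1))"
      by (simp add: norm_mult norm_exp_eq_Re)
    also have "\<dots> \<le> exp (1 / 2) * ((D / \<sigma>\<^sup>2 / s * exp (1 / 2)) * C + K / s * exp (1 / 2))"
    proof (intro mult_left_mono order_trans[OF norm_triangle_ineq] add_mono)
      have "cmod (exp E' - 1) \<le> cmod E' * exp (cmod E')" by (rule cmod_exp_minus_1_le)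
      also have "\<dots> \<le> D / \<sigma>\<^sup>2 / s * exp (1 / 2)"
        using E'_le E'_le' \<open>D > 0\<close> \<open>s > 0\<close> by (intro mult_mono) auto
      finally show "cmod ((exp E' - 1) * W w) \<le> D / \<sigma>\<^sup>2 / s * exp (1 / 2) * C"
        unfolding norm_mult using W_le[OF wr] \<open>D > 0\<close> \<open>s > 0\<close> by (intro mult_mono) auto
      have "K / s * 1 \<le> K / s * exp (1 / 2)" using \<open>K > 0\<close> \<open>s > 0\<close> by (intro mult_left_mono) auto
      then show "cmod (W w - 1) \<le> K / s * exp (1 / 2)" using W_w1 by simp
    qed simp
    also have "\<dots> = (exp (1 / 2) * exp (1 / 2)) * (C * D / \<sigma>\<^sup>2 + K) / s"
      by (simp add: algebra_simps add_divide_distrib)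
    also have "exp (1 / 2) * exp (1 / 2) = exp (1::real)" by (simp add: exp_add[symmetric])
    finally show ?thesis by (simp add: w_def)
  qed
qed

text \<open>Esseen's inequality is applied to the tilted laws with T = \<open>\<kappa> * s n\<close>
  and fixed \<open>\<kappa>\<close>: for |t| up to T the point (1+it)/s n stays in the ball where
  the moment generating function is known. The integral of the majorant and the smoothing term 1/T
  are both of order 1/s n. \<open>cdf_diff_via_exp_tilt\<close> then produces the weight
  exp(-x).\<close>

lemma mgf_berry_esseen_one_sided:
  fixes F :: "nat \<Rightarrow> real measure" and \<Lambda> :: "complex \<Rightarrow> complex" and W :: "nat \<Rightarrow> complex \<Rightarrow> complex"
    and \<sigma> r C :: real
  assumes F: "\<And>n. exp_integrable_distribution (F n)" and "\<sigma> > 0" "r > 0"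
    and hol: "\<Lambda> holomorphic_on ball 0 r" "\<And>n. n \<ge> 1 \<Longrightarrow> W n holomorphic_on ball 0 r"
    and \<Lambda>: "\<Lambda> 0 = 0" "deriv \<Lambda> 0 = 0" "deriv (deriv \<Lambda>) 0 = (complex_of_real \<sigma>)\<^sup>2"
    and W: "\<And>n. n \<ge> 1 \<Longrightarrow> W n 0 = 1" "\<And>n z. n \<ge> 1 \<Longrightarrow> z \<in> ball 0 r \<Longrightarrow> cmod (W n z) \<le> C"
    and mgf: "\<And>n z. n \<ge> 1 \<Longrightarrow> z \<in> ball 0 r \<Longrightarrow>
      (CLINT y|F n. exp (z * complex_of_real (\<sigma> * sqrt (real n) * y))) = exp (of_nat n * \<Lambda> z) * W n z"
  shows "\<exists>c n0. \<forall>n\<ge>n0. \<forall>x. \<bar>cdf (F n) x - cdf std_normal_distribution x\<bar> \<le> c / sqrt (real n) * exp (- x)"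
proof (rule cubic_remainder_lipschitz[OF hol(1) \<open>r > 0\<close> \<Lambda>])
  fix D :: real assume "D > 0" and D: "\<And>z w R. \<lbrakk>cmod z \<le> R; cmod w \<le> R; R \<le> r / 2\<rbrakk> \<Longrightarrow>
      cmod ((\<Lambda> z - (complex_of_real \<sigma>)\<^sup>2 * z\<^sup>2 / 2) - (\<Lambda> w - (complex_of_real \<sigma>)\<^sup>2 * w\<^sup>2 / 2)) \<le> D * R\<^sup>2 * cmod (z - w)"
  have "C > 0" using W(1)[of 1] W(2)[of 1 0] \<open>r > 0\<close> by simp
  define K where "K = 4 * C / r"
  have "K > 0" using \<open>C > 0\<close> \<open>r > 0\<close> by (simp add: K_def)
  have W_lip: "cmod (W n z - W n w) \<le> K * cmod (z - w)"
    if "n \<ge> 1" "cmod z \<le> r / 4" "cmod w \<le> r / 4" for n z w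
    unfolding K_def using that \<open>r > 0\<close>
    by (intro holomorphic_bounded_lipschitz[OF hol(2)[OF that(1)] W(2)[OF that(1)]]) auto
  \<comment> \<open>The entry r/8 keeps |(1+it)/s n| at most \<open>2 * \<kappa>\<close>, hence
    within r/4, where W n is Lipschitz. The other entry makes the cubic remainder small against the
    Gaussian exponent.\<close>
  define \<kappa> where "\<kappa> = min (r / 8) (\<sigma>\<^sup>2 / (8 * D))"
  have "\<kappa> > 0" using \<open>r > 0\<close> \<open>\<sigma> > 0\<close> \<open>D > 0\<close> by (simp add: \<kappa>_def)
  have \<kappa>_r: "2 * \<kappa> \<le> r / 4" by (simp add: \<kappa>_def)
  have "\<kappa> \<le> \<sigma>\<^sup>2 / (8 * D)" by (simp add: \<kappa>_def)
  then have \<kappa>_D: "\<kappa> * (8 * D) \<le> \<sigma>\<^sup>2" using \<open>D > 0\<close> by (simp add: field_simps)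
  define s where "s n = \<sigma> * sqrt (real n)" for n :: nat
  have "filterlim s at_top sequentially"
    unfolding s_def using \<open>\<sigma> > 0\<close>
    by (intro filterlim_tendsto_pos_mult_at_top[OF tendsto_const] filterlim_compose[OF sqrt_at_top filterlim_real_sequentially])
  then have "\<forall>\<^sub>F n in sequentially. max (1 / \<kappa>) (2 * K) \<le> s n"
    unfolding filterlim_at_top by (rule spec)
  then obtain n1 where n1: "\<And>n. n \<ge> n1 \<Longrightarrow> 1 / \<kappa> \<le> s n \<and> 2 * K \<le> s n"
    by (auto simp: eventually_sequentially)
  show ?thesis
  proof (rule esseen_smoothing)
    fix A :: real assume "A > 0" and A: "\<And>F G L T x (g :: real \<Rightarrow> real). \<lbrakk>real_distribution F; real_distribution G; T > 0; L \<ge> 0;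
         \<And>u v. u \<le> v \<Longrightarrow> cdf G v - cdf G u \<le> L * (v - u);
         integrable lborel g; \<And>t. 0 \<le> g t;
         \<And>t. \<bar>t\<bar> \<le> T \<Longrightarrow> cmod (char F t - char G t) \<le> \<bar>t\<bar> * g t\<rbrakk>
       \<Longrightarrow> \<bar>cdf F x - cdf G x\<bar> \<le> A * ((LBINT t. g t) + L / T)"
    define K1 where "K1 = 32 * (4 * C * D / \<sigma>\<^sup>2 * exp (1 / 4) + 2 * K)"
    define J where "J = (LBINT t::real. inverse (1 + t\<^sup>2))"
    define K2 where "K2 = A * (K1 * J + 1 / \<kappa>)"
    define K3 where "K3 = exp 1 * (C * D / \<sigma>\<^sup>2 + K)"
    have "K1 \<ge> 0" using \<open>C > 0\<close> \<open>D > 0\<close> \<open>K > 0\<close> by (simp add: K1_def)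
    have main: "\<bar>cdf (F n) x - cdf std_normal_distribution x\<bar> \<le> (K3 + 2 * exp (1 / 2) * K2) / \<sigma> / sqrt (real n) * exp (- x)"
      if n: "n \<ge> max 1 n1" for n x
    proof -
      interpret exp_integrable_distribution "F n" by (rule F)
      have "n \<ge> 1" using n by simp
      have s: "s n > 0" using n \<open>\<sigma> > 0\<close> by (simp add: s_def)
      have s_\<kappa>: "1 \<le> \<kappa> * s n" and s_K: "2 * K \<le> s n"
        using n1[of n] n \<open>\<kappa> > 0\<close> by (auto simp: field_simps)
      have n_s: "real n * \<sigma>\<^sup>2 = (s n)\<^sup>2" by (simp add: s_def power_mult_distrib)
      have \<Lambda>_rem: "cmod ((\<Lambda> z - (complex_of_real \<sigma>)\<^sup>2 * z\<^sup>2 / 2) - (\<Lambda> w - (complex_of_real \<sigma>)\<^sup>2 * w\<^sup>2 / 2))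
          \<le> D * R\<^sup>2 * cmod (z - w)" if "cmod z \<le> R" "cmod w \<le> R" "R \<le> r / 4" for z w R
        using that \<open>r > 0\<close> by (intro D) auto
      have W_le: "cmod (W n z) \<le> C" if "cmod z \<le> r / 4" for z
        using that \<open>r > 0\<close> by (intro W(2)[OF \<open>n \<ge> 1\<close>]) auto
      have est: "cmod (exp (of_nat n * \<Lambda> ((1 + \<i> * t) / s n)) * W n ((1 + \<i> * t) / s n)
            / (exp (of_nat n * \<Lambda> (1 / s n)) * W n (1 / s n)) - exp (\<i> * t - (complex_of_real t)\<^sup>2 / 2))
          \<le> \<bar>t\<bar> * (K1 / s n * inverse (1 + t\<^sup>2))" if "\<bar>t\<bar> \<le> \<kappa> * s n" for t
        unfolding K1_def by (rule tilted_char_estimate(1)[OF \<open>\<sigma> > 0\<close> s \<open>D > 0\<close> \<open>K > 0\<close> \<open>C > 0\<close> n_s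
          \<Lambda>_rem W_lip[OF \<open>n \<ge> 1\<close>] W_le W(1)[OF \<open>n \<ge> 1\<close>] \<Lambda>(1) \<kappa>_r \<kappa>_D s_\<kappa> s_K that])
      have est_0: "cmod (exp (of_nat n * \<Lambda> (1 / s n)) * W n (1 / s n) - exp (1 / 2)) \<le> K3 / s n"
        unfolding K3_def by (rule tilted_char_estimate(2)[OF \<open>\<sigma> > 0\<close> s \<open>D > 0\<close> \<open>K > 0\<close> \<open>C > 0\<close> n_s
          \<Lambda>_rem W_lip[OF \<open>n \<ge> 1\<close>] W_le W(1)[OF \<open>n \<ge> 1\<close>] \<Lambda>(1) \<kappa>_r \<kappa>_D s_\<kappa> s_K, of 0])
          (use \<open>\<kappa> > 0\<close> s in auto)
      define m where "m = (LINT y|F n. exp y)"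
      have mgf': "(CLINT y|F n. exp ((1 + \<i> * t) * complex_of_real y))
          = exp (of_nat n * \<Lambda> ((1 + \<i> * t) / s n)) * W n ((1 + \<i> * t) / s n)" if t: "\<bar>t\<bar> \<le> \<kappa> * s n" for t
      proof -
        have "cmod ((1 + \<i> * t) / s n) \<le> (1 + \<bar>t\<bar>) / s n"
          using norm_triangle_ineq[of 1 "\<i> * complex_of_real t"] s
          by (simp add: norm_divide norm_mult divide_right_mono)
        also have "\<dots> \<le> (\<kappa> * s n + \<kappa> * s n) / s n"
          using t s_\<kappa> s by (intro divide_right_mono) auto
        also have "\<dots> < r" using s \<kappa>_r \<open>r > 0\<close> by simp
        finally have "(1 + \<i> * t) / s n \<in> ball 0 r" by simp
        moreover have "(1 + \<i> * t) / s n * complex_of_real (s n * y) = (1 + \<i> * t) * complex_of_real y" for y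
          using s by simp
        ultimately show ?thesis
          using mgf[OF \<open>n \<ge> 1\<close>, of "(1 + \<i> * t) / s n"] by (simp only: s_def[symmetric])
      qed
      have m: "complex_of_real m = exp (of_nat n * \<Lambda> (1 / s n)) * W n (1 / s n)"
      proof -
        have "complex_of_real m = (CLINT y|F n. exp (complex_of_real y))"
          unfolding m_def integral_complex_of_real[symmetric] by (simp add: exp_of_real)
        then show ?thesis using mgf'[of 0] \<open>\<kappa> > 0\<close> s by simp
      qed
      define g where "g t = K1 / s n * inverse (1 + t\<^sup>2)" for t :: real
      have g_int: "integrable lborel g"
        unfolding g_def[abs_def] by (intro integrable_mult_right integrable_inverse_one_plus_square)
      have close: "\<bar>cdf (exp_tilt (F n)) u - cdf (exp_tilt std_normal_distribution) u\<bar> \<le> K2 / s n" for u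
      proof -
        interpret std: exp_integrable_distribution std_normal_distribution by (rule exp_integrable_std_normal)
        have "\<bar>cdf (exp_tilt (F n)) u - cdf (exp_tilt std_normal_distribution) u\<bar> \<le> A * ((LBINT t. g t) + 1 / (\<kappa> * s n))"
        proof (rule A[OF real_distribution_exp_tilt std.real_distribution_exp_tilt _ _ _ g_int])
          show "cdf (exp_tilt std_normal_distribution) v - cdf (exp_tilt std_normal_distribution) u \<le> 1 * (v - u)"
            if "u \<le> v" for u v
            using std.real_distribution_exp_tilt that normal_density_le_1 unfolding exp_tilt_std_normal
            by (intro cdf_density_lipschitz) auto
          show "0 \<le> g t" for t using \<open>K1 \<ge> 0\<close> s by (simp add: g_def)
          show "cmod (char (exp_tilt (F n)) t - char (exp_tilt std_normal_distribution) t) \<le> \<bar>t\<bar> * g t"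
            if t: "\<bar>t\<bar> \<le> \<kappa> * s n" for t
            unfolding char_exp_tilt m_def[symmetric] mgf'[OF t] m exp_tilt_std_normal char_normal_1_1 g_def
            by (rule est[OF t])
        qed (use s \<open>\<kappa> > 0\<close> in simp_all)
        also have "(LBINT t. g t) = K1 / s n * J"
          by (simp add: g_def[abs_def] J_def)
        also have "A * (K1 / s n * J + 1 / (\<kappa> * s n)) = K2 / s n"
          using s by (simp add: K2_def field_simps)
        finally show ?thesis .
      qed
      have "cmod (complex_of_real (m - exp (1 / 2))) \<le> K3 / s n"
        unfolding of_real_diff m using est_0 by (simp add: exp_of_real[symmetric])
      then have m_close: "\<bar>m - exp (1 / 2)\<bar> \<le> K3 / s n" by (simp only: norm_of_real)
      have "\<bar>cdf (F n) x - cdf std_normal_distribution x\<bar>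
          \<le> (\<bar>m - exp (1 / 2)\<bar> + 2 * exp (1 / 2) * (K2 / s n)) * exp (- x)"
        using cdf_diff_via_exp_tilt[OF F exp_integrable_std_normal close]
        unfolding m_def exp_moment_std_normal .
      also have "\<dots> \<le> (K3 / s n + 2 * exp (1 / 2) * (K2 / s n)) * exp (- x)"
        using m_close by (intro mult_right_mono add_right_mono) auto
      also have "\<dots> = (K3 + 2 * exp (1 / 2) * K2) / \<sigma> / sqrt (real n) * exp (- x)"
        using \<open>\<sigma> > 0\<close> by (simp add: s_def add_divide_distrib)
      finally show ?thesis .
    qed
    then show ?thesis by blast
  qed
qed

section \<open>Symmetry, tails and increments of the standard normal law\<close>

lemma std_normal_no_atoms: "measure std_normal_distribution {x} = 0"
  by (rule density_lborel_no_atoms) simp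

text \<open>Symmetry is read off from the even characteristic function by Levy's uniqueness theorem;
  absence of atoms removes the end point.\<close>

lemma cdf_std_normal_minus: "cdf std_normal_distribution (- x) = 1 - cdf std_normal_distribution x"
proof -
  interpret real_distribution std_normal_distribution by (rule real_dist_normal_dist)
  have "distr std_normal_distribution borel uminus = std_normal_distribution"
  proof (rule Levy_uniqueness)
    show "real_distribution (distr std_normal_distribution borel uminus)"
      by (rule real_distribution_distr) simp
    show "char (distr std_normal_distribution borel uminus) = char std_normal_distribution"
    proof
      fix t
      have "char (distr std_normal_distribution borel uminus) t = char std_normal_distribution (- t)"
        unfolding char_def by (subst integral_distr) auto
      then show "char (distr std_normal_distribution borel uminus) t = char std_normal_distribution t"
        by (simp add: char_std_normal_distribution)
    qed
  qed (rule real_dist_normal_dist)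
  then have "cdf std_normal_distribution (- x) = measure (distr std_normal_distribution borel uminus) {..- x}"
    by (simp add: cdf_def)
  also have "\<dots> = measure std_normal_distribution (uminus -` {..- x} \<inter> space std_normal_distribution)"
    by (rule measure_distr) auto
  also have "uminus -` {..- x} \<inter> space std_normal_distribution = {x} \<union> {x<..}" by auto
  also have "measure std_normal_distribution ({x} \<union> {x<..}) = measure std_normal_distribution {x<..}"
    by (subst finite_measure_Union) (auto simp: std_normal_no_atoms)
  also have "\<dots> = 1 - cdf std_normal_distribution x"
  proof -
    have "{x<..} = space std_normal_distribution - {..x}" by auto
    then show ?thesis using prob_compl[of "{..x}"] by (simp add: cdf_def)
  qed
  finally show ?thesis .
qed

lemma std_normal_tail_le: "1 - cdf std_normal_distribution x \<le> exp (1 / 2) * exp (- x)"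
proof -
  interpret exp_integrable_distribution std_normal_distribution by (rule exp_integrable_std_normal)
  show ?thesis
    unfolding tail_via_exp_tilt exp_moment_std_normal
    by (intro mult_left_mono exp_weighted_tail real_distribution_exp_tilt) simp
qed

lemma power_div_fact_le_exp:
  fixes y :: real
  assumes "0 \<le> y"
  shows "y ^ k / fact k \<le> exp y"
proof -
  have "(\<Sum>j\<in>{k}. y ^ j /\<^sub>R fact j) \<le> (\<Sum>j. y ^ j /\<^sub>R fact j)"
    using assms by (intro sum_le_suminf summable_exp_generic) auto
  then show ?thesis by (simp add: exp_def divide_inverse mult.commute)
qed

text \<open>Keeps one term of the exponential series at (1 + |x|)/2. The exponent is halved because
  the change of argument in \<open>nonuniform_berry_esseen\<close> costs the other half.\<close>

lemma exp_half_le_power: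
  fixes x :: real
  shows "exp (- \<bar>x\<bar> / 2) \<le> (2 ^ k * fact k * exp (1 / 2)) * inverse ((1 + \<bar>x\<bar>) ^ k)"
proof -
  have "((1 + \<bar>x\<bar>) / 2) ^ k / fact k \<le> exp ((1 + \<bar>x\<bar>) / 2)"
    by (rule power_div_fact_le_exp) simp
  also have "\<dots> = exp (1 / 2) * exp (\<bar>x\<bar> / 2)"
    by (simp add: exp_add[symmetric] add_divide_distrib)
  finally have "(1 + \<bar>x\<bar>) ^ k \<le> 2 ^ k * fact k * exp (1 / 2) * exp (\<bar>x\<bar> / 2)"
    by (simp add: power_divide field_simps)
  moreover have "0 < (1 + \<bar>x\<bar>) ^ k" by (simp add: add_pos_nonneg)
  ultimately show ?thesis
    by (simp add: exp_minus field_simps)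
qed

lemma std_normal_density_le: "std_normal_density u \<le> exp (1 / 2 - \<bar>u\<bar>)"
proof -
  have "0 \<le> (\<bar>u\<bar> - 1)\<^sup>2" by simp
  then have "- u\<^sup>2 / 2 \<le> 1 / 2 - \<bar>u\<bar>" by (simp add: power2_eq_square algebra_simps)
  then have "exp (- u\<^sup>2 / 2) \<le> exp (1 / 2 - \<bar>u\<bar>)" by simp
  moreover have "1 \<le> sqrt (2 * pi)" using pi_ge_two by (simp add: real_le_rsqrt)
  then have "1 / sqrt (2 * pi) * exp (- u\<^sup>2 / 2) \<le> 1 * exp (- u\<^sup>2 / 2)"
    by (intro mult_right_mono) auto
  ultimately show ?thesis unfolding std_normal_density_def by linarith
qed

text \<open>Between x and y every u satisfies |u| \<ge> (|x| - 1)/2, so the density there is at most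
  exp(1 - |x|/2). The increment is thus linear in |y - x| and still decays in x.\<close>

lemma cdf_std_normal_diff_le:
  assumes "\<bar>y - x\<bar> \<le> (1 + \<bar>x\<bar>) / 2"
  shows "\<bar>cdf std_normal_distribution y - cdf std_normal_distribution x\<bar> \<le> exp (1 - \<bar>x\<bar> / 2) * \<bar>y - x\<bar>"
proof -
  interpret real_distribution std_normal_distribution by (rule real_dist_normal_dist)
  have dens: "std_normal_density u \<le> exp (1 - \<bar>x\<bar> / 2)" if "\<bar>u - x\<bar> \<le> (1 + \<bar>x\<bar>) / 2" for u
  proof -
    have "1 / 2 - \<bar>u\<bar> \<le> 1 - \<bar>x\<bar> / 2" using that by (auto simp: abs_if field_simps split: if_splits)
    then show ?thesis using std_normal_density_le[of u] order_trans by fastforce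
  qed
  show ?thesis
  proof (cases "x \<le> y")
    case True
    have "cdf std_normal_distribution y - cdf std_normal_distribution x \<le> exp (1 - \<bar>x\<bar> / 2) * (y - x)"
      using assms True by (intro cdf_density_lipschitz dens real_dist_normal_dist) auto
    then show ?thesis using True cdf_nondecreasing[OF True] by simp
  next
    case False
    then have "y \<le> x" by simp
    have "cdf std_normal_distribution x - cdf std_normal_distribution y \<le> exp (1 - \<bar>x\<bar> / 2) * (x - y)"
      using assms \<open>y \<le> x\<close> by (intro cdf_density_lipschitz dens real_dist_normal_dist) auto
    then show ?thesis using \<open>y \<le> x\<close> cdf_nondecreasing[OF \<open>y \<le> x\<close>] by simp
  qed
qed

section \<open>Reflection and the two-sided exponential bound\<close>

lemma deriv_reflect:
  assumes hol: "f holomorphic_on ball 0 r" and "z \<in> ball 0 r"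
  shows "deriv (\<lambda>z. f (- z)) z = - deriv f (- z)"
proof (rule DERIV_imp_deriv)
  have "- z \<in> ball 0 r" using assms(2) by simp
  from holomorphic_derivI[OF hol open_ball this]
  have "((\<lambda>z. f (- z)) has_field_derivative deriv f (- z) * (- 1)) (at z)"
    by (intro DERIV_chain2[of f]) (auto intro!: derivative_eq_intros)
  then show "((\<lambda>z. f (- z)) has_field_derivative - deriv f (- z)) (at z)" by simp
qed

lemma holomorphic_reflect: "f holomorphic_on ball 0 r \<Longrightarrow> (\<lambda>z. f (- z)) holomorphic_on ball 0 r"
  by (rule holomorphic_on_compose_gen[of uminus _ f, unfolded comp_def]) (auto intro!: holomorphic_intros)

context prob_space
begin

text \<open>The left tail is the right tail of \<open>- S\<close>, whose moment generating function is reflected.\<close>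

lemma mgf_berry_esseen:
  fixes S :: "nat \<Rightarrow> 'a \<Rightarrow> real" and \<Lambda> :: "complex \<Rightarrow> complex" and W :: "nat \<Rightarrow> complex \<Rightarrow> complex"
    and \<sigma> r C :: real and D :: "nat \<Rightarrow> real"
  assumes S[measurable]: "\<And>n. S n \<in> borel_measurable M" and S_le: "\<And>n \<omega>. \<omega> \<in> space M \<Longrightarrow> \<bar>S n \<omega>\<bar> \<le> D n"
    and "\<sigma> > 0" "r > 0"
    and hol: "\<Lambda> holomorphic_on ball 0 r" "\<And>n. n \<ge> 1 \<Longrightarrow> W n holomorphic_on ball 0 r"
    and \<Lambda>: "\<Lambda> 0 = 0" "deriv \<Lambda> 0 = 0" "deriv (deriv \<Lambda>) 0 = (complex_of_real \<sigma>)\<^sup>2"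
    and W: "\<And>n. n \<ge> 1 \<Longrightarrow> W n 0 = 1" "\<And>n z. n \<ge> 1 \<Longrightarrow> z \<in> ball 0 r \<Longrightarrow> cmod (W n z) \<le> C"
    and mgf: "\<And>n z. n \<ge> 1 \<Longrightarrow> z \<in> ball 0 r \<Longrightarrow>
      (CLINT \<omega>|M. exp (z * complex_of_real (S n \<omega>))) = exp (of_nat n * \<Lambda> z) * W n z"
  shows "\<exists>c\<ge>0. \<exists>n0. \<forall>n\<ge>n0. \<forall>x. \<bar>prob {\<omega> \<in> space M. S n \<omega> / (\<sigma> * sqrt (real n)) \<le> x} - cdf std_normal_distribution x\<bar>
      \<le> c / sqrt (real n) * exp (- \<bar>x\<bar>)"
proof -
  define F where "F e n = distr M borel (\<lambda>\<omega>. e * (S n \<omega> / (\<sigma> * sqrt (real n))))" for e n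
  have exp_F: "exp_integrable_distribution (F e n)" for e n
  proof -
    interpret F: real_distribution "F e n"
      unfolding F_def by (rule real_distribution_distr) simp
    have "integrable M (\<lambda>\<omega>. exp (e * (S n \<omega> / (\<sigma> * sqrt (real n)))))"
    proof (rule integrable_const_bound[where B = "exp (\<bar>e\<bar> * (D n / \<bar>\<sigma> * sqrt (real n)\<bar>))"])
      have "e * (S n \<omega> / (\<sigma> * sqrt (real n))) \<le> \<bar>e\<bar> * (D n / \<bar>\<sigma> * sqrt (real n)\<bar>)" if "\<omega> \<in> space M" for \<omega>
      proof -
        have "e * (S n \<omega> / (\<sigma> * sqrt (real n))) \<le> \<bar>e\<bar> * (\<bar>S n \<omega>\<bar> / \<bar>\<sigma> * sqrt (real n)\<bar>)"
          by (rule order_trans[OF abs_ge_self]) (simp add: abs_mult)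
        also have "\<dots> \<le> \<bar>e\<bar> * (D n / \<bar>\<sigma> * sqrt (real n)\<bar>)"
          using S_le[OF that] by (intro mult_left_mono divide_right_mono) auto
        finally show ?thesis .
      qed
      then show "AE \<omega> in M. norm (exp (e * (S n \<omega> / (\<sigma> * sqrt (real n))))) \<le> exp (\<bar>e\<bar> * (D n / \<bar>\<sigma> * sqrt (real n)\<bar>))"
        by (intro AE_I2) simp
    qed simp
    then have "integrable (F e n) exp"
      unfolding F_def by (subst integrable_distr_eq) auto
    then show ?thesis by unfold_locales
  qed
  have mgf_F: "(CLINT y|F e n. exp (z * complex_of_real (\<sigma> * sqrt (real n) * y))) = exp (of_nat n * \<Lambda> (e * z)) * W n (e * z)"
    if "n \<ge> 1" "z \<in> ball 0 r" "\<bar>e\<bar> = 1" for n and z :: complex and e :: real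
  proof -
    have "(CLINT y|F e n. exp (z * complex_of_real (\<sigma> * sqrt (real n) * y)))
        = (CLINT \<omega>|M. exp (z * complex_of_real (\<sigma> * sqrt (real n) * (e * (S n \<omega> / (\<sigma> * sqrt (real n)))))))"
      unfolding F_def by (subst integral_distr) auto
    also have "\<dots> = (CLINT \<omega>|M. exp (complex_of_real e * z * complex_of_real (S n \<omega>)))"
      using that \<open>\<sigma> > 0\<close> by (intro Bochner_Integration.integral_cong) (auto simp: mult_ac)
    also have "\<dots> = exp (of_nat n * \<Lambda> (e * z)) * W n (e * z)"
      using that by (intro mgf) (auto simp: norm_mult)
    finally show ?thesis .
  qed
  have "\<exists>c n0. \<forall>n\<ge>n0. \<forall>x. \<bar>cdf (F 1 n) x - cdf std_normal_distribution x\<bar> \<le> c / sqrt (real n) * exp (- x)"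
  proof (rule mgf_berry_esseen_one_sided[of "F 1" \<sigma> r \<Lambda> W C])
    show "(CLINT y|F 1 n. exp (z * complex_of_real (\<sigma> * sqrt (real n) * y))) = exp (of_nat n * \<Lambda> z) * W n z"
      if "n \<ge> 1" "z \<in> ball 0 r" for n z
      using mgf_F[OF that, of 1] by simp
  qed (use exp_F \<open>\<sigma> > 0\<close> \<open>r > 0\<close> \<Lambda> W hol in auto)
  then obtain c1 n1 where 1: "\<And>n x. n \<ge> n1 \<Longrightarrow> \<bar>cdf (F 1 n) x - cdf std_normal_distribution x\<bar> \<le> c1 / sqrt (real n) * exp (- x)"
    by blast
  have "\<exists>c n0. \<forall>n\<ge>n0. \<forall>x. \<bar>cdf (F (- 1) n) x - cdf std_normal_distribution x\<bar> \<le> c / sqrt (real n) * exp (- x)"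
  proof (rule mgf_berry_esseen_one_sided[of "F (- 1)" \<sigma> r "\<lambda>z. \<Lambda> (- z)" "\<lambda>n z. W n (- z)" C])
    have "deriv (deriv (\<lambda>z. \<Lambda> (- z))) 0 = deriv (\<lambda>z. - deriv \<Lambda> (- z)) 0"
      using deriv_reflect[OF hol(1)] \<open>r > 0\<close>
      by (intro deriv_cong_ev eventually_nhds_in_open[THEN eventually_mono, of "ball 0 r"]) auto
    also have "\<dots> = deriv (deriv \<Lambda>) 0"
    proof (rule DERIV_imp_deriv)
      have "(deriv \<Lambda> has_field_derivative deriv (deriv \<Lambda>) (- 0)) (at (- 0))"
        using \<open>r > 0\<close> by (intro holomorphic_derivI[OF holomorphic_deriv[OF hol(1) open_ball] open_ball]) auto
      then have "((\<lambda>z. deriv \<Lambda> (- z)) has_field_derivative deriv (deriv \<Lambda>) (- 0) * (- 1)) (at 0)"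
        by (intro DERIV_chain2[of "deriv \<Lambda>"]) (auto intro!: derivative_eq_intros)
      from DERIV_minus[OF this]
      show "((\<lambda>z. - deriv \<Lambda> (- z)) has_field_derivative deriv (deriv \<Lambda>) 0) (at 0)" by simp
    qed
    finally show "deriv (deriv (\<lambda>z. \<Lambda> (- z))) 0 = (complex_of_real \<sigma>)\<^sup>2" by (simp add: \<Lambda>)
    show "deriv (\<lambda>z. \<Lambda> (- z)) 0 = 0"
      using deriv_reflect[OF hol(1), of 0] \<open>r > 0\<close> \<Lambda> by simp
    show "(CLINT y|F (- 1) n. exp (z * complex_of_real (\<sigma> * sqrt (real n) * y))) = exp (of_nat n * \<Lambda> (- z)) * W n (- z)"
      if "n \<ge> 1" "z \<in> ball 0 r" for n z
      using mgf_F[OF that, of "- 1"] by simp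
  qed (use exp_F \<open>\<sigma> > 0\<close> \<open>r > 0\<close> \<Lambda> W holomorphic_reflect hol in auto)
  then obtain c2 n2 where 2: "\<And>n x. n \<ge> n2 \<Longrightarrow> \<bar>cdf (F (- 1) n) x - cdf std_normal_distribution x\<bar> \<le> c2 / sqrt (real n) * exp (- x)"
    by blast
  interpret std: real_distribution std_normal_distribution by (rule real_dist_normal_dist)
  define c where "c = max 0 (max c1 c2)"
  have "\<bar>prob {\<omega> \<in> space M. S n \<omega> / (\<sigma> * sqrt (real n)) \<le> x} - cdf std_normal_distribution x\<bar>
      \<le> c / sqrt (real n) * exp (- \<bar>x\<bar>)" if n: "n \<ge> max n1 n2" for n x
  proof -
    define Y where "Y \<omega> = S n \<omega> / (\<sigma> * sqrt (real n))" for \<omega>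
    have [measurable]: "Y \<in> borel_measurable M" unfolding Y_def by measurable
    interpret F: real_distribution "F (- 1) n"
      using exp_F by (rule exp_integrable_distribution.axioms)
    let ?c = "c / sqrt (real n)"
    have cdf1: "cdf (F 1 n) x = prob {\<omega> \<in> space M. Y \<omega> \<le> x}"
      unfolding cdf_def F_def Y_def by (subst measure_distr) (auto intro!: arg_cong[where f = prob])
    have "\<bar>prob {\<omega> \<in> space M. Y \<omega> \<le> x} - cdf std_normal_distribution x\<bar> \<le> c1 / sqrt (real n) * exp (- x)"
      using 1[of n x] n by (simp add: cdf1)
    also have "\<dots> \<le> ?c * exp (- x)"
      by (intro mult_right_mono divide_right_mono) (auto simp: c_def)
    finally have right: "\<bar>prob {\<omega> \<in> space M. Y \<omega> \<le> x} - cdf std_normal_distribution x\<bar> \<le> ?c * exp (- x)" .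
    \<comment> \<open>The complement of Y \<le> x is the strict event -Y < -x. The bound for the
      distribution function of -Y is therefore passed to its left limit at -x, which leaves the
      normal term unchanged by continuity.\<close>
    have "\<bar>measure (F (- 1) n) {..<- x} - cdf std_normal_distribution (- x)\<bar> \<le> c2 / sqrt (real n) * exp (- (- x))"
    proof (rule tendsto_le)
      show "((\<lambda>y. \<bar>cdf (F (- 1) n) y - cdf std_normal_distribution y\<bar>) \<longlongrightarrow>
          \<bar>measure (F (- 1) n) {..<- x} - cdf std_normal_distribution (- x)\<bar>) (at_left (- x))"
      proof (intro tendsto_intros F.cdf_at_left)
        have "isCont (cdf std_normal_distribution) (- x)"
          by (simp add: std.isCont_cdf std_normal_no_atoms)
        then show "(cdf std_normal_distribution \<longlongrightarrow> cdf std_normal_distribution (- x)) (at_left (- x))"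
          unfolding continuous_at by (rule tendsto_within_subset) simp
      qed
      show "((\<lambda>y. c2 / sqrt (real n) * exp (- y)) \<longlongrightarrow> c2 / sqrt (real n) * exp (- (- x))) (at_left (- x))"
        by (intro tendsto_intros)
      show "\<forall>\<^sub>F y in at_left (- x). \<bar>cdf (F (- 1) n) y - cdf std_normal_distribution y\<bar> \<le> c2 / sqrt (real n) * exp (- y)"
        using 2 n by (intro always_eventually) auto
    qed simp
    also have "\<dots> \<le> ?c * exp (- (- x))"
      by (intro mult_right_mono divide_right_mono) (auto simp: c_def)
    finally have "\<bar>measure (F (- 1) n) {..<- x} - cdf std_normal_distribution (- x)\<bar> \<le> ?c * exp (- (- x))" .
    moreover have "measure (F (- 1) n) {..<- x} = 1 - prob {\<omega> \<in> space M. Y \<omega> \<le> x}"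
    proof -
      have "measure (F (- 1) n) {..<- x} = prob (space M - {\<omega> \<in> space M. Y \<omega> \<le> x})"
        unfolding F_def Y_def by (subst measure_distr) (auto intro!: arg_cong[where f = prob])
      also have "\<dots> = 1 - prob {\<omega> \<in> space M. Y \<omega> \<le> x}" by (rule prob_compl) measurable
      finally show ?thesis .
    qed
    ultimately have left: "\<bar>prob {\<omega> \<in> space M. Y \<omega> \<le> x} - cdf std_normal_distribution x\<bar> \<le> ?c * exp x"
      by (simp add: cdf_std_normal_minus abs_minus_commute)
    show ?thesis using left right by (cases "x \<ge> 0") (auto simp: Y_def)
  qed
  then show ?thesis by (intro exI[of _ c] conjI exI[of _ "max n1 n2"]) (auto simp: c_def)
qed

end

section \<open>Polynomial weights and general normalisations\<close>

context prob_space
begin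

text \<open>For a single bounded variable: where |x| exceeds its bound the probability is 0 or 1 and
  a normal tail remains; elsewhere the trivial bound 1 is paid for by the constant. This serves the
  finitely many n to which the asymptotic estimate does not apply.\<close>

lemma bounded_cdf_std_normal_diff:
  fixes Z :: "'a \<Rightarrow> real"
  assumes [measurable]: "Z \<in> borel_measurable M" and Z: "\<And>\<omega>. \<omega> \<in> space M \<Longrightarrow> \<bar>Z \<omega>\<bar> \<le> D"
  shows "\<exists>C\<ge>0. \<forall>x. \<bar>prob {\<omega> \<in> space M. Z \<omega> \<le> x} - cdf std_normal_distribution x\<bar> \<le> C * inverse ((1 + \<bar>x\<bar>) ^ m)"
proof -
  interpret std: real_distribution std_normal_distribution by (rule real_dist_normal_dist)
  let ?L = "\<lambda>x. \<bar>prob {\<omega> \<in> space M. Z \<omega> \<le> x} - cdf std_normal_distribution x\<bar>"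
  define C' :: real where "C' = exp (1 / 2) * (2 ^ m * fact m * exp (1 / 2))"
  define D' where "D' = max D 0"
  have "?L x \<le> max ((1 + D') ^ m) C' * inverse ((1 + \<bar>x\<bar>) ^ m)" for x
  proof (cases "\<bar>x\<bar> \<le> D'")
    case True
    have pos: "0 < (1 + \<bar>x\<bar>) ^ m" by (simp add: add_pos_nonneg)
    have "?L x \<le> 1"
      using prob_le_1[of "{\<omega> \<in> space M. Z \<omega> \<le> x}"] measure_nonneg[of M "{\<omega> \<in> space M. Z \<omega> \<le> x}"]
        std.cdf_nonneg[of x] std.cdf_bounded_prob[of x] by linarith
    also have "1 = (1 + \<bar>x\<bar>) ^ m * inverse ((1 + \<bar>x\<bar>) ^ m)" using pos by simp
    also have "\<dots> \<le> max ((1 + D') ^ m) C' * inverse ((1 + \<bar>x\<bar>) ^ m)"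
      using True pos by (intro mult_right_mono max.coboundedI1 power_mono) auto
    finally show ?thesis .
  next
    case False
    have "?L x \<le> exp (1 / 2) * exp (- \<bar>x\<bar>)"
    proof (cases "x \<ge> 0")
      case True
      then have "Z \<omega> \<le> x" if "\<omega> \<in> space M" for \<omega> using Z[OF that] False by (auto simp: D'_def)
      then have "{\<omega> \<in> space M. Z \<omega> \<le> x} = space M" by auto
      then show ?thesis
        using std_normal_tail_le[of x] True std.cdf_bounded_prob[of x] by (simp add: prob_space)
    next
      case neg: False
      then have "\<not> Z \<omega> \<le> x" if "\<omega> \<in> space M" for \<omega> using Z[OF that] False by (auto simp: D'_def)
      then have "{\<omega> \<in> space M. Z \<omega> \<le> x} = {}" by auto
      then have "prob {\<omega> \<in> space M. Z \<omega> \<le> x} = 0" by (simp only: measure_empty)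
      then show ?thesis
        using std_normal_tail_le[of "- x"] neg std.cdf_nonneg[of x] by (simp add: cdf_std_normal_minus)
    qed
    also have "\<dots> \<le> exp (1 / 2) * exp (- \<bar>x\<bar> / 2)" by (intro mult_left_mono) auto
    also have "\<dots> \<le> exp (1 / 2) * ((2 ^ m * fact m * exp (1 / 2)) * inverse ((1 + \<bar>x\<bar>) ^ m))"
      by (intro mult_left_mono exp_half_le_power) auto
    also have "\<dots> = C' * inverse ((1 + \<bar>x\<bar>) ^ m)" by (simp add: C'_def)
    also have "\<dots> \<le> max ((1 + D') ^ m) C' * inverse ((1 + \<bar>x\<bar>) ^ m)"
      by (intro mult_right_mono) (auto simp: add_nonneg_nonneg)
    finally show ?thesis .
  qed
  moreover have "0 \<le> max ((1 + D') ^ m) C'" by (simp add: C'_def le_max_iff_disj)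
  ultimately show ?thesis by blast
qed

text \<open>Passing to b n and A n replaces x by y = (b n x + A n)/(sigma sqrt n), with |y - x| at
  most \<open>\<gamma>\<close> (1 + |x|)/sqrt n. For large n this is below (1 + |x|)/2, so the
  exponential weight at y is still of order exp(-|x|/2), and the normal increment from x to y is of
  order (1 + |x|) exp(-|x|/2)/sqrt n. Half of the exponential weight is left to dominate every
  power.\<close>

lemma nonuniform_berry_esseen:
  fixes S :: "nat \<Rightarrow> 'a \<Rightarrow> real" and A b s :: "nat \<Rightarrow> real" and D :: "nat \<Rightarrow> real"
  assumes S[measurable]: "\<And>n. S n \<in> borel_measurable M" and S_le: "\<And>n \<omega>. \<omega> \<in> space M \<Longrightarrow> \<bar>S n \<omega>\<bar> \<le> D n"
    and "\<sigma> > 0"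
    and exp_bound: "\<exists>c\<ge>0. \<exists>n0. \<forall>n\<ge>n0. \<forall>x.
      \<bar>prob {\<omega> \<in> space M. S n \<omega> / (\<sigma> * sqrt (real n)) \<le> x} - cdf std_normal_distribution x\<bar>
        \<le> c / sqrt (real n) * exp (- \<bar>x\<bar>)"
    and s_le: "\<And>n. n \<ge> 1 \<Longrightarrow> s n \<le> c' * sqrt (real n)"
    and A: "\<And>n. \<bar>A n\<bar> \<le> a" and b_pos: "\<And>n. n \<ge> 1 \<Longrightarrow> b n > 0"
    and b: "\<And>n. n \<ge> n0 \<Longrightarrow> \<bar>b n - \<sigma> * sqrt (real n)\<bar> \<le> \<beta>"
  shows "\<exists>C. \<forall>n\<ge>1. s n > 0 \<longrightarrow> (\<forall>x.
      \<bar>prob {\<omega> \<in> space M. (S n \<omega> - A n) / b n \<le> x} - cdf std_normal_distribution x\<bar>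
        \<le> C * inverse (s n) * inverse ((1 + \<bar>x\<bar>) ^ m))"
proof -
  obtain c n1 where "c \<ge> 0" and c: "\<And>n x. n \<ge> n1 \<Longrightarrow>
      \<bar>prob {\<omega> \<in> space M. S n \<omega> / (\<sigma> * sqrt (real n)) \<le> x} - cdf std_normal_distribution x\<bar>
        \<le> c / sqrt (real n) * exp (- \<bar>x\<bar>)"
    using exp_bound by blast
  have "a \<ge> 0" using A[of 0] by simp
  have "\<beta> \<ge> 0" using b[of n0] by simp
  define \<gamma> where "\<gamma> = (\<beta> + a) / \<sigma>"
  have "\<gamma> \<ge> 0" using \<open>a \<ge> 0\<close> \<open>\<beta> \<ge> 0\<close> \<open>\<sigma> > 0\<close> by (simp add: \<gamma>_def)
  let ?L = "\<lambda>n x. \<bar>prob {\<omega> \<in> space M. (S n \<omega> - A n) / b n \<le> x} - cdf std_normal_distribution x\<bar>"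
  obtain n2 where n2: "\<And>n. n \<ge> n2 \<Longrightarrow> 2 * \<gamma> \<le> sqrt (real n)"
  proof -
    have "filterlim (\<lambda>n. sqrt (real n)) at_top sequentially"
      by (intro filterlim_compose[OF sqrt_at_top filterlim_real_sequentially])
    then have "\<forall>\<^sub>F n in sequentially. 2 * \<gamma> \<le> sqrt (real n)"
      unfolding filterlim_at_top by (rule spec)
    then show ?thesis using that unfolding eventually_sequentially by blast
  qed
  define N where "N = max 1 (max n0 (max n1 n2))"
  \<comment> \<open>The power is \<open>Suc m\<close> because the normal increment brings a factor 1
    + |x|, which uses up one power.\<close>
  define Cm where "Cm = (c * exp 1 + \<gamma> * exp 1) * (2 ^ Suc m * fact (Suc m) * exp (1 / 2))"
  have "Cm \<ge> 0" using \<open>c \<ge> 0\<close> \<open>\<gamma> \<ge> 0\<close> by (simp add: Cm_def)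
  have large: "?L n x \<le> Cm / sqrt (real n) * inverse ((1 + \<bar>x\<bar>) ^ m)" if n: "n \<ge> N" for n x
  proof -
    have "n \<ge> 1" "n \<ge> n0" "n \<ge> n1" "n \<ge> n2" using n by (auto simp: N_def)
    define q where "q = sqrt (real n)"
    have q: "q > 0" "2 * \<gamma> \<le> q" using \<open>n \<ge> 1\<close> n2[OF \<open>n \<ge> n2\<close>] by (auto simp: q_def)
    define y where "y = (b n * x + A n) / (\<sigma> * q)"
    have set: "{\<omega> \<in> space M. (S n \<omega> - A n) / b n \<le> x} = {\<omega> \<in> space M. S n \<omega> / (\<sigma> * q) \<le> y}"
    proof -
      have "(S n \<omega> - A n) / b n \<le> x \<longleftrightarrow> S n \<omega> \<le> b n * x + A n" for \<omega>
        using b_pos[OF \<open>n \<ge> 1\<close>] by (auto simp: pos_divide_le_eq mult.commute)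
      moreover have "S n \<omega> / (\<sigma> * q) \<le> y \<longleftrightarrow> S n \<omega> \<le> b n * x + A n" for \<omega>
        unfolding y_def using q \<open>\<sigma> > 0\<close> by (auto simp: divide_le_cancel mult_less_0_iff)
      ultimately show ?thesis by simp
    qed
    have y_x: "\<bar>y - x\<bar> \<le> \<gamma> * (1 + \<bar>x\<bar>) / q"
    proof -
      have "y - x = ((b n - \<sigma> * q) * x + A n) / (\<sigma> * q)"
        using q \<open>\<sigma> > 0\<close> by (simp add: y_def field_simps)
      also have "\<bar>\<dots>\<bar> = \<bar>(b n - \<sigma> * q) * x + A n\<bar> / (\<sigma> * q)"
        using q \<open>\<sigma> > 0\<close> by simp
      also have "\<dots> \<le> (\<beta> * \<bar>x\<bar> + a) / (\<sigma> * q)"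
      proof (intro divide_right_mono)
        have "\<bar>(b n - \<sigma> * q) * x\<bar> \<le> \<beta> * \<bar>x\<bar>"
          unfolding abs_mult q_def by (intro mult_right_mono b \<open>n \<ge> n0\<close>) simp
        then show "\<bar>(b n - \<sigma> * q) * x + A n\<bar> \<le> \<beta> * \<bar>x\<bar> + a"
          using A[of n] by linarith
      qed (use q \<open>\<sigma> > 0\<close> in simp)
      also have "\<dots> \<le> ((\<beta> + a) * (1 + \<bar>x\<bar>)) / (\<sigma> * q)"
        using q \<open>\<sigma> > 0\<close> \<open>a \<ge> 0\<close> \<open>\<beta> \<ge> 0\<close> by (intro divide_right_mono) (auto simp: algebra_simps)
      also have "\<dots> = \<gamma> * (1 + \<bar>x\<bar>) / q" by (simp add: \<gamma>_def)
      finally show ?thesis .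
    qed
    also have "\<gamma> * (1 + \<bar>x\<bar>) / q \<le> (1 + \<bar>x\<bar>) / 2"
    proof -
      have "(2 * \<gamma>) * (1 + \<bar>x\<bar>) \<le> q * (1 + \<bar>x\<bar>)" using q by (intro mult_right_mono) auto
      then show ?thesis using q by (simp add: field_simps)
    qed
    finally have near: "\<bar>y - x\<bar> \<le> (1 + \<bar>x\<bar>) / 2" .
    have y_ge: "- \<bar>y\<bar> \<le> 1 - \<bar>x\<bar> / 2"
      using near by (auto simp: abs_if field_simps split: if_splits)
    have "?L n x \<le> \<bar>prob {\<omega> \<in> space M. S n \<omega> / (\<sigma> * q) \<le> y} - cdf std_normal_distribution y\<bar>
        + \<bar>cdf std_normal_distribution y - cdf std_normal_distribution x\<bar>"
      unfolding set by simp
    also have "\<dots> \<le> c / q * exp (1 - \<bar>x\<bar> / 2) + exp (1 - \<bar>x\<bar> / 2) * (\<gamma> * (1 + \<bar>x\<bar>) / q)"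
    proof (rule add_mono)
      have "\<bar>prob {\<omega> \<in> space M. S n \<omega> / (\<sigma> * q) \<le> y} - cdf std_normal_distribution y\<bar> \<le> c / q * exp (- \<bar>y\<bar>)"
        unfolding q_def by (rule c[OF \<open>n \<ge> n1\<close>])
      also have "\<dots> \<le> c / q * exp (1 - \<bar>x\<bar> / 2)"
        using y_ge \<open>c \<ge> 0\<close> q by (intro mult_left_mono) auto
      finally show "\<bar>prob {\<omega> \<in> space M. S n \<omega> / (\<sigma> * q) \<le> y} - cdf std_normal_distribution y\<bar> \<le> c / q * exp (1 - \<bar>x\<bar> / 2)" .
      show "\<bar>cdf std_normal_distribution y - cdf std_normal_distribution x\<bar> \<le> exp (1 - \<bar>x\<bar> / 2) * (\<gamma> * (1 + \<bar>x\<bar>) / q)"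
        by (rule order_trans[OF cdf_std_normal_diff_le[OF near]]) (intro mult_left_mono y_x, simp)
    qed
    also have "\<dots> = (exp 1 / q) * exp (- \<bar>x\<bar> / 2) * (c + \<gamma> * (1 + \<bar>x\<bar>))"
    proof -
      have "exp (1 - \<bar>x\<bar> / 2) = exp 1 * exp (- \<bar>x\<bar> / 2)" by (simp add: exp_add[symmetric])
      then show ?thesis by (simp add: algebra_simps add_divide_distrib)
    qed
    also have "\<dots> \<le> (exp 1 / q) * exp (- \<bar>x\<bar> / 2) * ((c + \<gamma>) * (1 + \<bar>x\<bar>))"
      using \<open>c \<ge> 0\<close> q by (intro mult_left_mono) (auto simp: algebra_simps)
    also have "\<dots> = (exp 1 / q) * ((c + \<gamma>) * (1 + \<bar>x\<bar>)) * exp (- \<bar>x\<bar> / 2)"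
      by simp
    also have "\<dots> \<le> (exp 1 / q) * ((c + \<gamma>) * (1 + \<bar>x\<bar>)) * ((2 ^ Suc m * fact (Suc m) * exp (1 / 2)) * inverse ((1 + \<bar>x\<bar>) ^ Suc m))"
      using \<open>c \<ge> 0\<close> \<open>\<gamma> \<ge> 0\<close> q by (intro mult_left_mono exp_half_le_power) auto
    also have "\<dots> = Cm / q * ((1 + \<bar>x\<bar>) * inverse ((1 + \<bar>x\<bar>) ^ Suc m))"
      by (simp add: Cm_def algebra_simps add_divide_distrib del: fact_Suc power_Suc)
    also have "(1 + \<bar>x\<bar>) * inverse ((1 + \<bar>x\<bar>) ^ Suc m) = inverse ((1 + \<bar>x\<bar>) ^ m)"
    proof -
      have "1 + \<bar>x\<bar> \<noteq> 0" using abs_ge_zero[of x] by linarith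
      then show ?thesis by simp
    qed
    finally show ?thesis by (simp add: q_def)
  qed
  have "\<forall>n. \<exists>C\<ge>0. n \<ge> 1 \<longrightarrow> (\<forall>x. ?L n x \<le> C * inverse ((1 + \<bar>x\<bar>) ^ m))"
  proof
    fix n
    show "\<exists>C\<ge>0. n \<ge> 1 \<longrightarrow> (\<forall>x. ?L n x \<le> C * inverse ((1 + \<bar>x\<bar>) ^ m))"
    proof -
      have le: "\<bar>(S n \<omega> - A n) / b n\<bar> \<le> (D n + a) / \<bar>b n\<bar>" if "\<omega> \<in> space M" for \<omega>
        unfolding abs_divide using S_le[OF that, of n] A[of n]
        by (intro divide_right_mono) auto
      have "\<exists>C\<ge>0. \<forall>x. ?L n x \<le> C * inverse ((1 + \<bar>x\<bar>) ^ m)"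
        by (rule bounded_cdf_std_normal_diff[where D = "(D n + a) / \<bar>b n\<bar>"]) (measurable, rule le)
      then show ?thesis by auto
    qed
  qed
  from choice[OF this] obtain E where
    "\<forall>n. 0 \<le> E n \<and> (n \<ge> 1 \<longrightarrow> (\<forall>x. ?L n x \<le> E n * inverse ((1 + \<bar>x\<bar>) ^ m)))" by (elim exE)
  then have E: "\<And>n. 0 \<le> E n" "\<And>n x. n \<ge> 1 \<Longrightarrow> ?L n x \<le> E n * inverse ((1 + \<bar>x\<bar>) ^ m)"
    by simp_all
  \<comment> \<open>The first term covers n \<ge> N, through s n \<le> |c'| sqrt n; the sum makes C
    / s n at least E n for each n < N.\<close>
  define C where "C = Cm * \<bar>c'\<bar> + (\<Sum>n<N. E n * \<bar>s n\<bar>)"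
  have "?L n x \<le> C * inverse (s n) * inverse ((1 + \<bar>x\<bar>) ^ m)" if "n \<ge> 1" "s n > 0" for n x
  proof (cases "n \<ge> N")
    case True
    have "0 \<le> (\<Sum>n<N. E n * \<bar>s n\<bar>)" by (intro sum_nonneg) (simp add: E)
    moreover have "s n \<le> \<bar>c'\<bar> * sqrt (real n)"
      by (rule order_trans[OF s_le[OF that(1)]]) (intro mult_right_mono, auto)
    then have "Cm * s n \<le> Cm * (\<bar>c'\<bar> * sqrt (real n))"
      using \<open>Cm \<ge> 0\<close> by (intro mult_left_mono)
    ultimately have "Cm * s n \<le> C * sqrt (real n)"
      by (simp add: C_def algebra_simps add_increasing2)
    then have "Cm / sqrt (real n) \<le> C * inverse (s n)"
      using that by (simp add: field_simps)
    then show ?thesis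
      by (intro order_trans[OF large[OF True]] mult_right_mono) auto
  next
    case False
    have "E n * s n \<le> (\<Sum>n<N. E n * \<bar>s n\<bar>)"
      using False E that member_le_sum[of n "{..<N}" "\<lambda>n. E n * \<bar>s n\<bar>"] by simp
    also have "\<dots> \<le> C" using \<open>Cm \<ge> 0\<close> by (simp add: C_def)
    finally have "E n \<le> C * inverse (s n)" using that by (simp add: field_simps)
    then show ?thesis
      by (intro order_trans[OF E(2)[OF that(1)]] mult_right_mono) auto
  qed
  then show ?thesis by blast
qed

end

section \<open>Moment generating functions of bounded random variables\<close>

context prob_space
begin

text \<open>Differentiation under the integral by dominated convergence. Cauchy's estimate on the
  half ball bounds all difference quotients by 4 D / r; the derivative of the integrand is
  measurable as their pointwise limit.\<close>

lemma has_field_derivative_integral: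
  fixes G :: "complex \<Rightarrow> 'a \<Rightarrow> complex"
  assumes hol: "\<And>y. y \<in> space M \<Longrightarrow> (\<lambda>z. G z y) holomorphic_on ball 0 r"
    and le: "\<And>y z. y \<in> space M \<Longrightarrow> z \<in> ball 0 r \<Longrightarrow> cmod (G z y) \<le> D"
    and meas: "\<And>z. z \<in> ball 0 r \<Longrightarrow> G z \<in> borel_measurable M"
    and z: "z \<in> ball 0 (r / 2)"
  shows "((\<lambda>z. CLINT y|M. G z y) has_field_derivative (CLINT y|M. deriv (\<lambda>z. G z y) z)) (at z)"
proof -
  have r: "r > 0" using z norm_ge_zero[of z] by (auto simp del: norm_ge_zero)
  have sub: "u \<in> ball 0 (r / 2) \<Longrightarrow> u \<in> ball 0 r" for u :: complex using r by auto
  have int: "complex_integrable M (G u)" if "u \<in> ball 0 r" for u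
    using le meas that by (intro integrable_const_bound[where B = D]) auto
  have "((\<lambda>u. ((CLINT y|M. G u y) - (CLINT y|M. G z y)) / (u - z)) \<longlongrightarrow> (CLINT y|M. deriv (\<lambda>z. G z y) z))
      (at z within ball 0 (r / 2))"
    unfolding tendsto_at_iff_sequentially comp_def
  proof (intro allI impI)
    fix X :: "nat \<Rightarrow> complex"
    assume X: "\<forall>i. X i \<in> ball 0 (r / 2) - {z}" and "X \<longlonglongrightarrow> z"
    have Xi: "X i \<in> ball 0 (r / 2)" "X i \<noteq> z" for i using X by auto
    have [measurable]: "G (X i) \<in> borel_measurable M" "G z \<in> borel_measurable M" for i
      using meas sub Xi z by auto
    have lim: "(\<lambda>i. (G (X i) y - G z y) / (X i - z)) \<longlonglongrightarrow> deriv (\<lambda>z. G z y) z" if "y \<in> space M" for y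
    proof -
      have "((\<lambda>z. G z y) has_field_derivative deriv (\<lambda>z. G z y) z) (at z)"
        by (rule holomorphic_derivI[OF hol[OF that] open_ball sub[OF z]])
      then have "((\<lambda>u. (G u y - G z y) / (u - z)) \<longlongrightarrow> deriv (\<lambda>z. G z y) z) (at z)"
        by (simp add: has_field_derivative_iff)
      then show ?thesis
        using \<open>X \<longlonglongrightarrow> z\<close> Xi(2) by (auto simp: tendsto_at_iff_sequentially comp_def)
    qed
    have "(\<lambda>i. CLINT y|M. (G (X i) y - G z y) / (X i - z)) \<longlonglongrightarrow> (CLINT y|M. deriv (\<lambda>z. G z y) z)"
    proof (rule integral_dominated_convergence[where w = "\<lambda>_. 4 * D / r"])
      show "(\<lambda>y. deriv (\<lambda>z. G z y) z) \<in> borel_measurable M"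
        by (rule borel_measurable_LIMSEQ_metric[OF _ lim]) measurable
      show "AE y in M. cmod ((G (X i) y - G z y) / (X i - z)) \<le> 4 * D / r" for i
      proof (intro AE_I2)
        fix y assume y: "y \<in> space M"
        have "cmod (G (X i) y - G z y) \<le> 4 * D / r * cmod (X i - z)"
          by (rule holomorphic_bounded_lipschitz[OF hol[OF y] le[OF y] Xi(1) z])
        then show "cmod ((G (X i) y - G z y) / (X i - z)) \<le> 4 * D / r"
          using Xi(2)[of i] by (simp add: norm_divide divide_le_eq)
      qed
    qed (use lim in auto)
    moreover have "(CLINT y|M. (G (X i) y - G z y) / (X i - z)) = ((CLINT y|M. G (X i) y) - (CLINT y|M. G z y)) / (X i - z)" for i
      using int sub Xi z by simp
    ultimately show "(\<lambda>i. ((CLINT y|M. G (X i) y) - (CLINT y|M. G z y)) / (X i - z)) \<longlonglongrightarrow> (CLINT y|M. deriv (\<lambda>z. G z y) z)"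
      by (simp only:)
  qed
  then have "((\<lambda>z. CLINT y|M. G z y) has_field_derivative (CLINT y|M. deriv (\<lambda>z. G z y) z)) (at z within ball 0 (r / 2))"
    by (simp add: has_field_derivative_iff)
  then show ?thesis using at_within_open[OF z open_ball] by simp
qed

lemma holomorphic_on_integral:
  fixes G :: "complex \<Rightarrow> 'a \<Rightarrow> complex"
  assumes "\<And>y. y \<in> space M \<Longrightarrow> (\<lambda>z. G z y) holomorphic_on ball 0 r"
    and "\<And>y z. y \<in> space M \<Longrightarrow> z \<in> ball 0 r \<Longrightarrow> cmod (G z y) \<le> D"
    and "\<And>z. z \<in> ball 0 r \<Longrightarrow> G z \<in> borel_measurable M"
  shows "(\<lambda>z. CLINT y|M. G z y) holomorphic_on ball 0 (r / 2)"
  by (rule holomorphic_onI, unfold field_differentiable_def)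
     (blast intro: has_field_derivative_at_within has_field_derivative_integral[OF assms])

lemma mgf_has_derivative:
  fixes S :: "'a \<Rightarrow> real" and z :: complex
  assumes [measurable]: "S \<in> borel_measurable M" and S: "\<And>y. y \<in> space M \<Longrightarrow> \<bar>S y\<bar> \<le> D"
  shows "((\<lambda>z. CLINT y|M. complex_of_real (S y) ^ k * exp (z * S y)) has_field_derivative
      (CLINT y|M. complex_of_real (S y) ^ Suc k * exp (z * S y))) (at z)"
proof -
  define r where "r = 2 * (cmod z + 1)"
  have z: "z \<in> ball 0 (r / 2)" and "r \<ge> 0" by (simp_all add: r_def)
  have "((\<lambda>z. CLINT y|M. complex_of_real (S y) ^ k * exp (z * S y)) has_field_derivative
      (CLINT y|M. deriv (\<lambda>z. complex_of_real (S y) ^ k * exp (z * S y)) z)) (at z)"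
  proof (rule has_field_derivative_integral)
    show "z \<in> ball 0 (r / 2)" by (rule z)
  next
    fix y z assume y: "y \<in> space M" and z: "z \<in> ball (0::complex) r"
    have "D \<ge> 0" using S[OF y] by linarith
    have "Re (z * S y) \<le> r * D"
    proof -
      have "Re (z * S y) \<le> cmod (z * S y)" by (rule complex_Re_le_cmod)
      also have "\<dots> \<le> r * D" unfolding norm_mult using z S[OF y] \<open>r \<ge> 0\<close> by (intro mult_mono) auto
      finally show ?thesis .
    qed
    then have "cmod (exp (z * S y)) \<le> exp (r * D)" by (simp only: norm_exp_eq_Re exp_le_cancel_iff)
    moreover have "cmod (complex_of_real (S y) ^ k) \<le> D ^ k"
      using S[OF y] by (simp add: norm_power power_mono)
    ultimately show "cmod (complex_of_real (S y) ^ k * exp (z * S y)) \<le> D ^ k * exp (r * D)"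
      unfolding norm_mult using \<open>D \<ge> 0\<close> by (intro mult_mono) auto
  qed (auto intro!: holomorphic_intros)
  moreover have "deriv (\<lambda>z. complex_of_real (S y) ^ k * exp (z * S y)) z = complex_of_real (S y) ^ Suc k * exp (z * S y)" for y
    by (rule DERIV_imp_deriv) (auto intro!: derivative_eq_intros)
  ultimately show ?thesis by simp
qed

lemma mgf_derivs:
  fixes S :: "'a \<Rightarrow> real"
  assumes [measurable]: "S \<in> borel_measurable M" and S: "\<And>y. y \<in> space M \<Longrightarrow> \<bar>S y\<bar> \<le> D"
  defines "\<psi> \<equiv> \<lambda>z. CLINT y|M. exp (z * complex_of_real (S y))"
  shows "\<psi> holomorphic_on A" "deriv \<psi> 0 = complex_of_real (LINT y|M. S y)"
    "deriv (deriv \<psi>) 0 = complex_of_real (LINT y|M. (S y)\<^sup>2)"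
proof -
  have d0: "(\<psi> has_field_derivative (CLINT y|M. complex_of_real (S y) * exp (z * S y))) (at z)" for z :: complex
    using mgf_has_derivative[OF assms(1) S, where k = 0] by (simp add: \<psi>_def)
  then show "\<psi> holomorphic_on A"
    by (intro holomorphic_onI) (auto simp: field_differentiable_def intro: has_field_derivative_at_within)
  have deriv: "deriv \<psi> = (\<lambda>z::complex. CLINT y|M. complex_of_real (S y) * exp (z * S y))"
    using d0 by (intro ext DERIV_imp_deriv)
  then show "deriv \<psi> 0 = complex_of_real (LINT y|M. S y)"
    by (simp add: integral_complex_of_real)
  have "((\<lambda>z. CLINT y|M. complex_of_real (S y) * exp (z * S y)) has_field_derivative
      (CLINT y|M. complex_of_real (S y) ^ 2 * exp (0 * S y))) (at 0)"
    using mgf_has_derivative[OF assms(1) S, where k = 1 and z = 0] by (simp add: power2_eq_square)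
  then have "deriv (deriv \<psi>) 0 = (CLINT y|M. complex_of_real (S y) ^ 2 * exp (0 * S y))"
    unfolding deriv by (rule DERIV_imp_deriv)
  also have "\<dots> = (CLINT y|M. complex_of_real ((S y)\<^sup>2))" by simp
  finally show "deriv (deriv \<psi>) 0 = complex_of_real (LINT y|M. (S y)\<^sup>2)"
    by (simp only: integral_complex_of_real)
qed

text \<open>Differentiating exp(n Lambda) W_n at 0 gives 0 = n Lambda'(0) + W_n'(0) for the centred
  mean, then E S_n^2 = n Lambda''(0) + W_n''(0). Cauchy's inequality bounds the derivatives of W_n
  at 0 independently of n. Dividing the first identity by n gives Lambda'(0) = 0, and the second
  leaves an error O(1).\<close>

lemma mgf_variance_asymptotics:
  fixes S :: "nat \<Rightarrow> 'a \<Rightarrow> real" and \<Lambda> :: "complex \<Rightarrow> complex" and W :: "nat \<Rightarrow> complex \<Rightarrow> complex"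
    and D :: "nat \<Rightarrow> real"
  assumes S[measurable]: "\<And>n. S n \<in> borel_measurable M" and S_le: "\<And>n \<omega>. \<omega> \<in> space M \<Longrightarrow> \<bar>S n \<omega>\<bar> \<le> D n"
    and centered: "\<And>n. (LINT \<omega>|M. S n \<omega>) = 0" and "r > 0"
    and hol: "\<Lambda> holomorphic_on ball 0 r" "\<And>n. n \<ge> 1 \<Longrightarrow> W n holomorphic_on ball 0 r"
    and \<Lambda>: "\<Lambda> 0 = 0" and W: "\<And>n. n \<ge> 1 \<Longrightarrow> W n 0 = 1"
      "\<And>n z. n \<ge> 1 \<Longrightarrow> z \<in> ball 0 r \<Longrightarrow> cmod (W n z) \<le> C"
    and mgf: "\<And>n z. n \<ge> 1 \<Longrightarrow> z \<in> ball 0 r \<Longrightarrow>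
      (CLINT \<omega>|M. exp (z * complex_of_real (S n \<omega>))) = exp (of_nat n * \<Lambda> z) * W n z"
  shows "deriv \<Lambda> 0 = 0"
    and "\<exists>\<beta>. \<forall>n\<ge>1. cmod (complex_of_real (LINT \<omega>|M. (S n \<omega>)\<^sup>2) - of_nat n * deriv (deriv \<Lambda>) 0) \<le> \<beta>"
proof -
  have z0: "0 \<in> ball (0::complex) r" using \<open>r > 0\<close> by simp
  have W_deriv_bound: "cmod ((deriv ^^ k) (W n) 0) \<le> fact k * C / (r / 2) ^ k" if "n \<ge> 1" for n k
  proof (rule Cauchy_inequality)
    have sub: "cball (0::complex) (r / 2) \<subseteq> ball 0 r" using \<open>r > 0\<close> by auto
    then show "continuous_on (cball 0 (r / 2)) (W n)"
      using hol(2)[OF that] holomorphic_on_imp_continuous_on holomorphic_on_subset by blast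
    show "W n holomorphic_on ball 0 (r / 2)"
      using \<open>r > 0\<close> by (intro holomorphic_on_subset[OF hol(2)[OF that]]) auto
    show "cmod (W n x) \<le> C" if "cmod (0 - x) = r / 2" for x
      using that \<open>r > 0\<close> \<open>n \<ge> 1\<close> by (intro W(2)) auto
  qed (use \<open>r > 0\<close> in simp)
  define \<psi> where "\<psi> n z = (CLINT \<omega>|M. exp (z * complex_of_real (S n \<omega>)))" for n z
  note d\<Lambda> = holomorphic_derivI[OF hol(1) open_ball] and d\<Lambda>' = holomorphic_derivI[OF holomorphic_deriv[OF hol(1) open_ball] open_ball]
  note dW = holomorphic_derivI[OF hol(2) open_ball] and dW' = holomorphic_derivI[OF holomorphic_deriv[OF hol(2) open_ball] open_ball]
  let ?d = "\<lambda>n z. exp (of_nat n * \<Lambda> z) * (of_nat n * deriv \<Lambda> z * W n z + deriv (W n) z)"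
  have d1: "deriv (\<psi> n) z = ?d n z" if n: "n \<ge> 1" and z: "z \<in> ball 0 r" for n z
  proof -
    have "deriv (\<psi> n) z = deriv (\<lambda>z. exp (of_nat n * \<Lambda> z) * W n z) z"
      using mgf[OF n] z unfolding \<psi>_def
      by (intro deriv_cong_ev eventually_nhds_in_open[THEN eventually_mono, of "ball 0 r"]) auto
    also have "\<dots> = ?d n z"
      by (rule DERIV_imp_deriv)
         (auto intro!: derivative_eq_intros d\<Lambda>[OF z] dW[OF n z] simp: algebra_simps)
    finally show ?thesis .
  qed
  have first: "of_nat n * deriv \<Lambda> 0 + deriv (W n) 0 = 0" if n: "n \<ge> 1" for n
    using d1[OF n z0] mgf_derivs(2)[OF S[of n] S_le] centered[of n] \<Lambda> W(1)[OF n]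
    by (simp add: \<psi>_def[abs_def])
  show \<Lambda>': "deriv \<Lambda> 0 = 0"
  proof -
    define c where "c = fact 1 * C / (r / 2) ^ 1"
    have le: "cmod (deriv \<Lambda> 0) \<le> c / real (Suc n)" for n
    proof -
      have "of_nat (Suc n) * deriv \<Lambda> 0 = - deriv (W (Suc n)) 0"
        using first[of "Suc n"] by (simp add: eq_neg_iff_add_eq_0)
      then have "real (Suc n) * cmod (deriv \<Lambda> 0) = cmod (deriv (W (Suc n)) 0)"
        by (metis norm_minus_cancel norm_mult norm_of_nat)
      also have "\<dots> \<le> c" using W_deriv_bound[of "Suc n" 1] by (simp add: c_def)
      finally show ?thesis by (simp add: field_simps)
    qed
    have "(\<lambda>n. c / real (Suc n)) \<longlonglongrightarrow> 0"
      using LIMSEQ_Suc[OF lim_const_over_n[of c]] by simp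
    then have "cmod (deriv \<Lambda> 0) \<le> 0"
      by (rule LIMSEQ_le_const) (use le in blast)
    then show ?thesis by simp
  qed
  have second: "complex_of_real (LINT \<omega>|M. (S n \<omega>)\<^sup>2) = of_nat n * deriv (deriv \<Lambda>) 0 + deriv (deriv (W n)) 0"
    if n: "n \<ge> 1" for n
  proof -
    have "complex_of_real (LINT \<omega>|M. (S n \<omega>)\<^sup>2) = deriv (deriv (\<psi> n)) 0"
      using mgf_derivs(3)[OF S[of n] S_le] by (simp add: \<psi>_def[abs_def])
    also have "\<dots> = deriv (?d n) 0"
      using d1[OF n] \<open>r > 0\<close>
      by (intro deriv_cong_ev eventually_nhds_in_open[THEN eventually_mono, of "ball 0 r"]) auto
    also have "\<dots> = of_nat n * deriv (deriv \<Lambda>) 0 + deriv (deriv (W n)) 0"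
      by (rule DERIV_imp_deriv)
         (auto intro!: derivative_eq_intros d\<Lambda>[OF z0] d\<Lambda>'[OF z0] dW[OF n z0] dW'[OF n z0]
           simp: \<Lambda> \<Lambda>' W(1)[OF n])
    finally show ?thesis .
  qed
  have "cmod (complex_of_real (LINT \<omega>|M. (S n \<omega>)\<^sup>2) - of_nat n * deriv (deriv \<Lambda>) 0) \<le> fact 2 * C / (r / 2) ^ 2"
    if n: "n \<ge> 1" for n
    using second[OF n] W_deriv_bound[OF n, of 2] by (simp add: numeral_2_eq_2)
  then show "\<exists>\<beta>. \<forall>n\<ge>1. cmod (complex_of_real (LINT \<omega>|M. (S n \<omega>)\<^sup>2) - of_nat n * deriv (deriv \<Lambda>) 0) \<le> \<beta>"
    by blast
qed

end

section \<open>Markov property\<close>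

lemma integral_bind_complex:
  fixes f :: "'b \<Rightarrow> complex"
  assumes "prob_space M" and N: "N \<in> M \<rightarrow>\<^sub>M prob_algebra L"
    and f[measurable]: "f \<in> borel_measurable L" and le: "\<And>x. x \<in> space L \<Longrightarrow> cmod (f x) \<le> D"
  shows "(CLINT x|(M \<bind> N). f x) = (CLINT x|M. CLINT y|N x. f y)"
    and "integrable M (\<lambda>x. CLINT y|N x. f y)"
proof -
  interpret prob_space M by fact
  have N'[measurable]: "N \<in> M \<rightarrow>\<^sub>M subprob_algebra L" by (rule measurable_prob_algebraD[OF N])
  have prob_N: "prob_space (N x)" and sets_N: "sets (N x) = sets L" if "x \<in> space M" for x
    using measurable_space[OF N that] by (auto simp: space_prob_algebra)
  have "prob_space (M \<bind> N)"
    by (rule prob_space_bind'[OF _ N]) (simp add: space_prob_algebra assms(1))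
  then interpret bind: prob_space "M \<bind> N" .
  have sets_bind: "sets (M \<bind> N) = sets L"
    using sets_bind[OF sets_kernel[OF N'] not_empty] by simp
  have [measurable_cong]: "sets (M \<bind> N) = sets L" by (rule sets_bind)
  have int_bind: "complex_integrable (M \<bind> N) f"
    using le sets_eq_imp_space_eq[OF sets_bind] by (intro bind.integrable_const_bound[where B = D]) auto
  have int_N: "complex_integrable (N x) f" if "x \<in> space M" for x
  proof -
    interpret Nx: prob_space "N x" by (rule prob_N[OF that])
    have [measurable]: "f \<in> borel_measurable (N x)"
      using f measurable_cong_sets[OF sets_N[OF that] refl] by blast
    show ?thesis
      using le sets_eq_imp_space_eq[OF sets_N[OF that]] by (intro Nx.integrable_const_bound[where B = D]) auto
  qed
  have inner_le: "cmod (CLINT y|N x. f y) \<le> D" if "x \<in> space M" for x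
  proof -
    interpret Nx: prob_space "N x" by (rule prob_N[OF that])
    have "cmod (CLINT y|N x. f y) \<le> (LINT y|N x. cmod (f y))" by (rule integral_norm_bound)
    also have "\<dots> \<le> (LINT y|N x. D)"
      using le sets_eq_imp_space_eq[OF sets_N[OF that]]
      by (intro integral_mono integrable_norm int_N[OF that]) auto
    finally show ?thesis using Nx.prob_space by simp
  qed
  show int_outer: "integrable M (\<lambda>x. CLINT y|N x. f y)"
    using inner_le by (intro integrable_const_bound[where B = D]) auto
  have emb: "AE x in M. emeasure (N x) (space (N x)) \<le> ennreal 1"
    using prob_N by (intro AE_I2) (simp add: prob_space.emeasure_space_1)
  have "Re (CLINT x|(M \<bind> N). f x) = (LINT x|(M \<bind> N). Re (f x))"
    by (simp add: integral_Re[OF int_bind])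
  also have "\<dots> = (LINT x|M. LINT y|N x. Re (f y))"
  proof (rule integral_bind[where K = L and B = D and B' = 1, OF _ _ N' finite_measure_axioms emb])
    show "\<bar>Re (f x)\<bar> \<le> D" if "x \<in> space L" for x
      by (rule order_trans[OF abs_Re_le_cmod le[OF that]])
  qed measurable
  also have "\<dots> = (LINT x|M. Re (CLINT y|N x. f y))"
    by (intro Bochner_Integration.integral_cong) (simp_all add: integral_Re[OF int_N])
  finally have Re: "Re (CLINT x|(M \<bind> N). f x) = Re (CLINT x|M. CLINT y|N x. f y)"
    by (simp add: integral_Re[OF int_outer])
  have "Im (CLINT x|(M \<bind> N). f x) = (LINT x|(M \<bind> N). Im (f x))"
    by (simp add: integral_Im[OF int_bind])
  also have "\<dots> = (LINT x|M. LINT y|N x. Im (f y))"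
  proof (rule integral_bind[where K = L and B = D and B' = 1, OF _ _ N' finite_measure_axioms emb])
    show "\<bar>Im (f x)\<bar> \<le> D" if "x \<in> space L" for x
      by (rule order_trans[OF abs_Im_le_cmod le[OF that]])
  qed measurable
  also have "\<dots> = (LINT x|M. Im (CLINT y|N x. f y))"
    by (intro Bochner_Integration.integral_cong) (simp_all add: integral_Im[OF int_N])
  finally have "Im (CLINT x|(M \<bind> N). f x) = Im (CLINT x|M. CLINT y|N x. f y)"
    by (simp add: integral_Im[OF int_outer])
  with Re show "(CLINT x|(M \<bind> N). f x) = (CLINT x|M. CLINT y|N x. f y)"
    by (rule complex_eqI)
qed

context homogeneous_markov_chain
begin

declare random_variable_state [measurable]

text \<open>This is the map that generates \<open>past_algebra\<close>, so functions of it are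
  measurable there.\<close>

definition past :: "nat \<Rightarrow> 'w \<Rightarrow> nat \<Rightarrow> 'a" where
  "past n \<omega> = (\<lambda>i\<in>{..n}. \<xi> i \<omega>)"

lemma measurable_past [measurable]: "past n \<in> M \<rightarrow>\<^sub>M PiM {..n} (\<lambda>_. X)"
  unfolding past_def by measurable

lemma kernel_subprob [measurable]: "K \<in> X \<rightarrow>\<^sub>M subprob_algebra X"
  by (rule measurable_prob_algebraD[OF kernel])

lemma prob_space_kernel: "x \<in> space X \<Longrightarrow> prob_space (K x)"
  and sets_K: "x \<in> space X \<Longrightarrow> sets (K x) = sets X"
  using measurable_space[OF kernel] by (auto simp: space_prob_algebra)

lemma state_in_space: "\<omega> \<in> space M \<Longrightarrow> \<xi> n \<omega> \<in> space X"
  using measurable_space[OF random_variable_state] .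

lemma measurable_Pair_past:
  assumes "\<omega> \<in> space M"
  shows "Pair (past n \<omega>) \<in> K (\<xi> n \<omega>) \<rightarrow>\<^sub>M PiM {..n} (\<lambda>_. X) \<Otimes>\<^sub>M X"
  using measurable_Pair1'[OF measurable_space[OF measurable_past assms]]
  by (simp add: measurable_cong_sets[OF sets_K[OF state_in_space[OF assms]] refl])

text \<open>The conditional joint law of the past and the next state: a point mass at the past,
  times the kernel at the present state.\<close>

definition past_kernel :: "nat \<Rightarrow> 'w \<Rightarrow> ((nat \<Rightarrow> 'a) \<times> 'a) measure" where
  "past_kernel n \<omega> = distr (K (\<xi> n \<omega>)) (PiM {..n} (\<lambda>_. X) \<Otimes>\<^sub>M X) (Pair (past n \<omega>))"

lemma measurable_past_kernel: "past_kernel n \<in> M \<rightarrow>\<^sub>M prob_algebra (PiM {..n} (\<lambda>_. X) \<Otimes>\<^sub>M X)"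
proof (rule measurable_prob_algebraI)
  show "prob_space (past_kernel n \<omega>)" if "\<omega> \<in> space M" for \<omega>
  proof -
    show ?thesis
      unfolding past_kernel_def
      by (intro prob_space.prob_space_distr prob_space_kernel state_in_space measurable_Pair_past that)
  qed
  show "past_kernel n \<in> M \<rightarrow>\<^sub>M subprob_algebra (PiM {..n} (\<lambda>_. X) \<Otimes>\<^sub>M X)"
    unfolding past_kernel_def by (rule measurable_distr2[where M = X]) measurable
qed

text \<open>Turns the Markov property, given through conditional expectations of indicators, into an
  identity of measures that integrates complex functions of past and future. On a rectangle the past
  event is pulled into the conditional expectation; rectangles form an intersection-stable
  generator, so they determine the law.\<close>

lemma joint_law_past_next:
  "distr M (PiM {..n} (\<lambda>_. X) \<Otimes>\<^sub>M X) (\<lambda>\<omega>. (past n \<omega>, \<xi> (Suc n) \<omega>)) = M \<bind> past_kernel n"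
proof -
  define P where "P = PiM {..n} (\<lambda>_. X)"
  note kern = measurable_prob_algebraD[OF measurable_past_kernel[of n], folded P_def]
  have [measurable]: "past n \<in> M \<rightarrow>\<^sub>M P" unfolding P_def by measurable
  define F where "F = past_algebra M X \<xi> n"
  have F_eq: "F = vimage_algebra (space M) (past n) P"
    by (simp add: F_def past_algebra_def past_def[abs_def] P_def)
  have "subalgebra M F"
    unfolding subalgebra_def F_eq using measurable_iff_sets[of "past n" M P] by simp
  then interpret F: finite_measure_subalgebra M F
    by (simp add: finite_measure_subalgebra_def finite_measure_subalgebra_axioms_def finite_measure_axioms)
  have past_F: "past n \<in> F \<rightarrow>\<^sub>M P"
    unfolding F_eq by (rule measurable_vimage_algebra1) (use measurable_space[of "past n" M P] in auto)
  have rect: "emeasure (distr M (P \<Otimes>\<^sub>M X) (\<lambda>\<omega>. (past n \<omega>, \<xi> (Suc n) \<omega>))) (E \<times> A)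
      = emeasure (M \<bind> past_kernel n) (E \<times> A)" if [measurable]: "E \<in> sets P" "A \<in> sets X" for E A
  proof -
    let ?e = "\<lambda>\<omega>. indicat_real E (past n \<omega>)" and ?a = "\<lambda>\<omega>. indicat_real A (\<xi> (Suc n) \<omega>)"
    have int: "integrable M (\<lambda>\<omega>. ?e \<omega> * ?a \<omega>)"
      by (rule integrable_const_bound[where B = 1]) (auto simp: indicator_def)
    have e_F: "?e \<in> borel_measurable F" using past_F by measurable
    have cond: "(LINT \<omega>|M. ?e \<omega> * real_cond_exp M F ?a \<omega>) = (LINT \<omega>|M. ?e \<omega> * ?a \<omega>)"
      by (rule F.real_cond_exp_intg(2)[OF int e_F]) simp
    have int_k: "integrable M (\<lambda>\<omega>. ?e \<omega> * measure (K (\<xi> n \<omega>)) A)"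
      using prob_space.prob_le_1[OF prob_space_kernel[OF state_in_space]]
      by (intro integrable_const_bound[where B = 1]) (auto simp: indicator_def)
    have "emeasure (distr M (P \<Otimes>\<^sub>M X) (\<lambda>\<omega>. (past n \<omega>, \<xi> (Suc n) \<omega>))) (E \<times> A)
        = (\<integral>\<^sup>+z. indicator (E \<times> A) z \<partial>distr M (P \<Otimes>\<^sub>M X) (\<lambda>\<omega>. (past n \<omega>, \<xi> (Suc n) \<omega>)))"
      by (subst nn_integral_indicator) auto
    also have "\<dots> = (\<integral>\<^sup>+\<omega>. indicator (E \<times> A) (past n \<omega>, \<xi> (Suc n) \<omega>) \<partial>M)"
      by (subst nn_integral_distr) auto
    also have "\<dots> = (\<integral>\<^sup>+\<omega>. ennreal (?e \<omega> * ?a \<omega>) \<partial>M)"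
      by (intro nn_integral_cong) (auto simp: indicator_def)
    also have "\<dots> = ennreal (LINT \<omega>|M. ?e \<omega> * ?a \<omega>)"
      by (intro nn_integral_eq_integral int) simp
    also have "(LINT \<omega>|M. ?e \<omega> * ?a \<omega>) = (LINT \<omega>|M. ?e \<omega> * measure (K (\<xi> n \<omega>)) A)"
      unfolding cond[symmetric]
    proof (rule integral_cong_AE)
      show "AE \<omega> in M. ?e \<omega> * real_cond_exp M F ?a \<omega> = ?e \<omega> * measure (K (\<xi> n \<omega>)) A"
        using markov_property[OF that(2), of n] by (auto simp: F_def)
      show "(\<lambda>\<omega>. ?e \<omega> * real_cond_exp M F ?a \<omega>) \<in> borel_measurable M"
        by (intro borel_measurable_times borel_measurable_cond_exp2) measurable
    qed (use int_k in auto)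
    also have "ennreal (LINT \<omega>|M. ?e \<omega> * measure (K (\<xi> n \<omega>)) A)
        = (\<integral>\<^sup>+\<omega>. ennreal (?e \<omega> * measure (K (\<xi> n \<omega>)) A) \<partial>M)"
      by (intro nn_integral_eq_integral[symmetric] int_k) simp
    also have "\<dots> = (\<integral>\<^sup>+\<omega>. emeasure (past_kernel n \<omega>) (E \<times> A) \<partial>M)"
    proof (intro nn_integral_cong)
      fix \<omega> assume \<omega>: "\<omega> \<in> space M"
      interpret Kp: prob_space "K (\<xi> n \<omega>)" by (rule prob_space_kernel[OF state_in_space[OF \<omega>]])
      have "emeasure (past_kernel n \<omega>) (E \<times> A) = emeasure (K (\<xi> n \<omega>)) (Pair (past n \<omega>) -` (E \<times> A) \<inter> space (K (\<xi> n \<omega>)))"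
        unfolding past_kernel_def P_def[symmetric]
        by (rule emeasure_distr[OF measurable_Pair_past[OF \<omega>, of n, folded P_def]]) measurable
      also have "Pair (past n \<omega>) -` (E \<times> A) \<inter> space (K (\<xi> n \<omega>)) = (if past n \<omega> \<in> E then A else {})"
        using sets.sets_into_space[OF that(2)] sets_eq_imp_space_eq[OF sets_K[OF state_in_space[OF \<omega>]]] by auto
      finally show "ennreal (?e \<omega> * measure (K (\<xi> n \<omega>)) A) = emeasure (past_kernel n \<omega>) (E \<times> A)"
        by (simp add: Kp.emeasure_eq_measure)
    qed
    also have "\<dots> = emeasure (M \<bind> past_kernel n) (E \<times> A)"
      by (rule emeasure_bind[OF not_empty kern, symmetric]) measurable
    finally show ?thesis .
  qed
  have "distr M (P \<Otimes>\<^sub>M X) (\<lambda>\<omega>. (past n \<omega>, \<xi> (Suc n) \<omega>)) = M \<bind> past_kernel n"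
  proof (rule measure_eqI_generator_eq[where E = "{E \<times> A |E A. E \<in> sets P \<and> A \<in> sets X}"
        and \<Omega> = "space P \<times> space X" and A = "\<lambda>_. space P \<times> space X"])
    show "Int_stable {E \<times> A |E A. E \<in> sets P \<and> A \<in> sets X}" by (rule Int_stable_pair_measure_generator)
    show "{E \<times> A |E A. E \<in> sets P \<and> A \<in> sets X} \<subseteq> Pow (space P \<times> space X)" by (rule pair_measure_closed)
    show "sets (M \<bind> past_kernel n) = sigma_sets (space P \<times> space X) {E \<times> A |E A. E \<in> sets P \<and> A \<in> sets X}"
      using sets_bind[OF sets_kernel[OF kern] not_empty] by (simp add: sets_pair_measure)
    have "emeasure (distr M (P \<Otimes>\<^sub>M X) (\<lambda>\<omega>. (past n \<omega>, \<xi> (Suc n) \<omega>))) (space P \<times> space X) \<le> 1"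
      by (intro prob_space.measure_le_1[THEN order_trans] prob_space.emeasure_le_1 prob_space_distr) measurable
    then show "emeasure (distr M (P \<Otimes>\<^sub>M X) (\<lambda>\<omega>. (past n \<omega>, \<xi> (Suc n) \<omega>))) (space P \<times> space X) \<noteq> \<infinity>"
      by (auto simp: top_unique)
  qed (auto simp: rect sets_pair_measure)
  then show ?thesis by (simp only: P_def)
qed

lemma markov_step:
  fixes G :: "(nat \<Rightarrow> 'a) \<Rightarrow> complex" and h :: "'a \<Rightarrow> complex"
  assumes [measurable]: "G \<in> borel_measurable (PiM {..n} (\<lambda>_. X))" "h \<in> borel_measurable X"
    and G: "\<And>u. u \<in> space (PiM {..n} (\<lambda>_. X)) \<Longrightarrow> cmod (G u) \<le> D" and h: "\<And>x. x \<in> space X \<Longrightarrow> cmod (h x) \<le> E"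
  shows "(CLINT \<omega>|M. G (past n \<omega>) * h (\<xi> (Suc n) \<omega>)) = (CLINT \<omega>|M. G (past n \<omega>) * markov_op K h (\<xi> n \<omega>))"
proof -
  let ?P = "PiM {..n} (\<lambda>_. X)"
  have le: "cmod (G (fst z) * h (snd z)) \<le> D * E" if "z \<in> space (?P \<Otimes>\<^sub>M X)" for z
    unfolding norm_mult using that G[of "fst z"] h[of "snd z"] order_trans[OF norm_ge_zero G[of "fst z"]]
    by (intro mult_mono) (auto simp: space_pair_measure)
  have "(CLINT \<omega>|M. G (past n \<omega>) * h (\<xi> (Suc n) \<omega>))
      = (CLINT z|distr M (?P \<Otimes>\<^sub>M X) (\<lambda>\<omega>. (past n \<omega>, \<xi> (Suc n) \<omega>)). G (fst z) * h (snd z))"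
    by (subst integral_distr) auto
  also have "\<dots> = (CLINT \<omega>|M. CLINT z|past_kernel n \<omega>. G (fst z) * h (snd z))"
    unfolding joint_law_past_next
    by (rule integral_bind_complex(1)[OF prob_space_axioms measurable_past_kernel _ le]) measurable
  also have "\<dots> = (CLINT \<omega>|M. G (past n \<omega>) * markov_op K h (\<xi> n \<omega>))"
  proof (intro Bochner_Integration.integral_cong refl)
    fix \<omega> assume \<omega>: "\<omega> \<in> space M"
    have "(CLINT z|past_kernel n \<omega>. G (fst z) * h (snd z)) = (CLINT y|K (\<xi> n \<omega>). G (past n \<omega>) * h y)"
      unfolding past_kernel_def
      by (subst integral_distr[OF measurable_Pair_past[OF \<omega>]]) auto
    then show "(CLINT z|past_kernel n \<omega>. G (fst z) * h (snd z)) = G (past n \<omega>) * markov_op K h (\<xi> n \<omega>)"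
      by (simp add: markov_op_def)
  qed
  finally show ?thesis .
qed

end

section \<open>Perturbed Markov operators\<close>

context complex_banach_function_space
begin

section \<open>Norm arithmetic in the function space\<close>

lemma N_cong: "g \<in> B \<Longrightarrow> (\<And>x. x \<in> space X \<Longrightarrow> h x = g x) \<Longrightarrow> N h = N g"
  using restriction by blast

lemma diff_closed: "g \<in> B \<Longrightarrow> h \<in> B \<Longrightarrow> (\<lambda>x. g x - h x) \<in> B"
  using add_closed[of g "\<lambda>x. - 1 * h x"] scale_closed[of h "- 1"] by simp

lemma N_diff_le: "g \<in> B \<Longrightarrow> h \<in> B \<Longrightarrow> N (\<lambda>x. g x - h x) \<le> N g + N h"
  using norm_triangle[of g "\<lambda>x. - 1 * h x"] scale_closed[of h "- 1"] norm_scale[of h "- 1"] by simp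

lemma N_const: "N (\<lambda>_. c) = cmod c * N (\<lambda>_. 1)"
  using norm_scale[OF constants[of 1], of c] by simp

lemma N_zero: "N (\<lambda>_. 0) = 0"
  using N_const[of 0] by simp

lemma N_nonneg: "g \<in> B \<Longrightarrow> 0 \<le> N g"
  using norm_triangle[of g "\<lambda>x. - 1 * g x"] scale_closed[of g "- 1"] norm_scale[of g "- 1"] N_zero by simp

lemma sum_closed: "finite I \<Longrightarrow> (\<And>i. i \<in> I \<Longrightarrow> g i \<in> B) \<Longrightarrow> (\<lambda>x. \<Sum>i\<in>I. g i x) \<in> B"
  by (induction I rule: finite_induct) (auto intro: constants add_closed)

lemma N_sum_le:
  "finite I \<Longrightarrow> (\<And>i. i \<in> I \<Longrightarrow> g i \<in> B) \<Longrightarrow> N (\<lambda>x. \<Sum>i\<in>I. g i x) \<le> (\<Sum>i\<in>I. N (g i))"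
proof (induction I rule: finite_induct)
  case (insert i I)
  have "N (\<lambda>x. g i x + (\<Sum>i\<in>I. g i x)) \<le> N (g i) + N (\<lambda>x. \<Sum>i\<in>I. g i x)"
    using insert by (intro norm_triangle sum_closed) auto
  then show ?case using insert by fastforce
qed (simp add: N_zero)

lemma prob_integrable:
  assumes "prob_space \<rho>" "sets \<rho> = sets X" "g \<in> B"
  shows "complex_integrable \<rho> g"
proof -
  interpret prob_space \<rho> by fact
  have "g \<in> borel_measurable \<rho>"
    using measurable[OF assms(3)] measurable_cong_sets[OF assms(2) refl] by blast
  then show ?thesis
    using sup_le_norm[OF assms(3)] sets_eq_imp_space_eq[OF assms(2)]
    by (intro integrable_const_bound[where B = "N g"]) auto
qed

lemma prob_integral_le:
  assumes "prob_space \<rho>" "sets \<rho> = sets X" "g \<in> B"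
  shows "cmod (CLINT x|\<rho>. g x) \<le> N g"
proof -
  interpret prob_space \<rho> by fact
  have "cmod (CLINT x|\<rho>. g x) \<le> (LINT x|\<rho>. cmod (g x))" by (rule integral_norm_bound)
  also have "\<dots> \<le> (LINT x|\<rho>. N g)"
    using sup_le_norm[OF assms(3)] sets_eq_imp_space_eq[OF assms(2)]
    by (intro integral_mono integrable_norm prob_integrable[OF assms]) auto
  finally show ?thesis using prob_space by simp
qed

end

text \<open>The exponent \<open>root p (1/2)\<close> depends only on \<open>p\<close>, which makes the bound uniform over a family
  of operators.\<close>

lemma funpow_geometric_bound:
  fixes T :: "'g \<Rightarrow> 'g" and N :: "'g \<Rightarrow> real"
  assumes step: "\<And>g. g \<in> B \<Longrightarrow> T g \<in> B \<and> N (T g) \<le> c * N g"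
    and contract: "\<And>g. g \<in> B \<Longrightarrow> N ((T ^^ p) g) \<le> N g / 2"
    and "1 \<le> c" "1 \<le> p" and nonneg: "\<And>g. g \<in> B \<Longrightarrow> 0 \<le> N g" and "g \<in> B"
  shows "N ((T ^^ k) g) \<le> 2 * c ^ p * root p (1 / 2) ^ k * N g"
proof -
  define d where "d = root p (1 / 2)"
  have d: "d ^ p = 1 / 2" "0 < d" "d \<le> 1"
    using \<open>1 \<le> p\<close> by (auto simp: d_def)
  have mem: "(T ^^ k) g \<in> B" if "g \<in> B" for g k
    using step that by (induction k) auto
  have crude: "N ((T ^^ k) g) \<le> c ^ k * N g" if "g \<in> B" for g k
  proof (induction k)
    case (Suc k)
    have "N ((T ^^ Suc k) g) \<le> c * N ((T ^^ k) g)" using step[OF mem[OF that]] by simp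
    also have "\<dots> \<le> c * (c ^ k * N g)" using Suc \<open>1 \<le> c\<close> by (intro mult_left_mono) auto
    finally show ?case by simp
  qed simp
  have "N ((T ^^ k) g) \<le> 2 * c ^ p * d ^ k * N g" if "g \<in> B" for g
    using that
  proof (induction k arbitrary: g rule: less_induct)
    case (less k)
    show ?case
    proof (cases "k < p")
      case True
      \<comment> \<open>For k < p the crude bound c^k is absorbed by c^p, and the factor 2
        compensates for d^k. Longer powers lose p steps at a time, each block contributing 1/2 =
        d^p.\<close>
      have "1 / 2 \<le> d ^ k"
        using d power_decreasing[of k p d] True by simp
      then have "c ^ k * 1 \<le> c ^ p * (2 * d ^ k)"
        using True \<open>1 \<le> c\<close> by (intro mult_mono power_increasing) auto
      then have "c ^ k * N g \<le> (2 * c ^ p * d ^ k) * N g"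
        using nonneg[OF less.prems] by (intro mult_right_mono) (auto simp: mult_ac)
      then show ?thesis using crude[OF less.prems, of k] by simp
    next
      case False
      then have k: "k = (k - p) + p" by simp
      have "N ((T ^^ k) g) = N ((T ^^ (k - p)) ((T ^^ p) g))"
        by (subst k) (simp only: funpow_add comp_def)
      also have "\<dots> \<le> 2 * c ^ p * d ^ (k - p) * N ((T ^^ p) g)"
        using False \<open>1 \<le> p\<close> by (intro less.IH mem less.prems) auto
      also have "\<dots> \<le> 2 * c ^ p * d ^ (k - p) * (N g / 2)"
        using contract[OF less.prems] \<open>1 \<le> c\<close> d by (intro mult_left_mono) auto
      also have "\<dots> = 2 * c ^ p * (d ^ (k - p) * d ^ p) * N g" by (simp add: d)
      also have "d ^ (k - p) * d ^ p = d ^ k" using False by (simp add: power_add[symmetric])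
      finally show ?thesis .
    qed
  qed
  then show ?thesis using \<open>g \<in> B\<close> by (simp add: d_def)
qed

text \<open>The coefficients grow at most geometrically because the partial sums converge at one point
  \<open>z \<noteq> 0\<close>.\<close>

lemma (in complex_banach_function_space) op_analytic_imp_continuous:
  assumes "op_analytic_at X B N F 0" and F: "\<And>z g. g \<in> B \<Longrightarrow> F z g \<in> B" and "\<epsilon> > 0"
  obtains r where "r > 0" "\<And>z g. z \<in> ball 0 r \<Longrightarrow> g \<in> B \<Longrightarrow> N (\<lambda>x. F z g x - F 0 g x) \<le> \<epsilon> * N g"
proof -
  obtain r A where "r > 0" and A: "\<And>k. bounded_op X B N (A k)"
    and conv: "\<And>z e. z \<in> ball 0 r \<Longrightarrow> e > 0 \<Longrightarrow> \<exists>n0. \<forall>n\<ge>n0.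
           op_norm_le B N (\<lambda>g x. F z g x - (\<Sum>k<n. (z - 0) ^ k * A k g x)) e"
    using assms(1) unfolding op_analytic_at_def by blast
  define q where "q = r / 2"
  have "q > 0" "complex_of_real q \<in> ball 0 r" using \<open>r > 0\<close> by (auto simp: q_def)
  have A_B: "A k g \<in> B" if "g \<in> B" for k g
    using A[of k] that unfolding bounded_op_def op_norm_le_def by blast
  have S_B: "(\<lambda>x. \<Sum>k<n. z ^ k * A k g x) \<in> B" if "g \<in> B" for n z g
    by (intro sum_closed scale_closed A_B that) auto
  obtain n0 where n0: "\<And>n g. n \<ge> n0 \<Longrightarrow> g \<in> B \<Longrightarrow>
      N (\<lambda>x. F (complex_of_real q) g x - (\<Sum>k<n. complex_of_real q ^ k * A k g x)) \<le> 1 * N g"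
    using conv[OF \<open>complex_of_real q \<in> ball 0 r\<close>, of 1] unfolding op_norm_le_def by auto
  have "\<forall>k. \<exists>c. \<forall>g\<in>B. N (A k g) \<le> c * N g"
    using A unfolding bounded_op_def op_norm_le_def by blast
  from choice[OF this] obtain c where c: "\<And>k g. g \<in> B \<Longrightarrow> N (A k g) \<le> c k * N g" by blast
  \<comment> \<open>The finitely many early coefficients are collected in the sum; the 2 serves all
    k \<ge> n0, where two partial-sum errors of size 1 are added.\<close>
  define L where "L = 2 + (\<Sum>k<n0. \<bar>c k\<bar> * q ^ k)"
  have "L \<ge> 0" using \<open>q > 0\<close> by (simp add: L_def sum_nonneg)
  have coeff: "q ^ k * N (A k g) \<le> L * N g" if g: "g \<in> B" for k g
  proof (cases "k < n0")
    case True
    have "q ^ k * N (A k g) \<le> q ^ k * (\<bar>c k\<bar> * N g)"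
      using \<open>q > 0\<close> by (intro mult_left_mono order_trans[OF c[OF g]] mult_right_mono N_nonneg g) auto
    also have "\<dots> = (\<bar>c k\<bar> * q ^ k) * N g" by simp
    also have "\<dots> \<le> L * N g"
      unfolding L_def using True \<open>q > 0\<close> N_nonneg[OF g]
        member_le_sum[of k "{..<n0}" "\<lambda>k. \<bar>c k\<bar> * q ^ k"]
      by (intro mult_right_mono) auto
    finally show ?thesis .
  next
    case False
    let ?D = "\<lambda>n x. F (complex_of_real q) g x - (\<Sum>k<n. complex_of_real q ^ k * A k g x)"
    have D_B: "?D n \<in> B" for n by (intro diff_closed F S_B g)
    have "q ^ k * N (A k g) = N (\<lambda>x. complex_of_real q ^ k * A k g x)"
      using norm_scale[OF A_B[OF g], of "complex_of_real q ^ k" k] \<open>q > 0\<close> by (simp add: norm_power)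
    \<comment> \<open>A term of the series is the difference of two consecutive partial-sum
      errors.\<close>
    also have "(\<lambda>x. complex_of_real q ^ k * A k g x) = (\<lambda>x. ?D k x - ?D (Suc k) x)"
      by (auto simp: fun_eq_iff)
    also have "N \<dots> \<le> N (?D k) + N (?D (Suc k))" by (rule N_diff_le[OF D_B D_B])
    also have "\<dots> \<le> 1 * N g + 1 * N g" using False by (intro add_mono n0 g) auto
    also have "\<dots> \<le> L * N g"
      using N_nonneg[OF g] sum_nonneg[of "{..<n0}" "\<lambda>k. \<bar>c k\<bar> * q ^ k"] \<open>q > 0\<close>
        mult_right_mono[of 2 L "N g"] by (simp add: L_def)
    finally show ?thesis .
  qed
  have A0: "N (\<lambda>x. F z g x - A 0 g x) \<le> (\<epsilon> / 4 + 2 * L * (cmod z / q)) * N g"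
    if g: "g \<in> B" and z: "cmod z \<le> q / 2" for z g
  proof -
    have "z \<in> ball 0 r" using z \<open>r > 0\<close> by (simp add: q_def)
    from conv[OF this, of "\<epsilon> / 4"] \<open>\<epsilon> > 0\<close> obtain n where n: "\<And>m. m \<ge> n \<Longrightarrow>
        N (\<lambda>x. F z g x - (\<Sum>k<m. z ^ k * A k g x)) \<le> \<epsilon> / 4 * N g"
      using g unfolding op_norm_le_def by auto
    define t where "t = cmod z / q"
    have t: "0 \<le> t" "t \<le> 1 / 2" using z \<open>q > 0\<close> by (auto simp: t_def field_simps)
    have "F z g x - A 0 g x = (F z g x - (\<Sum>k<Suc n. z ^ k * A k g x)) + (\<Sum>k<n. z ^ Suc k * A (Suc k) g x)" for x
      by (subst sum.lessThan_Suc_shift) simp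
    then have "N (\<lambda>x. F z g x - A 0 g x)
        = N (\<lambda>x. (F z g x - (\<Sum>k<Suc n. z ^ k * A k g x)) + (\<Sum>k<n. z ^ Suc k * A (Suc k) g x))"
      by presburger
    also have "\<dots> \<le> N (\<lambda>x. F z g x - (\<Sum>k<Suc n. z ^ k * A k g x)) + N (\<lambda>x. \<Sum>k<n. z ^ Suc k * A (Suc k) g x)"
      by (intro norm_triangle diff_closed F S_B g sum_closed scale_closed A_B) auto
    also have "\<dots> \<le> \<epsilon> / 4 * N g + (\<Sum>k<n. N (\<lambda>x. z ^ Suc k * A (Suc k) g x))"
      by (intro add_mono n N_sum_le scale_closed A_B g) auto
    also have "(\<Sum>k<n. N (\<lambda>x. z ^ Suc k * A (Suc k) g x)) \<le> (\<Sum>k<n. t * (1 / 2) ^ k * (L * N g))"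
    proof (rule sum_mono)
      fix k
      have "N (\<lambda>x. z ^ Suc k * A (Suc k) g x) = cmod z ^ Suc k * N (A (Suc k) g)"
        using norm_scale[OF A_B[OF g]] by (simp add: norm_power norm_mult)
      also have "\<dots> = t ^ Suc k * (q ^ Suc k * N (A (Suc k) g))"
        using \<open>q > 0\<close> by (simp add: t_def power_divide)
      also have "\<dots> \<le> (t * (1 / 2) ^ k) * (L * N g)"
        using t \<open>L \<ge> 0\<close> N_nonneg[OF g] N_nonneg[OF A_B[OF g]] \<open>q > 0\<close>
        by (intro mult_mono coeff g) (auto intro!: mult_left_mono power_mono)
      finally show "N (\<lambda>x. z ^ Suc k * A (Suc k) g x) \<le> t * (1 / 2) ^ k * (L * N g)" .
    qed
    also have "\<dots> = t * (L * N g) * (\<Sum>k<n. (1 / 2) ^ k)"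
      unfolding sum_distrib_left by (intro sum.cong) auto
    also have "\<dots> \<le> t * (L * N g) * 2"
    proof (intro mult_left_mono)
      have "(\<Sum>k<n. (1 / 2 :: real) ^ k) \<le> (\<Sum>k. (1 / 2) ^ k)"
        by (intro sum_le_suminf) (auto intro!: summable_geometric)
      then show "(\<Sum>k<n. (1 / 2 :: real) ^ k) \<le> 2" by (simp add: suminf_geometric)
    qed (use t \<open>L \<ge> 0\<close> N_nonneg[OF g] in auto)
    finally show ?thesis by (simp add: t_def algebra_simps)
  qed
  define r' where "r' = min (q / 2) (\<epsilon> * q / (4 * (L + 1)))"
  have "r' > 0" using \<open>q > 0\<close> \<open>\<epsilon> > 0\<close> \<open>L \<ge> 0\<close> by (simp add: r'_def)
  have "N (\<lambda>x. F z g x - F 0 g x) \<le> \<epsilon> * N g" if z: "z \<in> ball 0 r'" and g: "g \<in> B" for z g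
  proof -
    have "cmod z \<le> \<epsilon> * q / (4 * (L + 1))" using z by (simp add: r'_def)
    then have "cmod z * (4 * (L + 1)) \<le> \<epsilon> * q" using \<open>L \<ge> 0\<close> by (simp add: pos_le_divide_eq)
    moreover have "4 * L * cmod z \<le> cmod z * (4 * (L + 1))" by (simp add: algebra_simps)
    ultimately have "4 * L * cmod z \<le> \<epsilon> * q" by linarith
    then have small: "2 * L * (cmod z / q) \<le> \<epsilon> / 2" using \<open>q > 0\<close> by (simp add: field_simps)
    have AB: "(\<lambda>x. F z g x - A 0 g x) \<in> B" for z by (intro diff_closed F A_B g)
    \<comment> \<open>The constant coefficient \<open>A 0\<close> is the intermediate operator;
      \<open>A0\<close> at the point 0 also bounds its distance from \<open>F 0\<close>.\<close>
    have "N (\<lambda>x. F z g x - F 0 g x) = N (\<lambda>x. (F z g x - A 0 g x) - (F 0 g x - A 0 g x))" by simp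
    also have "\<dots> \<le> N (\<lambda>x. F z g x - A 0 g x) + N (\<lambda>x. F 0 g x - A 0 g x)" by (rule N_diff_le[OF AB AB])
    also have "\<dots> \<le> (\<epsilon> / 4 + 2 * L * (cmod z / q)) * N g + (\<epsilon> / 4 + 2 * L * (cmod 0 / q)) * N g"
      using z \<open>q > 0\<close> by (intro add_mono A0 g) (auto simp: r'_def)
    also have "\<dots> = (\<epsilon> / 2 + 2 * L * (cmod z / q)) * N g" by (simp add: algebra_simps)
    also have "\<dots> \<le> \<epsilon> * N g"
      using small N_nonneg[OF g] by (intro mult_right_mono) auto
    finally show ?thesis .
  qed
  with \<open>r' > 0\<close> show ?thesis by (rule that)
qed

text \<open>Fixes the witnesses of \<open>exponential_convergence\<close> as parameters, so that the
  operators below can refer to \<open>\<mu>\<close>.\<close>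

locale twisted_chain =
  homogeneous_markov_chain M X K \<xi> + complex_banach_function_space X B N
  for M :: "'w measure" and X :: "'a measure" and K :: "'a \<Rightarrow> 'a measure"
    and \<xi> :: "nat \<Rightarrow> 'w \<Rightarrow> 'a" and B :: "('a \<Rightarrow> complex) set" and N :: "('a \<Rightarrow> complex) \<Rightarrow> real" +
  fixes f :: "'a \<Rightarrow> real" and \<mu> :: "'a measure" and \<delta>0 C0 :: real
  assumes f_B: "(\<lambda>x. complex_of_real (f x)) \<in> B"
    and Rz_bounded: "\<And>z. bounded_op X B N (twisted_op K f z)"
    and Rz_analytic: "op_analytic_at X B N (twisted_op K f) 0"
    and stationary: "stationary_measure X K \<mu>"
    and \<delta>0: "0 < \<delta>0" "\<delta>0 < 1" and C0: "0 < C0"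
    and convergence: "\<And>g n. g \<in> B \<Longrightarrow> 1 \<le> n \<Longrightarrow>
      N (\<lambda>x. (markov_op K ^^ n) g x - (LINT y|\<mu>. g y)) \<le> C0 * N g * \<delta>0 ^ n"
begin

section \<open>Centred operators, their powers and the renewal expansion\<close>

abbreviation R :: "complex \<Rightarrow> ('a \<Rightarrow> complex) \<Rightarrow> 'a \<Rightarrow> complex" where
  "R \<equiv> twisted_op K f"

definition mean :: "('a \<Rightarrow> complex) \<Rightarrow> complex" where
  "mean g = (CLINT y|\<mu>. g y)"

lemma prob_\<mu>: "prob_space \<mu>" and sets_\<mu>: "sets \<mu> = sets X"
  using stationary by (auto simp: stationary_measure_def space_prob_algebra)

lemma mean_le: "g \<in> B \<Longrightarrow> cmod (mean g) \<le> N g"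
  unfolding mean_def by (rule prob_integral_le[OF prob_\<mu> sets_\<mu>])

lemma mean_const: "mean (\<lambda>_. c) = c"
  using prob_space.prob_space[OF prob_\<mu>] by (simp add: mean_def)

lemma mean_diff: "g \<in> B \<Longrightarrow> h \<in> B \<Longrightarrow> mean (\<lambda>x. g x - h x) = mean g - mean h"
  unfolding mean_def by (intro Bochner_Integration.integral_diff prob_integrable[OF prob_\<mu> sets_\<mu>])

lemma mean_cong: "(\<And>x. x \<in> space X \<Longrightarrow> g x = h x) \<Longrightarrow> mean g = mean h"
  unfolding mean_def using sets_eq_imp_space_eq[OF sets_\<mu>] by (intro Bochner_Integration.integral_cong) auto

lemma R_0: "R 0 = markov_op K"
  by (simp add: twisted_op_def fun_eq_iff)

lemma R_B: "g \<in> B \<Longrightarrow> R z g \<in> B"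
  using Rz_bounded[of z] by (auto simp: bounded_op_def op_norm_le_def)

lemma R_pow_B: "g \<in> B \<Longrightarrow> (R z ^^ n) g \<in> B"
  by (induction n) (auto intro: R_B)

lemma R_cong: "(\<And>y. y \<in> space X \<Longrightarrow> g y = h y) \<Longrightarrow> x \<in> space X \<Longrightarrow> R z g x = R z h x"
  unfolding twisted_op_def markov_op_def
  using sets_eq_imp_space_eq[OF sets_K] by (intro Bochner_Integration.integral_cong) auto

lemma R_linear: "g \<in> B \<Longrightarrow> h \<in> B \<Longrightarrow> x \<in> space X \<Longrightarrow>
    R z (\<lambda>y. a * g y + b * h y) x = a * R z g x + b * R z h x"
  using Rz_bounded[of z] by (auto simp: bounded_op_def linear_op_def)

lemma R_diff: "g \<in> B \<Longrightarrow> h \<in> B \<Longrightarrow> x \<in> space X \<Longrightarrow> R z (\<lambda>y. g y - h y) x = R z g x - R z h x"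
  using R_linear[of g h x z 1 "- 1"] by simp

lemma R_scale: "g \<in> B \<Longrightarrow> x \<in> space X \<Longrightarrow> R z (\<lambda>y. c * g y) x = c * R z g x"
  using R_linear[of g g x z c 0] by simp

lemma R_0_const: "x \<in> space X \<Longrightarrow> R 0 (\<lambda>_. c) x = c"
  using prob_space.prob_space[OF prob_space_kernel] by (simp add: R_0 markov_op_def)

lemma mean_R_0: "g \<in> B \<Longrightarrow> mean (R 0 g) = mean g"
proof -
  assume g: "g \<in> B"
  have "\<mu> \<bind> K = \<mu>" using stationary by (simp add: stationary_measure_def)
  moreover have "K \<in> \<mu> \<rightarrow>\<^sub>M prob_algebra X"
    using kernel measurable_cong_sets[OF sets_\<mu> refl] by blast
  from integral_bind_complex(1)[OF prob_\<mu> this measurable[OF g] sup_le_norm[OF g]]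
  have "(CLINT x|(\<mu> \<bind> K). g x) = mean (R 0 g)" by (simp add: R_0 mean_def markov_op_def)
  ultimately show ?thesis by (simp add: mean_def)
qed

lemma mean_R_0_pow: "g \<in> B \<Longrightarrow> mean ((R 0 ^^ n) g) = mean g"
  by (induction n) (auto simp: mean_R_0 R_pow_B)

definition T :: "complex \<Rightarrow> ('a \<Rightarrow> complex) \<Rightarrow> 'a \<Rightarrow> complex" where
  "T z g = R z (\<lambda>x. g x - mean g)"

text \<open>Its mean is the weight b_k. The function itself is kept because integrating it against
  the initial law gives the weights of the second renewal equation.\<close>

definition V :: "complex \<Rightarrow> nat \<Rightarrow> 'a \<Rightarrow> complex" where
  "V z k = (T z ^^ k) (R z (\<lambda>_. 1))"

definition a :: "nat \<Rightarrow> complex \<Rightarrow> complex" where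
  "a n z = mean ((R z ^^ n) (\<lambda>_. 1))"

lemma center_B: "g \<in> B \<Longrightarrow> (\<lambda>x. g x - mean g) \<in> B"
  by (intro diff_closed constants)

lemma T_B: "g \<in> B \<Longrightarrow> T z g \<in> B"
  unfolding T_def by (intro R_B center_B)

lemma T_pow_B: "g \<in> B \<Longrightarrow> (T z ^^ n) g \<in> B"
  by (induction n) (auto intro: T_B)

lemma V_B: "V z k \<in> B"
  unfolding V_def by (intro T_pow_B R_B constants)

lemma T_cong: "(\<And>y. y \<in> space X \<Longrightarrow> g y = h y) \<Longrightarrow> x \<in> space X \<Longrightarrow> T z g x = T z h x"
  unfolding T_def using mean_cong[of g h] by (intro R_cong) auto

lemma R_eq_T: "g \<in> B \<Longrightarrow> x \<in> space X \<Longrightarrow> R z g x = T z g x + mean g * R z (\<lambda>_. 1) x"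
  using R_diff[OF _ constants, of g x z "mean g"] R_scale[OF constants, of x z "mean g" 1]
  by (simp add: T_def)

lemma T_zero:
  assumes "x \<in> space X"
  shows "T z (\<lambda>_. 0) x = 0"
  using R_scale[OF constants assms, of z 0 0] by (simp add: T_def mean_const)

lemma T_linear:
  assumes "g \<in> B" "h \<in> B" "x \<in> space X"
  shows "T z (\<lambda>y. c * g y + h y) x = c * T z g x + T z h x"
proof -
  have "mean (\<lambda>y. c * g y + h y) = c * mean g + mean h"
    unfolding mean_def using prob_integrable[OF prob_\<mu> sets_\<mu>] assms by simp
  then have "T z (\<lambda>y. c * g y + h y) x = R z (\<lambda>y. c * (g y - mean g) + 1 * (h y - mean h)) x"
    unfolding T_def by (simp add: algebra_simps)
  also have "\<dots> = c * T z g x + 1 * T z h x"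
    unfolding T_def by (rule R_linear[OF center_B center_B]) (use assms in auto)
  finally show ?thesis by simp
qed

lemma T_diff: "g \<in> B \<Longrightarrow> h \<in> B \<Longrightarrow> x \<in> space X \<Longrightarrow> T z (\<lambda>y. g y - h y) x = T z g x - T z h x"
  using T_linear[of h g x z "- 1"] by simp

lemma T_sum:
  assumes "finite I" "\<And>i. i \<in> I \<Longrightarrow> g i \<in> B" "x \<in> space X"
  shows "T z (\<lambda>y. \<Sum>i\<in>I. c i * g i y) x = (\<Sum>i\<in>I. c i * T z (g i) x)"
  using assms(1,2)
proof (induction I rule: finite_induct)
  case (insert i I)
  have "T z (\<lambda>y. c i * g i y + (\<Sum>i\<in>I. c i * g i y)) x = c i * T z (g i) x + T z (\<lambda>y. \<Sum>i\<in>I. c i * g i y) x"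
  proof (rule T_linear[OF _ _ assms(3)])
    show "(\<lambda>y. \<Sum>i\<in>I. c i * g i y) \<in> B"
      using insert by (intro sum_closed[OF insert(1)] scale_closed) auto
  qed (use insert in auto)
  then show ?case using insert by simp
qed (simp add: T_zero assms)

text \<open>Apply \<open>R_eq_T\<close> to the n-fold iterate: \<open>T z\<close> shifts every index
  k to k + 1, and the rank-one part supplies the new term k = 0 with coefficient
  \<open>a (Suc n) z\<close>. Being pointwise in x, the expansion can be integrated against
  \<open>\<mu>\<close> and against the initial law alike.\<close>

lemma renewal_expansion:
  assumes "x \<in> space X"
  shows "(R z ^^ Suc n) (\<lambda>_. 1) x = (\<Sum>k\<le>n. V z k x * a (n - k) z)"
  using assms
proof (induction n arbitrary: x)
  case 0
  then show ?case by (simp add: V_def a_def mean_const)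
next
  case (Suc n)
  let ?h = "(R z ^^ Suc n) (\<lambda>_. 1)"
  have h: "?h \<in> B" by (intro R_pow_B constants)
  have "(R z ^^ Suc (Suc n)) (\<lambda>_. 1) x = R z ?h x" by simp
  also have "\<dots> = T z ?h x + mean ?h * R z (\<lambda>_. 1) x" by (rule R_eq_T[OF h Suc.prems])
  also have "T z ?h x = T z (\<lambda>y. \<Sum>k\<le>n. a (n - k) z * V z k y) x"
    using Suc by (intro T_cong) (simp_all add: mult.commute)
  also have "\<dots> = (\<Sum>k\<le>n. a (n - k) z * T z (V z k) x)"
    by (rule T_sum) (auto simp: V_B Suc.prems)
  also have "\<dots> = (\<Sum>k\<le>n. V z (Suc k) x * a (Suc n - Suc k) z)"
    by (intro sum.cong) (auto simp: V_def)
  also have "(\<Sum>k\<le>n. V z (Suc k) x * a (Suc n - Suc k) z) + mean ?h * R z (\<lambda>_. 1) x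
      = (\<Sum>k\<le>Suc n. V z k x * a (Suc n - k) z)"
    by (subst sum.atMost_Suc_shift) (simp add: V_def a_def)
  finally show ?case .
qed

lemma integral_renewal_expansion:
  assumes "prob_space \<rho>" "sets \<rho> = sets X"
  shows "(CLINT x|\<rho>. (R z ^^ Suc n) (\<lambda>_. 1) x) = (\<Sum>k\<le>n. (CLINT x|\<rho>. V z k x) * a (n - k) z)"
proof -
  have "(CLINT x|\<rho>. (R z ^^ Suc n) (\<lambda>_. 1) x) = (CLINT x|\<rho>. \<Sum>k\<le>n. V z k x * a (n - k) z)"
    using renewal_expansion sets_eq_imp_space_eq[OF assms(2)] by (intro Bochner_Integration.integral_cong) auto
  also have "\<dots> = (\<Sum>k\<le>n. CLINT x|\<rho>. V z k x * a (n - k) z)"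
    by (intro Bochner_Integration.integral_sum integrable_mult_left prob_integrable[OF assms] V_B)
  finally show ?thesis by simp
qed

text \<open>At z = 0 the operator preserves constants and means, so centring once is centring at
  every step. For the power 0 the identity fails by the mean, hence \<open>Suc n\<close>. Through it
  exponential convergence becomes decay of the powers of \<open>T 0\<close>.\<close>

lemma T_0_pow:
  assumes g: "g \<in> B"
  shows "x \<in> space X \<Longrightarrow> (T 0 ^^ Suc n) g x = (markov_op K ^^ Suc n) g x - mean g"
proof (induction n arbitrary: x)
  case 0
  then show ?case
    using R_diff[OF g constants, of x 0 "mean g"] by (simp add: T_def R_0_const R_0[symmetric])
next
  case (Suc n)
  let ?h = "(R 0 ^^ Suc n) g"
  have h: "?h \<in> B" by (rule R_pow_B[OF g])
  have "(T 0 ^^ Suc (Suc n)) g x = T 0 (\<lambda>y. ?h y - mean g) x"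
    using Suc by (simp del: funpow.simps add: funpow.simps(2)[of "Suc n"] R_0 comp_def) (intro T_cong; simp)
  also have "\<dots> = R 0 (\<lambda>y. ?h y - mean g) x"
    using mean_diff[OF h constants, of "mean g"] mean_R_0_pow[OF g, of "Suc n"]
    by (simp add: T_def mean_const)
  also have "\<dots> = R 0 ?h x - mean g"
    using R_diff[OF h constants Suc.prems, of 0 "mean g"] by (simp add: R_0_const[OF Suc.prems])
  finally show ?case by (simp add: R_0)
qed

lemma center_le: "g \<in> B \<Longrightarrow> N (\<lambda>x. g x - mean g) \<le> (1 + N (\<lambda>_. 1)) * N g"
  using N_diff_le[OF _ constants, of g "mean g"] mult_right_mono[OF mean_le N_nonneg[OF constants[of 1]], of g]
  by (simp add: N_const[of "mean g"] algebra_simps)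

lemma T_close:
  assumes "\<epsilon> > 0"
  shows "\<exists>r>0. \<forall>z\<in>ball 0 r. \<forall>g\<in>B. N (\<lambda>x. T z g x - T 0 g x) \<le> \<epsilon> * N g"
proof -
  define c where "c = 1 + N (\<lambda>_. 1)"
  have c: "c > 0" using N_nonneg[OF constants[of 1]] by (simp add: c_def)
  obtain r where "r > 0" and r: "\<And>z g. z \<in> ball 0 r \<Longrightarrow> g \<in> B \<Longrightarrow> N (\<lambda>x. R z g x - R 0 g x) \<le> \<epsilon> / c * N g"
    using op_analytic_imp_continuous[OF Rz_analytic R_B, of "\<epsilon> / c"] c assms by auto
  have "N (\<lambda>x. T z g x - T 0 g x) \<le> \<epsilon> * N g" if "z \<in> ball 0 r" and g: "g \<in> B" for z g
  proof -
    have "N (\<lambda>x. T z g x - T 0 g x) \<le> \<epsilon> / c * N (\<lambda>x. g x - mean g)"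
      unfolding T_def by (rule r[OF that(1) center_B[OF g]])
    also have "\<dots> \<le> \<epsilon> / c * (c * N g)"
      using center_le[OF g] c assms by (intro mult_left_mono) (auto simp: c_def)
    finally show ?thesis using c by simp
  qed
  with \<open>r > 0\<close> show ?thesis by blast
qed

lemma T_bounded_near_0:
  obtains r c where "r > 0" "c \<ge> 1" "\<And>z g. z \<in> ball 0 r \<Longrightarrow> g \<in> B \<Longrightarrow> N (T z g) \<le> c * N g"
proof -
  obtain c0 where c0: "\<And>g. g \<in> B \<Longrightarrow> N (R 0 g) \<le> c0 * N g"
    using Rz_bounded[of 0] unfolding bounded_op_def op_norm_le_def by blast
  define c1 where "c1 = 1 + N (\<lambda>_. 1)"
  obtain r where "r > 0" and r: "\<And>z g. z \<in> ball 0 r \<Longrightarrow> g \<in> B \<Longrightarrow> N (\<lambda>x. T z g x - T 0 g x) \<le> 1 * N g"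
    using T_close[of 1] by auto
  have "N (T z g) \<le> (1 + \<bar>c0\<bar> * c1) * N g" if "z \<in> ball 0 r" and g: "g \<in> B" for z g
  proof -
    have "N (T 0 g) \<le> c0 * N (\<lambda>x. g x - mean g)" unfolding T_def by (rule c0[OF center_B[OF g]])
    also have "\<dots> \<le> \<bar>c0\<bar> * N (\<lambda>x. g x - mean g)" by (intro mult_right_mono N_nonneg center_B g) auto
    also have "\<dots> \<le> \<bar>c0\<bar> * (c1 * N g)" unfolding c1_def by (intro mult_left_mono center_le g) auto
    finally have T0: "N (T 0 g) \<le> \<bar>c0\<bar> * (c1 * N g)" .
    have "N (T z g) = N (\<lambda>x. (T z g x - T 0 g x) + T 0 g x)" by simp
    also have "\<dots> \<le> N (\<lambda>x. T z g x - T 0 g x) + N (T 0 g)"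
      by (intro norm_triangle diff_closed T_B g)
    also have "\<dots> \<le> 1 * N g + \<bar>c0\<bar> * (c1 * N g)"
      by (intro add_mono r that T0)
    finally show ?thesis by (simp add: algebra_simps)
  qed
  moreover have "1 + \<bar>c0\<bar> * c1 \<ge> 1" using N_nonneg[OF constants[of 1]] by (simp add: c1_def)
  ultimately show ?thesis using that \<open>r > 0\<close> by blast
qed

text \<open>Telescoping: the difference of the (p+1)-st powers is \<open>T z\<close> applied to the
  difference of the p-th powers, plus \<open>T z\<close> - \<open>T 0\<close> applied to the p-th
  power of \<open>T 0\<close>.\<close>

lemma T_pow_close:
  assumes "\<epsilon> > 0"
  shows "\<exists>r>0. \<forall>z\<in>ball 0 r. \<forall>g\<in>B. N (\<lambda>x. (T z ^^ p) g x - (T 0 ^^ p) g x) \<le> \<epsilon> * N g"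
  using assms
proof (induction p arbitrary: \<epsilon>)
  case 0
  then show ?case by (auto intro!: exI[of _ 1] simp: N_zero N_nonneg)
next
  case (Suc p)
  obtain r1 c where "r1 > 0" "c \<ge> 1" and c: "\<And>z g. z \<in> ball 0 r1 \<Longrightarrow> g \<in> B \<Longrightarrow> N (T z g) \<le> c * N g"
    using T_bounded_near_0 by blast
  have T0_pow: "N ((T 0 ^^ p) g) \<le> c ^ p * N g" if "g \<in> B" for g
  proof (induction p)
    case (Suc p)
    have "N ((T 0 ^^ Suc p) g) \<le> c * N ((T 0 ^^ p) g)"
      using c[of 0, OF _ T_pow_B[OF that]] \<open>r1 > 0\<close> by simp
    also have "\<dots> \<le> c * (c ^ p * N g)" using Suc \<open>c \<ge> 1\<close> by (intro mult_left_mono) auto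
    finally show ?case by simp
  qed simp
  obtain r2 where "r2 > 0" and r2: "\<And>z g. z \<in> ball 0 r2 \<Longrightarrow> g \<in> B \<Longrightarrow>
      N (\<lambda>x. (T z ^^ p) g x - (T 0 ^^ p) g x) \<le> \<epsilon> / (2 * c) * N g"
    using Suc.IH[of "\<epsilon> / (2 * c)"] Suc.prems \<open>c \<ge> 1\<close> by auto
  obtain r3 where "r3 > 0" and r3: "\<And>z g. z \<in> ball 0 r3 \<Longrightarrow> g \<in> B \<Longrightarrow>
      N (\<lambda>x. T z g x - T 0 g x) \<le> \<epsilon> / (2 * c ^ p) * N g"
    using T_close[of "\<epsilon> / (2 * c ^ p)"] Suc.prems \<open>c \<ge> 1\<close> by auto
  define r where "r = min r1 (min r2 r3)"
  have "N (\<lambda>x. (T z ^^ Suc p) g x - (T 0 ^^ Suc p) g x) \<le> \<epsilon> * N g" if z: "z \<in> ball 0 r" and g: "g \<in> B" for z g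
  proof -
    let ?d = "\<lambda>x. (T z ^^ p) g x - (T 0 ^^ p) g x" and ?h = "(T 0 ^^ p) g"
    have d: "?d \<in> B" and h: "?h \<in> B" by (intro diff_closed T_pow_B g)+
    have z': "z \<in> ball 0 r1" "z \<in> ball 0 r2" "z \<in> ball 0 r3" using z by (auto simp: r_def)
    have "N (\<lambda>x. (T z ^^ Suc p) g x - (T 0 ^^ Suc p) g x) = N (\<lambda>x. T z ?d x + (T z ?h x - T 0 ?h x))"
    proof (rule N_cong)
      show "(\<lambda>x. T z ?d x + (T z ?h x - T 0 ?h x)) \<in> B" by (intro add_closed diff_closed T_B d h)
      show "(T z ^^ Suc p) g x - (T 0 ^^ Suc p) g x = T z ?d x + (T z ?h x - T 0 ?h x)" if "x \<in> space X" for x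
        using T_diff[OF T_pow_B[OF g, where z = z and n = p] h that, of z] by simp
    qed
    also have "\<dots> \<le> N (T z ?d) + N (\<lambda>x. T z ?h x - T 0 ?h x)"
      by (intro norm_triangle diff_closed T_B d h)
    also have "\<dots> \<le> c * (\<epsilon> / (2 * c) * N g) + \<epsilon> / (2 * c ^ p) * (c ^ p * N g)"
    proof (intro add_mono)
      show "N (T z ?d) \<le> c * (\<epsilon> / (2 * c) * N g)"
        using \<open>c \<ge> 1\<close> by (intro order_trans[OF c[OF z'(1) d]] mult_left_mono r2 z' g) auto
      show "N (\<lambda>x. T z ?h x - T 0 ?h x) \<le> \<epsilon> / (2 * c ^ p) * (c ^ p * N g)"
        using \<open>c \<ge> 1\<close> Suc.prems by (intro order_trans[OF r3[OF z'(3) h]] mult_left_mono T0_pow g) auto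
    qed
    also have "\<dots> = \<epsilon> * N g" using \<open>c \<ge> 1\<close> by simp
    finally show ?thesis .
  qed
  moreover have "r > 0" using \<open>r1 > 0\<close> \<open>r2 > 0\<close> \<open>r3 > 0\<close> by (simp add: r_def)
  ultimately show ?case by blast
qed

text \<open>Take p with C0 \<open>\<delta>0\<close> ^ p < 1/4. Then \<open>T 0 ^^ p\<close> has norm
  at most 1/4, and for z near 0 the power \<open>T z ^^ p\<close> is within 1/4 of it, hence has
  norm at most 1/2. \<open>funpow_geometric_bound\<close> converts this into one rate for all such
  z.\<close>

lemma V_bound:
  obtains r C \<delta> where "r > 0" "0 < \<delta>" "\<delta> < 1" "\<And>z k. z \<in> ball 0 r \<Longrightarrow> N (V z k) \<le> C * \<delta> ^ k"
proof -
  obtain r1 c where "r1 > 0" "c \<ge> 1" and c: "\<And>z g. z \<in> ball 0 r1 \<Longrightarrow> g \<in> B \<Longrightarrow> N (T z g) \<le> c * N g"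
    using T_bounded_near_0 by blast
  have "(\<lambda>n. C0 * \<delta>0 ^ Suc n) \<longlonglongrightarrow> C0 * 0"
    using \<delta>0 by (intro tendsto_intros LIMSEQ_Suc LIMSEQ_realpow_zero) auto
  then have "\<forall>\<^sub>F n in sequentially. C0 * \<delta>0 ^ Suc n < 1 / 4"
    by (rule order_tendstoD) simp
  then obtain m where m: "C0 * \<delta>0 ^ Suc m < 1 / 4" by (auto simp: eventually_sequentially)
  define p where "p = Suc m"
  obtain r2 where "r2 > 0" and r2: "\<And>z g. z \<in> ball 0 r2 \<Longrightarrow> g \<in> B \<Longrightarrow>
      N (\<lambda>x. (T z ^^ p) g x - (T 0 ^^ p) g x) \<le> 1 / 4 * N g"
    using T_pow_close[of "1 / 4" p] by auto
  obtain r3 where "r3 > 0" and r3: "\<And>z g. z \<in> ball 0 r3 \<Longrightarrow> g \<in> B \<Longrightarrow> N (\<lambda>x. R z g x - R 0 g x) \<le> 1 * N g"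
    using op_analytic_imp_continuous[OF Rz_analytic R_B, of 1] by auto
  define r where "r = min r1 (min r2 r3)"
  define L where "L = 2 * N (\<lambda>_. 1)"
  have "N (V z k) \<le> 2 * c ^ p * L * root p (1 / 2) ^ k" if "z \<in> ball 0 r" for z k
  proof -
    have z: "z \<in> ball 0 r1" "z \<in> ball 0 r2" "z \<in> ball 0 r3" using that by (auto simp: r_def)
    have half: "N ((T z ^^ p) g) \<le> N g / 2" if g: "g \<in> B" for g
    proof -
      have "N ((T 0 ^^ p) g) = N (\<lambda>x. (markov_op K ^^ p) g x - mean g)"
        using T_0_pow[OF g, of _ m] R_pow_B[OF g, where z = 0 and n = p]
        by (intro N_cong diff_closed constants) (auto simp: p_def R_0)
      also have "\<dots> \<le> C0 * N g * \<delta>0 ^ p"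
        unfolding mean_def by (rule convergence[OF g]) (simp add: p_def)
      also have "\<dots> = (C0 * \<delta>0 ^ p) * N g" by simp
      also have "\<dots> \<le> 1 / 4 * N g"
        using m N_nonneg[OF g] by (intro mult_right_mono) (auto simp: p_def)
      finally have T0: "N ((T 0 ^^ p) g) \<le> 1 / 4 * N g" .
      have "N ((T z ^^ p) g) = N (\<lambda>x. ((T z ^^ p) g x - (T 0 ^^ p) g x) + (T 0 ^^ p) g x)" by simp
      also have "\<dots> \<le> N (\<lambda>x. (T z ^^ p) g x - (T 0 ^^ p) g x) + N ((T 0 ^^ p) g)"
        by (intro norm_triangle diff_closed T_pow_B g)
      also have "\<dots> \<le> 1 / 4 * N g + 1 / 4 * N g" by (intro add_mono r2 z g T0)
      finally show ?thesis by simp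
    qed
    have one: "(\<lambda>_. 1) \<in> B" by (rule constants)
    have "N (R z (\<lambda>_. 1)) = N (\<lambda>x. (R z (\<lambda>_. 1) x - R 0 (\<lambda>_. 1) x) + R 0 (\<lambda>_. 1) x)" by simp
    also have "\<dots> \<le> N (\<lambda>x. R z (\<lambda>_. 1) x - R 0 (\<lambda>_. 1) x) + N (R 0 (\<lambda>_. 1))"
      by (intro norm_triangle diff_closed R_B one)
    also have "N (R 0 (\<lambda>_. 1)) = N (\<lambda>_. 1)" by (rule N_cong[OF one R_0_const])
    also have "N (\<lambda>x. R z (\<lambda>_. 1) x - R 0 (\<lambda>_. 1) x) \<le> 1 * N (\<lambda>_. 1)" by (rule r3[OF z(3) one])
    finally have R1: "N (R z (\<lambda>_. 1)) \<le> L" by (simp add: L_def)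
    have "N (V z k) \<le> 2 * c ^ p * root p (1 / 2) ^ k * N (R z (\<lambda>_. 1))"
      unfolding V_def
      by (rule funpow_geometric_bound[where B = B])
         (use T_B c[OF z(1)] half \<open>c \<ge> 1\<close> N_nonneg R_B[OF one] in \<open>auto simp: p_def\<close>)
    also have "\<dots> \<le> 2 * c ^ p * root p (1 / 2) ^ k * L"
      using R1 \<open>c \<ge> 1\<close> by (intro mult_left_mono mult_nonneg_nonneg zero_le_power real_root_ge_zero) auto
    finally show ?thesis by (simp add: mult_ac)
  qed
  moreover have "0 < root p (1 / 2)" "root p (1 / 2) < 1" by (auto simp: p_def)
  moreover have "r > 0" using \<open>r1 > 0\<close> \<open>r2 > 0\<close> \<open>r3 > 0\<close> by (simp add: r_def)
  ultimately show ?thesis by (intro that[of r "root p (1 / 2)" "2 * c ^ p * L"])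
qed

end

section \<open>Exponential moments of the partial sums\<close>

context twisted_chain
begin

definition F :: real where "F = N (\<lambda>x. complex_of_real (f x))"

lemma f_le: "x \<in> space X \<Longrightarrow> \<bar>f x\<bar> \<le> F"
  using sup_le_norm[OF f_B, of x] by (simp add: F_def)

lemma F_nonneg: "0 \<le> F"
  unfolding F_def by (rule N_nonneg[OF f_B])

lemma f_measurable: "f \<in> borel_measurable X"
  using measurable[OF f_B] by (simp add: borel_measurable_complex_iff)

lemma exp_f_le:
  assumes "x \<in> space X" "cmod z \<le> r"
  shows "cmod (exp (z * complex_of_real (f x))) \<le> exp (r * F)"
proof -
  have "Re (z * complex_of_real (f x)) \<le> cmod (z * complex_of_real (f x))" by (rule complex_Re_le_cmod)
  also have "\<dots> \<le> r * F"
    unfolding norm_mult using assms f_le[OF assms(1)] order_trans[OF norm_ge_zero assms(2)]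
    by (intro mult_mono) auto
  finally show ?thesis by (simp only: norm_exp_eq_Re exp_le_cancel_iff)
qed

text \<open>The factor h makes the induction work: one Markov step absorbs exp(z f) h at time n + 1
  into \<open>R z h\<close> at time n. The sum starts at j = 1, so the state at time 0 carries no
  exponential factor.\<close>

lemma exp_moment_eq_R_pow:
  assumes "h \<in> B"
  shows "(CLINT \<omega>|M. exp (z * complex_of_real (\<Sum>j=1..n. f (\<xi> j \<omega>))) * h (\<xi> n \<omega>)) = (CLINT \<omega>|M. (R z ^^ n) h (\<xi> 0 \<omega>))"
  using assms
proof (induction n arbitrary: h)
  case (Suc n)
  note [measurable] = f_measurable measurable[OF Suc.prems]
  define G where "G u = exp (z * complex_of_real (\<Sum>j=1..n. f (u j)))" for u :: "nat \<Rightarrow> 'a"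
  define h' where "h' x = exp (z * complex_of_real (f x)) * h x" for x
  have past: "past n \<omega> j = \<xi> j \<omega>" if "j \<in> {1..n}" for j \<omega>
    using that by (simp add: past_def)
  have G_past: "G (past n \<omega>) = exp (z * complex_of_real (\<Sum>j=1..n. f (\<xi> j \<omega>)))" for \<omega>
    unfolding G_def using past by (intro arg_cong[where f = exp] arg_cong2[where f = "(*)"] arg_cong[where f = complex_of_real] sum.cong) auto
  have "(CLINT \<omega>|M. exp (z * complex_of_real (\<Sum>j=1..Suc n. f (\<xi> j \<omega>))) * h (\<xi> (Suc n) \<omega>))
      = (CLINT \<omega>|M. G (past n \<omega>) * h' (\<xi> (Suc n) \<omega>))"
    by (simp add: G_past h'_def distrib_left exp_add mult_ac)
  also have "\<dots> = (CLINT \<omega>|M. G (past n \<omega>) * markov_op K h' (\<xi> n \<omega>))"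
  proof (rule markov_step)
    have [measurable]: "(\<lambda>u. f (u j)) \<in> borel_measurable (PiM {..n} (\<lambda>_. X))" if "j \<in> {1..n}" for j
      using that by (intro measurable_compose[OF measurable_component_singleton[of j "{..n}" "\<lambda>_. X"] f_measurable]) auto
    show "G \<in> borel_measurable (PiM {..n} (\<lambda>_. X))"
      unfolding G_def by measurable
    show "h' \<in> borel_measurable X" unfolding h'_def by measurable
    show "cmod (h' x) \<le> exp (cmod z * F) * N h" if "x \<in> space X" for x
      unfolding h'_def norm_mult using exp_f_le[OF that, of z "cmod z"] sup_le_norm[OF Suc.prems that]
      by (intro mult_mono) auto
    show "cmod (G u) \<le> (\<Prod>j=1..n. exp (cmod z * F))" if "u \<in> space (PiM {..n} (\<lambda>_. X))" for u
    proof -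
      have "G u = (\<Prod>j=1..n. exp (z * complex_of_real (f (u j))))"
        by (simp add: G_def sum_distrib_left exp_sum)
      then have "cmod (G u) = (\<Prod>j=1..n. cmod (exp (z * complex_of_real (f (u j)))))"
        by (simp only: prod_norm)
      also have "\<dots> \<le> (\<Prod>j=1..n. exp (cmod z * F))"
        using that by (intro prod_mono conjI exp_f_le) (auto simp: space_PiM)
      finally show ?thesis .
    qed
  qed
  also have "\<dots> = (CLINT \<omega>|M. exp (z * complex_of_real (\<Sum>j=1..n. f (\<xi> j \<omega>))) * R z h (\<xi> n \<omega>))"
    by (simp add: G_past twisted_op_def h'_def[abs_def])
  also have "\<dots> = (CLINT \<omega>|M. (R z ^^ n) (R z h) (\<xi> 0 \<omega>))"
    by (rule Suc.IH[OF R_B[OF Suc.prems]])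
  finally show ?case by (simp add: funpow_swap1)
qed simp

lemma R_pow_Suc: "(R z ^^ Suc n) g x = (CLINT y|K x. exp (z * complex_of_real (f y)) * (R z ^^ n) g y)"
  by (simp add: twisted_op_def[of K f z "(R z ^^ n) g"] markov_op_def)

lemma R_pow_integrand_measurable:
  assumes "x \<in> space X"
  shows "(\<lambda>y. exp (z * complex_of_real (f y)) * (R z ^^ n) (\<lambda>_. 1) y) \<in> borel_measurable (K x)"
proof -
  have "(\<lambda>y. exp (z * complex_of_real (f y)) * (R z ^^ n) (\<lambda>_. 1) y) \<in> borel_measurable X"
    using measurable[OF R_pow_B[OF constants[of 1]], of n z] f_measurable by measurable
  then show ?thesis
    using measurable_cong_sets[OF sets_K[OF assms] refl] by blast
qed

lemma R_pow_1_le: "x \<in> space X \<Longrightarrow> cmod z \<le> r \<Longrightarrow> cmod ((R z ^^ n) (\<lambda>_. 1) x) \<le> exp (r * F) ^ n"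
proof (induction n arbitrary: x)
  case (Suc n)
  interpret Kx: prob_space "K x" by (rule prob_space_kernel[OF Suc.prems(1)])
  let ?g = "\<lambda>y. exp (z * complex_of_real (f y)) * (R z ^^ n) (\<lambda>_. 1) y"
  have sp: "space (K x) = space X" by (rule sets_eq_imp_space_eq[OF sets_K[OF Suc.prems(1)]])
  have le: "cmod (?g y) \<le> exp (r * F) ^ Suc n" if "y \<in> space (K x)" for y
    unfolding norm_mult power_Suc using that Suc exp_f_le[of y z r] by (intro mult_mono) (auto simp: sp)
  have "cmod (CLINT y|K x. ?g y) \<le> (LINT y|K x. cmod (?g y))" by (rule integral_norm_bound)
  also have "\<dots> \<le> exp (r * F) ^ Suc n"
    using le R_pow_integrand_measurable[OF Suc.prems(1), of z n]
    by (intro Kx.integral_le_const integrable_norm Kx.integrable_const_bound[where B = "exp (r * F) ^ Suc n"]) auto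
  finally show ?case by (simp only: R_pow_Suc)
qed simp

text \<open>Each integration under \<open>K x\<close> halves the radius of the ball. The induction
  is therefore over all r, and the hypothesis is used with radius 2 r.\<close>

lemma R_pow_1_holomorphic:
  "x \<in> space X \<Longrightarrow> (\<lambda>z. (R z ^^ n) (\<lambda>_. 1) x) holomorphic_on ball 0 r"
proof (induction n arbitrary: x r)
  case (Suc n)
  interpret Kx: prob_space "K x" by (rule prob_space_kernel[OF Suc.prems(1)])
  have sp: "space (K x) = space X" by (rule sets_eq_imp_space_eq[OF sets_K[OF Suc.prems(1)]])
  have "(\<lambda>z. CLINT y|K x. exp (z * complex_of_real (f y)) * (R z ^^ n) (\<lambda>_. 1) y) holomorphic_on ball 0 (2 * r / 2)"
  proof (rule Kx.holomorphic_on_integral)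
    fix y z assume y: "y \<in> space (K x)" and z: "z \<in> ball (0::complex) (2 * r)"
    show "cmod (exp (z * complex_of_real (f y)) * (R z ^^ n) (\<lambda>_. 1) y) \<le> exp (2 * r * F) * exp (2 * r * F) ^ n"
      unfolding norm_mult using y z
      by (intro mult_mono exp_f_le R_pow_1_le) (auto simp: sp)
  next
    fix z :: complex
    show "(\<lambda>y. exp (z * complex_of_real (f y)) * (R z ^^ n) (\<lambda>_. 1) y) \<in> borel_measurable (K x)"
      by (rule R_pow_integrand_measurable[OF Suc.prems(1)])
  qed (auto intro!: holomorphic_intros Suc.IH simp: sp)
  then show ?case by (simp add: R_pow_Suc del: funpow.simps)
qed simp

lemma integral_R_pow_1_holomorphic:
  assumes "prob_space \<rho>" "sets \<rho> = sets X"
  shows "(\<lambda>z. CLINT x|\<rho>. (R z ^^ n) (\<lambda>_. 1) x) holomorphic_on ball 0 r"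
proof -
  interpret \<rho>: prob_space \<rho> by fact
  have sp: "space \<rho> = space X" by (rule sets_eq_imp_space_eq[OF assms(2)])
  have "(\<lambda>z. CLINT x|\<rho>. (R z ^^ n) (\<lambda>_. 1) x) holomorphic_on ball 0 (2 * r / 2)"
  proof (rule \<rho>.holomorphic_on_integral)
    show "cmod ((R z ^^ n) (\<lambda>_. 1) x) \<le> exp (2 * r * F) ^ n" if "x \<in> space \<rho>" "z \<in> ball 0 (2 * r)" for x z
      using that by (intro R_pow_1_le) (auto simp: sp)
    show "(R z ^^ n) (\<lambda>_. 1) \<in> borel_measurable \<rho>" for z
      using measurable[OF R_pow_B[OF constants[of 1]], of n z] measurable_cong_sets[OF assms(2) refl] by blast
  qed (simp add: R_pow_1_holomorphic sp)
  then show ?thesis by simp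
qed

definition init :: "'a measure" where "init = distr M X (\<xi> 0)"

lemma prob_init: "prob_space init" and sets_init: "sets init = sets X"
  by (auto simp: init_def intro!: prob_space_distr)

lemma integral_init: "g \<in> B \<Longrightarrow> (CLINT x|init. g x) = (CLINT \<omega>|M. g (\<xi> 0 \<omega>))"
  unfolding init_def using measurable by (intro integral_distr) auto

text \<open>The sums are not centred here: the centring depends on j through the initial law and is
  reinstated in \<open>mgf_decomposition\<close>.\<close>

definition \<phi> :: "nat \<Rightarrow> complex \<Rightarrow> complex" where
  "\<phi> n z = (CLINT \<omega>|M. exp (z * complex_of_real (\<Sum>j=1..n. f (\<xi> j \<omega>))))"

lemma \<phi>_eq: "\<phi> n z = (CLINT x|init. (R z ^^ n) (\<lambda>_. 1) x)"
  using exp_moment_eq_R_pow[OF constants[of 1], of z n] integral_init[OF R_pow_B[OF constants[of 1]]]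
  by (simp add: \<phi>_def)

lemma \<phi>_asymptotics:
  obtains r l U \<theta> D where "0 < r" "0 < \<theta>" "\<theta> < 1"
    "l holomorphic_on ball 0 r" "U holomorphic_on ball 0 r" "\<And>n. \<phi> n holomorphic_on ball 0 r"
    "l 0 = 1" "U 0 = 1" "\<And>z. z \<in> ball 0 r \<Longrightarrow> Re (l z) > 0"
    "\<And>n z. z \<in> ball 0 r \<Longrightarrow>
      cmod (\<phi> (Suc n) z - l z ^ Suc n * U z) \<le> D * \<theta> ^ Suc n * cmod (l z) ^ Suc n"
proof (rule V_bound)
  fix r0 C \<delta> :: real
  assume r0: "r0 > 0" and \<delta>: "0 < \<delta>" "\<delta> < 1" and V_le: "\<And>z k. z \<in> ball 0 r0 \<Longrightarrow> N (V z k) \<le> C * \<delta> ^ k"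
  have hol_\<phi>: "\<phi> n holomorphic_on ball 0 r" for n r
    unfolding \<phi>_eq[abs_def] by (rule integral_R_pow_1_holomorphic[OF prob_init sets_init])
  show thesis
  proof (rule renewal_asymptotics[where a = a and b = "\<lambda>k z. mean (V z k)" and e = "\<lambda>k z. CLINT x|init. V z k x"
        and \<phi> = \<phi> and C = C and \<delta> = \<delta> and ?r0.0 = r0])
    show "a n holomorphic_on ball 0 r0" for n
      unfolding a_def[abs_def] mean_def by (rule integral_R_pow_1_holomorphic[OF prob_\<mu> sets_\<mu>])
    show "a 0 z = 1" for z by (simp add: a_def mean_const)
    show "a (Suc n) z = (\<Sum>k\<le>n. mean (V z k) * a (n - k) z)" for n z
      unfolding a_def[of "Suc n"] mean_def by (rule integral_renewal_expansion[OF prob_\<mu> sets_\<mu>])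
    show "\<phi> (Suc n) z = (\<Sum>k\<le>n. (CLINT x|init. V z k x) * a (n - k) z)" for n z
      unfolding \<phi>_eq by (rule integral_renewal_expansion[OF prob_init sets_init])
    show "cmod (mean (V z k)) \<le> C * \<delta> ^ k" if "z \<in> ball 0 r0" for z k
      by (rule order_trans[OF mean_le[OF V_B] V_le[OF that]])
    show "cmod (CLINT x|init. V z k x) \<le> C * \<delta> ^ k" if "z \<in> ball 0 r0" for z k
      by (rule order_trans[OF prob_integral_le[OF prob_init sets_init V_B] V_le[OF that]])
    show "a n 0 = 1" for n
      using mean_R_0_pow[OF constants[of 1], of n] by (simp add: a_def mean_const)
    show "\<phi> n 0 = 1" for n by (simp add: \<phi>_def prob_space)
  next
    fix r l U \<theta> D
    assume *: "0 < r" "r \<le> r0" "0 < \<theta>" "\<theta> < 1" "l holomorphic_on ball 0 r" "U holomorphic_on ball 0 r"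
      "l 0 = 1" "U 0 = 1" "\<And>z. z \<in> ball 0 r \<Longrightarrow> Re (l z) > 0"
      "\<And>n z. z \<in> ball 0 r \<Longrightarrow> cmod (\<phi> (Suc n) z - l z ^ Suc n * U z) \<le> D * \<theta> ^ Suc n * cmod (l z) ^ Suc n"
    show thesis by (rule that[OF *(1,3-6) hol_\<phi> *(7-10)])
  qed (use r0 \<delta> hol_\<phi> in auto)
qed

text \<open>Away from stationarity the centring constants vary with n; this makes their deviations
  from the stationary mean summable.\<close>

lemma expectation_f_close:
  assumes "n \<ge> 1"
  shows "cmod (complex_of_real (LINT \<omega>|M. f (\<xi> n \<omega>)) - mean (\<lambda>x. complex_of_real (f x))) \<le> C0 * F * \<delta>0 ^ n"
proof -
  let ?f = "\<lambda>x. complex_of_real (f x)"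
  let ?g = "\<lambda>x. (R 0 ^^ n) ?f x - mean ?f"
  have g: "?g \<in> B" by (intro diff_closed R_pow_B f_B constants)
  have "complex_of_real (LINT \<omega>|M. f (\<xi> n \<omega>)) = (CLINT \<omega>|M. (R 0 ^^ n) ?f (\<xi> 0 \<omega>))"
    using exp_moment_eq_R_pow[OF f_B, of 0 n] by (simp add: integral_complex_of_real)
  also have "\<dots> = (CLINT x|init. (R 0 ^^ n) ?f x)"
    by (rule integral_init[symmetric, OF R_pow_B[OF f_B]])
  finally have "complex_of_real (LINT \<omega>|M. f (\<xi> n \<omega>)) - mean ?f = (CLINT x|init. ?g x)"
    using prob_integrable[OF prob_init sets_init R_pow_B[OF f_B, of n 0]] prob_space.prob_space[OF prob_init]
    by (subst Bochner_Integration.integral_diff) (auto simp: prob_integrable[OF prob_init sets_init constants])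
  also have "cmod \<dots> \<le> N ?g" by (rule prob_integral_le[OF prob_init sets_init g])
  also have "\<dots> \<le> C0 * F * \<delta>0 ^ n"
    using convergence[OF f_B assms] by (simp add: R_0 F_def mean_def)
  finally show ?thesis .
qed

lemma centered_sum_measurable: "centered_sum M \<xi> f n \<in> borel_measurable M"
  unfolding centered_sum_def[abs_def] using f_measurable by measurable

lemma integrable_f: "integrable M (\<lambda>\<omega>. f (\<xi> j \<omega>))"
  using f_measurable f_le[OF state_in_space] by (intro integrable_const_bound[where B = F]) auto

lemma centered_sum_le:
  assumes "\<omega> \<in> space M"
  shows "\<bar>centered_sum M \<xi> f n \<omega>\<bar> \<le> real n * (2 * F)"
proof -
  have "\<bar>f (\<xi> j \<omega>) - (LINT \<omega>'|M. f (\<xi> j \<omega>'))\<bar> \<le> 2 * F" for j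
  proof -
    have "\<bar>LINT \<omega>'|M. f (\<xi> j \<omega>')\<bar> \<le> (LINT \<omega>'|M. \<bar>f (\<xi> j \<omega>')\<bar>)" by (rule integral_abs_bound)
    also have "\<dots> \<le> F"
      using f_le[OF state_in_space] by (intro integral_le_const integrable_abs integrable_f) auto
    finally show ?thesis using f_le[OF state_in_space[OF assms], of j] by linarith
  qed
  then have "\<bar>centered_sum M \<xi> f n \<omega>\<bar> \<le> (\<Sum>j=1..n. 2 * F)"
    unfolding centered_sum_def by (intro order_trans[OF sum_abs] sum_mono)
  then show ?thesis by simp
qed

lemma centered_sum_expectation: "(LINT \<omega>|M. centered_sum M \<xi> f n \<omega>) = 0"
proof -
  have "(LINT \<omega>|M. centered_sum M \<xi> f n \<omega>) = (\<Sum>j=1..n. LINT \<omega>|M. (f (\<xi> j \<omega>) - (LINT \<omega>'|M. f (\<xi> j \<omega>'))))"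
    unfolding centered_sum_def by (intro Bochner_Integration.integral_sum) (simp add: integrable_f)
  also have "\<dots> = 0"
    using prob_space by (intro sum.neutral) (simp add: Bochner_Integration.integral_diff integrable_f)
  finally show ?thesis .
qed

end

section \<open>Centring and the decomposition of part (1)\<close>

context twisted_chain
begin

text \<open>The centring constants add up to n m + c - t n, where c is the total deviation from the
  stationary mean m and t n its tail. In exp(-z(n m + c - t n)) the first term joins Ln l in Lambda,
  the second belongs to U, and the third tends to 1 exponentially fast and stays in W n. The
  logarithm is holomorphic because Re l is positive.\<close>

lemma mgf_decomposition:
  obtains r \<Lambda> U W C \<delta> where "0 < r" "0 < \<delta>" "\<delta> < 1" "0 < C"
    "\<Lambda> holomorphic_on ball 0 r" "U holomorphic_on ball 0 r" "\<And>n. W n holomorphic_on ball 0 r"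
    "\<Lambda> 0 = 0" "U 0 = 1" "\<And>n. W n 0 = 1"
    "\<And>n z. n \<ge> 1 \<Longrightarrow> z \<in> ball 0 r \<Longrightarrow> cmod (W n z - U z) \<le> C * \<delta> ^ n"
    "\<And>n z. n \<ge> 1 \<Longrightarrow> z \<in> ball 0 r \<Longrightarrow> cmod (W n z) \<le> C"
    "\<And>n z. z \<in> ball 0 r \<Longrightarrow>
      (CLINT \<omega>|M. exp (z * complex_of_real (centered_sum M \<xi> f n \<omega>))) = exp (of_nat n * \<Lambda> z) * W n z"
proof (rule \<phi>_asymptotics)
  fix r0 l U \<theta> D
  assume "0 < r0" and \<theta>: "0 < \<theta>" "\<theta> < 1"
    and l_hol: "l holomorphic_on ball 0 r0" and U_hol: "U holomorphic_on ball 0 r0"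
    and \<phi>_hol: "\<And>n. \<phi> n holomorphic_on ball 0 r0"
    and "l 0 = 1" "U 0 = 1" and l_Re: "\<And>z. z \<in> ball 0 r0 \<Longrightarrow> Re (l z) > 0"
    and asym: "\<And>n z. z \<in> ball 0 r0 \<Longrightarrow>
      cmod (\<phi> (Suc n) z - l z ^ Suc n * U z) \<le> D * \<theta> ^ Suc n * cmod (l z) ^ Suc n"
  define r where "r = r0 / 2"
  have "r > 0" and sub: "ball 0 r \<subseteq> ball (0::complex) r0" and cb: "cball 0 r \<subseteq> ball (0::complex) r0"
    using \<open>r0 > 0\<close> by (auto simp: r_def)
  have l_nz: "l z \<noteq> 0" if "z \<in> ball 0 r0" for z using l_Re[OF that] by auto
  obtain BU where BU: "\<And>z. z \<in> cball 0 r \<Longrightarrow> cmod (U z) \<le> BU"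
  proof -
    have "compact (U ` cball 0 r)"
      by (rule compact_continuous_image[OF continuous_on_subset[OF holomorphic_on_imp_continuous_on[OF U_hol] cb] compact_cball])
    then have "bounded (U ` cball 0 r)" by (rule compact_imp_bounded)
    then obtain BU where "\<forall>x\<in>U ` cball 0 r. cmod x \<le> BU"
      unfolding bounded_iff by (elim exE)
    then show ?thesis by (intro that[of BU]) (erule bspec, rule imageI)
  qed
  have "BU \<ge> 1" using BU[of 0] \<open>U 0 = 1\<close> \<open>r > 0\<close> by simp
  have "D \<ge> 0"
    using order_trans[OF norm_ge_zero asym[of 0 0]] \<open>r0 > 0\<close> \<open>l 0 = 1\<close> \<theta> by (simp add: zero_le_mult_iff)

  define m where "m = mean (\<lambda>x. complex_of_real (f x))"
  \<comment> \<open>Index j stands for time j + 1, since the partial sums start at time 1.\<close>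
  define d where "d j = complex_of_real (LINT \<omega>|M. f (\<xi> (Suc j) \<omega>)) - m" for j
  have d_le: "cmod (d j) \<le> C0 * F * \<delta>0 ^ j" for j
  proof -
    have "cmod (d j) \<le> C0 * F * \<delta>0 ^ Suc j"
      unfolding d_def m_def by (rule expectation_f_close) simp
    also have "\<dots> \<le> C0 * F * \<delta>0 ^ j"
      using C0 F_nonneg \<delta>0 by (intro mult_left_mono power_decreasing) auto
    finally show ?thesis .
  qed
  have d_summable: "summable d"
    by (rule summable_comparison_test'[OF _ d_le]) (use \<delta>0 in \<open>auto intro!: summable_mult summable_geometric\<close>)
  define c where "c = suminf d"
  define t where "t n = (\<Sum>j. d (j + n))" for n
  define D1 where "D1 = C0 * F / (1 - \<delta>0)"
  have "D1 \<ge> 0" using C0 F_nonneg \<delta>0 by (simp add: D1_def)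
  have t_le: "cmod (t n) \<le> D1 * \<delta>0 ^ n" for n
    unfolding t_def D1_def using norm_suminf_geometric_tail[OF d_le \<delta>0, of n] by simp
  have mean_sum: "(\<Sum>j=1..n. complex_of_real (LINT \<omega>|M. f (\<xi> j \<omega>))) = of_nat n * m + c - t n" for n
  proof -
    have "(\<Sum>j=1..n. complex_of_real (LINT \<omega>|M. f (\<xi> j \<omega>))) = (\<Sum>j<n. d j + m)"
      by (simp add: sum.atLeast1_atMost_eq d_def)
    also have "\<dots> = (\<Sum>j<n. d j) + of_nat n * m" by (simp add: sum.distrib)
    also have "(\<Sum>j<n. d j) = c - t n"
      using suminf_split_initial_segment[OF d_summable, of n] by (simp add: c_def t_def)
    finally show ?thesis by simp
  qed
  define \<Lambda> where "\<Lambda> z = Ln (l z) - z * m" for z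
  define q where "q n z = \<phi> n z / l z ^ n" for n z
  define W where "W n z = exp (- z * c) * exp (z * t n) * q n z" for n z
  define U' where "U' z = exp (- z * c) * U z" for z
  have mgf: "(CLINT \<omega>|M. exp (z * complex_of_real (centered_sum M \<xi> f n \<omega>))) = exp (of_nat n * \<Lambda> z) * W n z"
    if z: "z \<in> ball 0 r0" for n z
  proof -
    have "(CLINT \<omega>|M. exp (z * complex_of_real (centered_sum M \<xi> f n \<omega>)))
        = (CLINT \<omega>|M. exp (- z * (of_nat n * m + c - t n)) * exp (z * complex_of_real (\<Sum>j=1..n. f (\<xi> j \<omega>))))"
      unfolding mean_sum[symmetric]
      by (simp add: centered_sum_def sum_subtractf exp_add[symmetric] algebra_simps)
    also have "\<dots> = exp (- z * (of_nat n * m + c - t n)) * \<phi> n z"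
      by (simp add: \<phi>_def)
    also have "\<phi> n z = exp (of_nat n * Ln (l z)) * q n z"
      using l_nz[OF z] by (simp add: q_def exp_of_nat_mult)
    also have "exp (- z * (of_nat n * m + c - t n)) * (exp (of_nat n * Ln (l z)) * q n z) = exp (of_nat n * \<Lambda> z) * W n z"
    proof -
      have exponent: "- z * (of_nat n * m + c - t n) + of_nat n * Ln (l z) = of_nat n * \<Lambda> z + - z * c + z * t n"
        by (simp add: \<Lambda>_def algebra_simps)
      have "exp (- z * (of_nat n * m + c - t n)) * (exp (of_nat n * Ln (l z)) * q n z)
          = exp (- z * (of_nat n * m + c - t n) + of_nat n * Ln (l z)) * q n z"
        by (simp only: exp_add mult.assoc)
      also have "\<dots> = exp (of_nat n * \<Lambda> z) * W n z"
        unfolding exponent W_def by (simp only: exp_add mult.assoc)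
      finally show ?thesis .
    qed
    finally show ?thesis .
  qed
  have \<phi>_0: "\<phi> n 0 = 1" for n by (simp add: \<phi>_def prob_space)
  \<comment> \<open>A common rate for two exponentially small errors: \<open>\<theta>\<close> from
    the renewal asymptotics and \<open>\<delta>0\<close> from the tails t n.\<close>
  define \<delta> where "\<delta> = max \<theta> \<delta>0"
  have \<delta>: "0 < \<delta>" "\<delta> < 1" using \<theta> \<delta>0 by (auto simp: \<delta>_def)
  define D2 where "D2 = r * D1"
  have "D2 \<ge> 0" using \<open>D1 \<ge> 0\<close> \<open>r > 0\<close> by (simp add: D2_def)
  \<comment> \<open>Read off from W n - U' = exp(-zc) ((exp(z t n) - 1) q n + (q n - U)), where |z t
    n| is at most \<open>D2 * \<delta> ^ n\<close>, |q n| at most BU + D, and |q n - U| at most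
    \<open>D * \<delta> ^ n\<close>.\<close>
  define D3 where "D3 = exp (r * cmod c) * (D2 * exp D2 * (BU + D) + D)"
  have "D3 \<ge> 0" using \<open>D2 \<ge> 0\<close> \<open>BU \<ge> 1\<close> \<open>D \<ge> 0\<close> by (simp add: D3_def)
  define C where "C = D3 + exp (r * cmod c) * BU"
  have C: "0 < C" "D3 \<le> C" using \<open>D3 \<ge> 0\<close> \<open>BU \<ge> 1\<close> by (auto simp: C_def intro!: add_nonneg_pos)
  have exp_c: "cmod (exp (- z * c)) \<le> exp (r * cmod c)" if "z \<in> ball 0 r" for z
  proof -
    have "Re (- z * c) \<le> cmod (- z * c)" by (rule complex_Re_le_cmod)
    also have "\<dots> \<le> r * cmod c" using that by (auto simp: norm_mult intro!: mult_right_mono)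
    finally show ?thesis by (simp only: norm_exp_eq_Re exp_le_cancel_iff)
  qed
  have q_close: "cmod (q n z - U z) \<le> D * \<delta> ^ n" if "n \<ge> 1" and zr: "z \<in> ball 0 r" for n z
  proof -
    obtain k where n: "n = Suc k" using \<open>n \<ge> 1\<close> by (cases n) auto
    have z: "z \<in> ball 0 r0" using zr sub by blast
    have "q n z - U z = (\<phi> n z - l z ^ n * U z) / l z ^ n"
      using l_nz[OF z] by (simp add: q_def field_simps)
    also have "cmod \<dots> \<le> D * \<theta> ^ n"
      using asym[OF z, of k] l_nz[OF z] unfolding n by (simp add: norm_divide norm_power divide_le_eq del: power_Suc)
    also have "\<dots> \<le> D * \<delta> ^ n"
      using \<open>D \<ge> 0\<close> \<theta> by (intro mult_left_mono power_mono) (auto simp: \<delta>_def)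
    finally show ?thesis .
  qed
  have W_close: "cmod (W n z - U' z) \<le> D3 * \<delta> ^ n" if n: "n \<ge> 1" and z: "z \<in> ball 0 r" for n z
  proof -
    have "\<delta> ^ n \<le> 1" using \<delta> by (intro power_le_one) auto
    have q_le: "cmod (q n z) \<le> BU + D"
    proof -
      have "cmod (q n z) \<le> cmod (U z) + cmod (q n z - U z)"
        using norm_triangle_ineq[of "U z" "q n z - U z"] by simp
      also have "\<dots> \<le> BU + D * \<delta> ^ n"
        using z by (intro add_mono BU q_close n) auto
      also have "\<dots> \<le> BU + D * 1"
        using \<open>D \<ge> 0\<close> \<open>\<delta> ^ n \<le> 1\<close> by (intro add_left_mono mult_left_mono)
      finally show ?thesis by simp
    qed
    have zt: "cmod (z * t n) \<le> D2 * \<delta> ^ n"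
    proof -
      have "cmod (z * t n) \<le> r * (D1 * \<delta>0 ^ n)"
        unfolding norm_mult using z t_le \<open>r > 0\<close> by (intro mult_mono) auto
      also have "\<dots> \<le> r * (D1 * \<delta> ^ n)"
        using \<open>r > 0\<close> \<open>D1 \<ge> 0\<close> \<delta>0 by (intro mult_left_mono power_mono) (auto simp: \<delta>_def)
      finally show ?thesis by (simp add: D2_def)
    qed
    also have "\<dots> \<le> D2" using \<open>D2 \<ge> 0\<close> \<open>\<delta> ^ n \<le> 1\<close> by (simp add: mult_left_le)
    finally have zt': "cmod (z * t n) \<le> D2" .
    have exp_t: "cmod (exp (z * t n) - 1) \<le> D2 * \<delta> ^ n * exp D2"
      using zt zt' \<open>D2 \<ge> 0\<close> \<delta> by (intro order_trans[OF cmod_exp_minus_1_le] mult_mono) auto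
    have "W n z - U' z = exp (- z * c) * ((exp (z * t n) - 1) * q n z + (q n z - U z))"
      by (simp add: W_def U'_def algebra_simps)
    also have "cmod \<dots> \<le> exp (r * cmod c) * ((D2 * \<delta> ^ n * exp D2) * (BU + D) + D * \<delta> ^ n)"
      unfolding norm_mult[of "exp (- z * c)"]
    proof (intro mult_mono exp_c z)
      have "cmod ((exp (z * t n) - 1) * q n z) \<le> (D2 * \<delta> ^ n * exp D2) * (BU + D)"
        unfolding norm_mult using exp_t q_le \<open>D2 \<ge> 0\<close> \<delta> by (intro mult_mono) auto
      then show "cmod ((exp (z * t n) - 1) * q n z + (q n z - U z)) \<le> (D2 * \<delta> ^ n * exp D2) * (BU + D) + D * \<delta> ^ n"
        using q_close[OF n z] by (intro norm_triangle_le add_mono)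
    qed auto
    also have "\<dots> = D3 * \<delta> ^ n" by (simp add: D3_def algebra_simps)
    finally show ?thesis .
  qed
  show thesis
  proof (rule that[of r \<delta> C \<Lambda> U' W])
    show "\<Lambda> holomorphic_on ball 0 r"
    proof -
      have "l z \<notin> \<real>\<^sub>\<le>\<^sub>0" if "z \<in> ball 0 r" for z
        using l_Re[of z] that sub by (auto simp: complex_nonpos_Reals_iff)
      then show ?thesis
        unfolding \<Lambda>_def by (intro holomorphic_intros holomorphic_on_subset[OF l_hol sub])
    qed
    show "U' holomorphic_on ball 0 r"
      unfolding U'_def by (intro holomorphic_intros holomorphic_on_subset[OF U_hol sub])
    show "W n holomorphic_on ball 0 r" for n
      unfolding W_def q_def using l_nz sub
      by (intro holomorphic_intros holomorphic_on_subset[OF l_hol sub] holomorphic_on_subset[OF \<phi>_hol sub]) auto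
    show "\<Lambda> 0 = 0" "U' 0 = 1" "W n 0 = 1" for n
      using \<open>l 0 = 1\<close> \<open>U 0 = 1\<close> by (auto simp: \<Lambda>_def U'_def W_def q_def \<phi>_0)
    show "cmod (W n z - U' z) \<le> C * \<delta> ^ n" if "n \<ge> 1" "z \<in> ball 0 r" for n z
      using C \<delta> by (intro order_trans[OF W_close[OF that]] mult_right_mono) auto
    show "cmod (W n z) \<le> C" if n: "n \<ge> 1" and z: "z \<in> ball 0 r" for n z
    proof -
      have "\<delta> ^ n \<le> 1" using \<delta> by (intro power_le_one) auto
      then have "cmod (W n z - U' z) \<le> D3"
        using \<open>D3 \<ge> 0\<close> by (intro order_trans[OF W_close[OF n z]]) (simp add: mult_left_le)
      moreover have "cmod (U' z) \<le> exp (r * cmod c) * BU"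
        unfolding U'_def norm_mult using z by (intro mult_mono exp_c BU) auto
      ultimately show ?thesis
        using norm_triangle_ineq[of "W n z - U' z" "U' z"] by (simp add: C_def)
    qed
    show "(CLINT \<omega>|M. exp (z * complex_of_real (centered_sum M \<xi> f n \<omega>))) = exp (of_nat n * \<Lambda> z) * W n z"
      if "z \<in> ball 0 r" for n z
      using mgf that sub by blast
  qed (use \<open>r > 0\<close> \<delta> C in auto)
qed

end

theorem theorem23:
  fixes M :: "'w measure" and X :: "'a measure" and K :: "'a \<Rightarrow> 'a measure"
    and \<xi> :: "nat \<Rightarrow> 'w \<Rightarrow> 'a"
    and B :: "('a \<Rightarrow> complex) set" and N :: "('a \<Rightarrow> complex) \<Rightarrow> real"
    and f :: "'a \<Rightarrow> real" and \<sigma> :: real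
  assumes chain: "homogeneous_markov_chain M X K \<xi>"
    and space_B: "complex_banach_function_space X B N"
    and R_bounded: "bounded_op X B N (markov_op K)"
    and exp_B: "\<And>h z. h \<in> B \<Longrightarrow> (\<lambda>x. exp (z * h x)) \<in> B"
    and exp_analytic: "\<And>h z0. h \<in> B \<Longrightarrow> fun_analytic_at B N (\<lambda>z x. exp (z * h x)) z0"
    and f_B: "(\<lambda>x. complex_of_real (f x)) \<in> B"
    and Rz_bounded: "\<And>z. bounded_op X B N (twisted_op K f z)"
    and Rz_analytic: "op_analytic_at X B N (twisted_op K f) 0"
    and quasi_compact: "quasi_compact_op X B N (markov_op K)"
    and peripheral: "only_constant_peripheral_eigenfunctions X B (markov_op K)"
    and convergence: "exponential_convergence X K B N"
    and variance_limit: "(\<lambda>n. prob_space.variance M (centered_sum M \<xi> f n) / real n) \<longlonglongrightarrow> \<sigma>\<^sup>2"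
    and sigma_pos: "\<sigma> > 0"
  shows
    "(\<exists>(V :: complex set) (\<Lambda> :: complex \<Rightarrow> complex) (U :: complex \<Rightarrow> complex)
        (\<Delta> :: nat \<Rightarrow> complex \<Rightarrow> complex) (C :: real) (\<delta> :: real).
        open V \<and> 0 \<in> V \<and> \<Lambda> analytic_on V \<and> U analytic_on V \<and> (\<forall>n\<ge>1. \<Delta> n analytic_on V) \<and>
        C > 0 \<and> 0 < \<delta> \<and> \<delta> < 1 \<and>
        \<Lambda> 0 = 0 \<and> deriv (deriv \<Lambda>) 0 \<in> \<real> \<and> Re (deriv (deriv \<Lambda>) 0) > 0 \<and> U 0 = 1 \<and>
        (\<forall>n\<ge>1. \<forall>z\<in>V. cmod (\<Delta> n z) \<le> C * \<delta> ^ n \<and>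
           (LINT \<omega>|M. exp (z * complex_of_real (centered_sum M \<xi> f n \<omega>)))
             = exp (of_nat n * \<Lambda> z) * (U z + \<Delta> n z)))
     \<and>
     (\<forall>(A :: nat \<Rightarrow> real) (b :: nat \<Rightarrow> real) (m :: nat).
        bounded (range A) \<longrightarrow> (\<forall>n\<ge>1. b n > 0) \<longrightarrow>
        ((\<lambda>n. b n - \<sigma> * sqrt (real n)) \<in> O(\<lambda>_. 1) \<or>
         (\<lambda>n. b n - l2_norm M (centered_sum M \<xi> f n)) \<in> O(\<lambda>_. 1)) \<longrightarrow>
        m \<ge> 2 \<longrightarrow>
        (\<exists>C :: real. \<forall>n\<ge>1. l2_norm M (centered_sum M \<xi> f n) > 0 \<longrightarrow> (\<forall>x :: real.
           \<bar>measure M {\<omega> \<in> space M. (centered_sum M \<xi> f n \<omega> - A n) / b n \<le> x}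
              - cdf std_normal_distribution x\<bar>
             \<le> C * inverse (l2_norm M (centered_sum M \<xi> f n)) * inverse ((1 + \<bar>x\<bar>) ^ m))))"
proof -
  obtain \<mu> \<delta>0 C0 where \<mu>: "stationary_measure X K \<mu>" and \<delta>0: "0 < \<delta>0" "\<delta>0 < 1" "0 < C0"
    and conv: "\<forall>g\<in>B. \<forall>n\<ge>1. N (\<lambda>x. (markov_op K ^^ n) g x - (LINT y|\<mu>. g y)) \<le> C0 * N g * \<delta>0 ^ n"
    using convergence unfolding exponential_convergence_def by (elim exE conjE) (rule that)
  interpret chain: homogeneous_markov_chain M X K \<xi> by (rule chain)
  interpret space: complex_banach_function_space X B N by (rule space_B)
  interpret twisted_chain M X K \<xi> B N f \<mu> \<delta>0 C0
    by unfold_locales (use f_B Rz_bounded Rz_analytic \<mu> \<delta>0 conv in auto)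
  let ?S = "centered_sum M \<xi> f"
  note S_meas = centered_sum_measurable and S_le = centered_sum_le
  define v where "v n = (LINT \<omega>|M. (?S n \<omega>)\<^sup>2)" for n
  have l2: "l2_norm M (?S n) = sqrt (v n)" for n
    by (simp add: l2_norm_def v_def)
  have variance: "chain.variance (?S n) = v n" for n
    by (simp add: centered_sum_expectation v_def)
  have v_nonneg: "0 \<le> v n" for n unfolding v_def by (intro integral_nonneg_AE) simp
  show ?thesis
  proof (rule mgf_decomposition)
    fix r \<Lambda> U W C \<delta>
    assume r: "0 < r" and \<delta>: "0 < \<delta>" "\<delta> < 1" and "0 < C"
      and \<Lambda>_hol: "\<Lambda> holomorphic_on ball 0 r" and U_hol: "U holomorphic_on ball 0 r"
      and W_hol: "\<And>n. W n holomorphic_on ball 0 r"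
      and \<Lambda>_0: "\<Lambda> 0 = 0" and U_0: "U 0 = 1" and W_0: "\<And>n. W n 0 = 1"
      and W_close: "\<And>n z. n \<ge> 1 \<Longrightarrow> z \<in> ball 0 r \<Longrightarrow> cmod (W n z - U z) \<le> C * \<delta> ^ n"
      and W_le: "\<And>n z. n \<ge> 1 \<Longrightarrow> z \<in> ball 0 r \<Longrightarrow> cmod (W n z) \<le> C"
      and mgf: "\<And>n z. z \<in> ball 0 r \<Longrightarrow>
        (CLINT \<omega>|M. exp (z * complex_of_real (?S n \<omega>))) = exp (of_nat n * \<Lambda> z) * W n z"
    note asym = chain.mgf_variance_asymptotics[OF S_meas S_le centered_sum_expectation r \<Lambda>_hol W_hol \<Lambda>_0 W_0 W_le mgf]
    have \<Lambda>': "deriv \<Lambda> 0 = 0" by (rule asym(1))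
    from asym(2) obtain \<beta> where \<beta>: "\<And>n. n \<ge> 1 \<Longrightarrow> cmod (complex_of_real (v n) - of_nat n * deriv (deriv \<Lambda>) 0) \<le> \<beta>"
      unfolding v_def by blast
    \<comment> \<open>The variance is n Lambda''(0) + O(1); dividing by n and comparing with the
      assumed limit identifies the second derivative, in particular as a positive real
      number.\<close>
    have \<Lambda>'': "deriv (deriv \<Lambda>) 0 = (complex_of_real \<sigma>)\<^sup>2"
    proof -
      have "(\<lambda>n. complex_of_real (v n / real n)) \<longlonglongrightarrow> complex_of_real (\<sigma>\<^sup>2)"
        using variance_limit unfolding variance by (rule tendsto_of_real)
      moreover have "(\<lambda>n. complex_of_real (v n / real n) - deriv (deriv \<Lambda>) 0) \<longlonglongrightarrow> 0"
      proof (rule Lim_null_comparison)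
        show "\<forall>\<^sub>F n in sequentially. cmod (complex_of_real (v n / real n) - deriv (deriv \<Lambda>) 0) \<le> \<beta> / real n"
          using eventually_ge_at_top[of 1]
        proof eventually_elim
          case (elim n)
          have "complex_of_real (v n / real n) - deriv (deriv \<Lambda>) 0 = (complex_of_real (v n) - of_nat n * deriv (deriv \<Lambda>) 0) / of_nat n"
            using elim by (simp add: field_simps)
          then show ?case using \<beta>[OF elim] by (simp add: norm_divide divide_right_mono)
        qed
        show "(\<lambda>n. \<beta> / real n) \<longlonglongrightarrow> 0" by (rule lim_const_over_n)
      qed
      then have "(\<lambda>n. complex_of_real (v n / real n)) \<longlonglongrightarrow> deriv (deriv \<Lambda>) 0"
        by (rule LIM_zero_cancel)
      ultimately show ?thesis using LIMSEQ_unique by fastforce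
    qed
    have v_close: "\<bar>v n - \<sigma>\<^sup>2 * real n\<bar> \<le> \<beta>" if "n \<ge> 1" for n
    proof -
      have "complex_of_real (v n) - of_nat n * deriv (deriv \<Lambda>) 0 = complex_of_real (v n - \<sigma>\<^sup>2 * real n)"
        by (simp add: \<Lambda>'')
      then show ?thesis using \<beta>[OF that] by (simp only: norm_of_real)
    qed
    have "\<beta> \<ge> 0" using order_trans[OF abs_ge_zero v_close[of 1]] by simp
    have part1: "\<exists>(V :: complex set) (\<Lambda> :: complex \<Rightarrow> complex) (U :: complex \<Rightarrow> complex)
        (\<Delta> :: nat \<Rightarrow> complex \<Rightarrow> complex) (C :: real) (\<delta> :: real).
        open V \<and> 0 \<in> V \<and> \<Lambda> analytic_on V \<and> U analytic_on V \<and> (\<forall>n\<ge>1. \<Delta> n analytic_on V) \<and>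
        C > 0 \<and> 0 < \<delta> \<and> \<delta> < 1 \<and>
        \<Lambda> 0 = 0 \<and> deriv (deriv \<Lambda>) 0 \<in> \<real> \<and> Re (deriv (deriv \<Lambda>) 0) > 0 \<and> U 0 = 1 \<and>
        (\<forall>n\<ge>1. \<forall>z\<in>V. cmod (\<Delta> n z) \<le> C * \<delta> ^ n \<and>
           (LINT \<omega>|M. exp (z * complex_of_real (centered_sum M \<xi> f n \<omega>)))
             = exp (of_nat n * \<Lambda> z) * (U z + \<Delta> n z))"
    proof (rule exI[of _ "ball 0 r"], rule exI[of _ \<Lambda>], rule exI[of _ U], rule exI[of _ "\<lambda>n z. W n z - U z"],
        rule exI[of _ C], rule exI[of _ \<delta>], intro conjI allI impI ballI)
      show "open (ball (0::complex) r)" "0 \<in> ball (0::complex) r" using r by auto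
      show "\<Lambda> analytic_on ball 0 r" "U analytic_on ball 0 r"
        using \<Lambda>_hol U_hol by (simp_all add: analytic_on_open)
      show "(\<lambda>z. W n z - U z) analytic_on ball 0 r" for n
        unfolding analytic_on_open[OF open_ball] by (intro holomorphic_intros W_hol U_hol)
      have "deriv (deriv \<Lambda>) 0 = complex_of_real (\<sigma>\<^sup>2)" by (simp add: \<Lambda>'')
      then show "deriv (deriv \<Lambda>) 0 \<in> \<real>" "Re (deriv (deriv \<Lambda>) 0) > 0"
        using sigma_pos by (simp_all only: Reals_of_real Re_complex_of_real zero_less_power)
      show "cmod (W n z - U z) \<le> C * \<delta> ^ n" if "n \<ge> 1" "z \<in> ball 0 r" for n z
        by (rule W_close[OF that])
      show "(LINT \<omega>|M. exp (z * complex_of_real (centered_sum M \<xi> f n \<omega>))) = exp (of_nat n * \<Lambda> z) * (U z + (W n z - U z))"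
        if "z \<in> ball 0 r" for n z
        using mgf[OF that] by simp
    qed (use \<open>0 < C\<close> \<delta> \<Lambda>_0 U_0 in auto)
    have part2: "\<exists>C :: real. \<forall>n\<ge>1. l2_norm M (?S n) > 0 \<longrightarrow> (\<forall>x :: real.
           \<bar>measure M {\<omega> \<in> space M. (?S n \<omega> - A n) / b n \<le> x}
              - cdf std_normal_distribution x\<bar>
             \<le> C * inverse (l2_norm M (?S n)) * inverse ((1 + \<bar>x\<bar>) ^ m))"
      if A: "bounded (range A)" and b_pos: "\<forall>n\<ge>1. b n > 0"
        and b: "(\<lambda>n. b n - \<sigma> * sqrt (real n)) \<in> O(\<lambda>_. 1) \<or> (\<lambda>n. b n - l2_norm M (?S n)) \<in> O(\<lambda>_. 1)"
      for A b :: "nat \<Rightarrow> real" and m :: nat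
    proof -
      obtain a where a: "\<And>n. \<bar>A n\<bar> \<le> a" using A by (auto simp: bounded_iff)
      \<comment> \<open>Uses the difference of squares: (sigma_n - sigma sqrt n)(sigma_n + sigma
        sqrt n) is bounded by \<open>\<beta>\<close>, and the second factor is at least sigma for n
        \<ge> 1. It reduces the second normalisation to the first.\<close>
      have l2_close: "\<bar>l2_norm M (?S n) - \<sigma> * sqrt (real n)\<bar> \<le> \<beta> / \<sigma>" if n: "n \<ge> 1" for n
      proof -
        let ?q = "\<sigma> * sqrt (real n)"
        have "\<sigma> * 1 \<le> ?q" using n sigma_pos by (intro mult_left_mono) auto
        then have q: "\<sigma> \<le> sqrt (v n) + ?q" using v_nonneg[of n] by (intro add_increasing) auto
        have "(sqrt (v n) - ?q) * (sqrt (v n) + ?q) = v n - \<sigma>\<^sup>2 * real n"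
          using v_nonneg[of n] by (simp add: algebra_simps power2_eq_square[symmetric] power_mult_distrib)
        then have "\<bar>sqrt (v n) - ?q\<bar> * (sqrt (v n) + ?q) \<le> \<beta>"
          using v_close[OF n] q sigma_pos by (metis abs_mult abs_of_nonneg order_trans less_imp_le)
        moreover have "\<bar>sqrt (v n) - ?q\<bar> * \<sigma> \<le> \<bar>sqrt (v n) - ?q\<bar> * (sqrt (v n) + ?q)"
          using q by (intro mult_left_mono) auto
        ultimately show ?thesis using sigma_pos by (simp add: l2 pos_le_divide_eq)
      qed
      have "\<exists>\<gamma> n0. \<forall>n\<ge>n0. \<bar>b n - \<sigma> * sqrt (real n)\<bar> \<le> \<gamma>"
        using b
      proof
        assume "(\<lambda>n. b n - \<sigma> * sqrt (real n)) \<in> O(\<lambda>_. 1)"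
        then obtain c where "\<forall>\<^sub>F n in sequentially. norm (b n - \<sigma> * sqrt (real n)) \<le> c * norm (1::real)"
          by (elim landau_o.bigE)
        then show ?thesis by (auto simp: eventually_sequentially)
      next
        assume "(\<lambda>n. b n - l2_norm M (?S n)) \<in> O(\<lambda>_. 1)"
        then obtain c where "\<forall>\<^sub>F n in sequentially. norm (b n - l2_norm M (?S n)) \<le> c * norm (1::real)"
          by (elim landau_o.bigE)
        then obtain n0 where n0: "\<And>n. n \<ge> n0 \<Longrightarrow> \<bar>b n - l2_norm M (?S n)\<bar> \<le> c"
          by (auto simp: eventually_sequentially)
        have "\<bar>b n - \<sigma> * sqrt (real n)\<bar> \<le> c + \<beta> / \<sigma>" if "n \<ge> max 1 n0" for n
          using n0[of n] l2_close[of n] that by auto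
        then show ?thesis by blast
      qed
      then obtain \<gamma> n0 where \<gamma>: "\<And>n. n \<ge> n0 \<Longrightarrow> \<bar>b n - \<sigma> * sqrt (real n)\<bar> \<le> \<gamma>" by blast
      \<comment> \<open>Compares sigma_n with sqrt n, so that a rate 1/sqrt n can be restated as a
        rate 1/sigma_n.\<close>
      have l2_le: "l2_norm M (?S n) \<le> sqrt (\<sigma>\<^sup>2 + \<beta>) * sqrt (real n)" if n: "n \<ge> 1" for n
      proof -
        have "\<beta> * 1 \<le> \<beta> * real n" using n \<open>\<beta> \<ge> 0\<close> by (intro mult_left_mono) auto
        then have "v n \<le> (\<sigma>\<^sup>2 + \<beta>) * real n"
          using v_close[OF n] by (simp add: algebra_simps abs_le_iff)
        then show ?thesis unfolding l2 real_sqrt_mult[symmetric] by simp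
      qed
      show ?thesis
      proof (rule chain.nonuniform_berry_esseen[OF S_meas S_le sigma_pos _ l2_le a _ \<gamma>])
        show "\<exists>c\<ge>0. \<exists>n0. \<forall>n\<ge>n0. \<forall>x.
            \<bar>measure M {\<omega> \<in> space M. ?S n \<omega> / (\<sigma> * sqrt (real n)) \<le> x} - cdf std_normal_distribution x\<bar>
              \<le> c / sqrt (real n) * exp (- \<bar>x\<bar>)"
          by (rule chain.mgf_berry_esseen[OF S_meas S_le sigma_pos r \<Lambda>_hol W_hol \<Lambda>_0 \<Lambda>' \<Lambda>'' W_0 W_le mgf])
      qed (use b_pos in auto)
    qed
    from part1 part2 show ?thesis by (intro conjI allI impI)
  qed
qed

end
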